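(* Let $f:\mathbb{R}^n\to\mathbb{R}$ be convex and continuously differentiable, let $R>0$, and consider the problem $\min_{\mathbf{x}\in\mathbb{R}^n:\ \|\mathbf{x}\|_1\le R}f(\mathbf{x})$. Let $\beta_1$ be the Lipschitz constant of $\nabla f$ over the feasible set w.r.t. the $\ell_1$ norm, and let $\alpha_2>0$ be the $\ell_2$-quadratic growth constant (both defined in the context). Assume that any optimal solution $\mathbf{x}^*$ satisfies $\mathrm{nnz}(\mathbf{x}^* )\le s\ll n$ (for a positive integer $s$) and $\|\mathbf{x}^*\|_1=R$, and that the step-size parameter $\eta=\frac{\alpha_2}{48\beta_1 s}$ lies in $[0,1]$. Then the algorithm described in the context admits an implementation that finds an $\epsilon$-approximated solution (in function value) in $O\left(\frac{\beta_1 s}{\alpha_2}\log\frac{1}{\epsilon}\right)$ iterations, and, aside from gradient computations, the runtime of each iteration is $O(n\log s)$. In particular, if $f$ is a (convex) quadratic of the form $f(\mathbf{x})=\frac12\mathbf{x}^\top\mathbf{A}\mathbf{x}+\mathbf{b}^\top\mathbf{x}$, the overall runtime of each iteration is $O(sn)$.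
   Context: $\mathrm{nnz}(\mathbf{x})$ is the number of non-zero entries of $\mathbf{x}$. $\mathcal{K}=\{\mathbf{x}\in\mathbb{R}^n:\|\mathbf{x}\|_1\le R\}$, $f^*$ is the optimal value, $\mathcal{X}^*$ is the set of minimizers over $\mathcal{K}$. The constant $\beta_1>0$ satisfies $\|\nabla f(\mathbf{x})-\nabla f(\mathbf{y})\|_\infty\le\beta_1\|\mathbf{x}-\mathbf{y}\|_1$ for all $\mathbf{x},\mathbf{y}\in\mathcal{K}$. The constant $\alpha_2>0$ satisfies $\min_{\mathbf{x}^*\in\mathcal{X}^*}\|\mathbf{x}-\mathbf{x}^*\|_2^2\le\frac{2}{\alpha_2}(f(\mathbf{x})-f^* )$ for all $\mathbf{x}\in\mathcal{K}$. A feasible point $\mathbf{x}$ is an $\epsilon$-approximated solution (in function value) if $f(\mathbf{x})-f^*\le\epsilon$. In the iteration bound, $O(\cdot)$ hides universal constants and the dependence of the logarithm on the initial error $f(\mathbf{x}_1)-f^*$. Runtime counts arithmetic operations and comparisons on real numbers. Algorithm. Let $\mathbb{E}_s=\{\mathbf{x}\in\mathbb{R}^n:\mathrm{nnz}(\mathbf{x})\le s\}$ and $\mathcal{K}_s=\mathcal{K}\cap\mathbb{E}_s$. Start from some $\mathbf{x}_1\in\mathcal{K}$. With step-size parameter $\eta=\frac{\alpha_2}{48\beta_1 s}$, for $t=1,2,\dots$: - $\widehat{\mathbf{x}}_t\gets$ a Euclidean projection of $\mathbf{x}_t$ onto $\mathbb{E}_s$ (keep $s$ entries largest in absolute value, zero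 the rest); - $\mathbf{v}_t\gets$ an element of $\arg\min_{\mathbf{v}\in\mathcal{K}_s}\langle\mathbf{v}-\mathbf{x}_t,\nabla f(\mathbf{x}_t)\rangle+2s\beta_1\eta\|\mathbf{v}-\widehat{\mathbf{x}}_t\|_2^2$, equivalently a Euclidean projection of $\widehat{\mathbf{x}}_t-\frac{1}{4s\beta_1\eta}\nabla f(\mathbf{x}_t)$ onto $\mathcal{K}_s$; - $\gamma_t\in[0,1]$ is set either by line-search, $\gamma_t\in\arg\min_{\gamma\in[0,1]}f((1-\gamma)\mathbf{x}_t+\gamma\mathbf{v}_t)$, or to the pre-defined value $\gamma_t=\eta$; - $\mathbf{x}_{t+1}\gets(1-\gamma_t)\mathbf{x}_t+\gamma_t\mathbf{v}_t$. *)

theory Defs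
  imports Complex_Main "Jordan_Normal_Form.Matrix"
begin

section \<open>Vectors of varying dimension\<close>

text \<open>The bounds are uniform in the dimension, so the dimension has to be quantified inside the
  statement. Vectors are therefore elements of \<open>carrier_vec n\<close> and not of a type indexed by \<open>n\<close>;
  the analytic notions are spelled out on \<open>carrier_vec n\<close>.\<close>

type_synonym rvec = "real vec"

definition l1 :: "rvec \<Rightarrow> real" where
  "l1 x = (\<Sum>i<dim_vec x. \<bar>x $ i\<bar>)"

definition l2 :: "rvec \<Rightarrow> real" where
  "l2 x = sqrt (x \<bullet> x)"

text \<open>Only meaningful for positive dimension.\<close>
definition linf :: "rvec \<Rightarrow> real" where
  "linf x = Max ((\<lambda>i. \<bar>x $ i\<bar>) ` {..<dim_vec x})"

definition nnz :: "rvec \<Rightarrow> nat" where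
  "nnz x = card {i. i < dim_vec x \<and> x $ i \<noteq> 0}"

definition convex_fun :: "nat \<Rightarrow> (rvec \<Rightarrow> real) \<Rightarrow> bool" where
  "convex_fun n f \<longleftrightarrow>
     (\<forall>x\<in>carrier_vec n. \<forall>y\<in>carrier_vec n. \<forall>u\<in>{0..1}.
        f ((1 - u) \<cdot>\<^sub>v x + u \<cdot>\<^sub>v y) \<le> (1 - u) * f x + u * f y)"

text \<open>Frechet differentiability at \<open>x\<close> with gradient \<open>G\<close>.\<close>
definition has_gradient :: "nat \<Rightarrow> (rvec \<Rightarrow> real) \<Rightarrow> rvec \<Rightarrow> rvec \<Rightarrow> bool" where
  "has_gradient n f G x \<longleftrightarrow> G \<in> carrier_vec n \<and>
     (\<forall>e>0. \<exists>d>0. \<forall>h\<in>carrier_vec n. l2 h < d \<longrightarrow> \<bar>f (x + h) - f x - G \<bullet> h\<bar> \<le> e * l2 h)"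

text \<open>\<open>f\<close> is continuously differentiable on the whole space, with gradient map \<open>g\<close>.\<close>
definition C1_with_gradient :: "nat \<Rightarrow> (rvec \<Rightarrow> real) \<Rightarrow> (rvec \<Rightarrow> rvec) \<Rightarrow> bool" where
  "C1_with_gradient n f g \<longleftrightarrow>
     (\<forall>x\<in>carrier_vec n. has_gradient n f (g x) x) \<and>
     (\<forall>x\<in>carrier_vec n. \<forall>e>0. \<exists>d>0. \<forall>y\<in>carrier_vec n. l2 (y - x) < d \<longrightarrow> l2 (g y - g x) < e)"

section \<open>The optimization problem\<close>

definition l1_ball :: "nat \<Rightarrow> real \<Rightarrow> rvec set" where
  "l1_ball n R = {x \<in> carrier_vec n. l1 x \<le> R}"

definition sparse_vecs :: "nat \<Rightarrow> nat \<Rightarrow> rvec set" where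
  "sparse_vecs n s = {x \<in> carrier_vec n. nnz x \<le> s}"

definition opt_value :: "nat \<Rightarrow> real \<Rightarrow> (rvec \<Rightarrow> real) \<Rightarrow> real" where
  "opt_value n R f = (INF x\<in>l1_ball n R. f x)"

definition minimizers :: "nat \<Rightarrow> real \<Rightarrow> (rvec \<Rightarrow> real) \<Rightarrow> rvec set" where
  "minimizers n R f = {x \<in> l1_ball n R. \<forall>y\<in>l1_ball n R. f x \<le> f y}"

definition gradient_lipschitz :: "nat \<Rightarrow> real \<Rightarrow> (rvec \<Rightarrow> rvec) \<Rightarrow> real \<Rightarrow> bool" where
  "gradient_lipschitz n R g \<beta> \<longleftrightarrow>
     (\<forall>x\<in>l1_ball n R. \<forall>y\<in>l1_ball n R. linf (g x - g y) \<le> \<beta> * l1 (x - y))"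

definition quadratic_growth :: "nat \<Rightarrow> real \<Rightarrow> (rvec \<Rightarrow> real) \<Rightarrow> real \<Rightarrow> bool" where
  "quadratic_growth n R f \<alpha> \<longleftrightarrow>
     (\<forall>x\<in>l1_ball n R.
        (INF xs\<in>minimizers n R f. (l2 (x - xs))\<^sup>2) \<le> 2 / \<alpha> * (f x - opt_value n R f))"

definition approx_solution :: "nat \<Rightarrow> real \<Rightarrow> (rvec \<Rightarrow> real) \<Rightarrow> real \<Rightarrow> rvec \<Rightarrow> bool" where
  "approx_solution n R f \<epsilon> x \<longleftrightarrow> x \<in> l1_ball n R \<and> f x - opt_value n R f \<le> \<epsilon>"

definition quadratic_fun :: "nat \<Rightarrow> real mat \<Rightarrow> rvec \<Rightarrow> (rvec \<Rightarrow> real) \<Rightarrow> bool" where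
  "quadratic_fun n A b f \<longleftrightarrow> A \<in> carrier_mat n n \<and> b \<in> carrier_vec n \<and>
     (\<forall>x\<in>carrier_vec n. f x = 1 / 2 * (x \<bullet> (A *\<^sub>v x)) + b \<bullet> x)"

section \<open>The algorithm\<close>

definition eta :: "real \<Rightarrow> real \<Rightarrow> nat \<Rightarrow> real" where
  "eta \<beta> \<alpha> s = \<alpha> / (48 * \<beta> * real s)"

definition is_projection :: "rvec set \<Rightarrow> rvec \<Rightarrow> rvec \<Rightarrow> bool" where
  "is_projection S x y \<longleftrightarrow> y \<in> S \<and> (\<forall>z\<in>S. l2 (x - y) \<le> l2 (x - z))"

definition subproblem :: "(rvec \<Rightarrow> rvec) \<Rightarrow> real \<Rightarrow> real \<Rightarrow> nat \<Rightarrow> rvec \<Rightarrow> rvec \<Rightarrow> rvec \<Rightarrow> real" where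
  "subproblem g \<beta> \<alpha> s x xhat v =
     (v - x) \<bullet> g x + 2 * real s * \<beta> * eta \<beta> \<alpha> s * (l2 (v - xhat))\<^sup>2"

definition is_line_search :: "(rvec \<Rightarrow> real) \<Rightarrow> rvec \<Rightarrow> rvec \<Rightarrow> real \<Rightarrow> bool" where
  "is_line_search f x v \<gamma> \<longleftrightarrow> \<gamma> \<in> {0..1} \<and>
     (\<forall>\<gamma>'\<in>{0..1}. f ((1 - \<gamma>) \<cdot>\<^sub>v x + \<gamma> \<cdot>\<^sub>v v) \<le> f ((1 - \<gamma>') \<cdot>\<^sub>v x + \<gamma>' \<cdot>\<^sub>v v))"

text \<open>One iteration, as a relation: ties in the projection and in the subproblem are broken
  arbitrarily, and either step-size rule may be used.\<close>
definition fw_step :: "nat \<Rightarrow> (rvec \<Rightarrow> real) \<Rightarrow> (rvec \<Rightarrow> rvec) \<Rightarrow> real \<Rightarrow> real \<Rightarrow> real \<Rightarrow> nat \<Rightarrow>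
    rvec \<Rightarrow> rvec \<Rightarrow> bool" where
  "fw_step n f g R \<beta> \<alpha> s x x' \<longleftrightarrow>
     (\<exists>xhat v \<gamma>.
        is_projection (sparse_vecs n s) x xhat \<and>
        v \<in> l1_ball n R \<inter> sparse_vecs n s \<and>
        (\<forall>w \<in> l1_ball n R \<inter> sparse_vecs n s.
           subproblem g \<beta> \<alpha> s x xhat v \<le> subproblem g \<beta> \<alpha> s x xhat w) \<and>
        (is_line_search f x v \<gamma> \<or> \<gamma> = eta \<beta> \<alpha> s) \<and>
        x' = (1 - \<gamma>) \<cdot>\<^sub>v x + \<gamma> \<cdot>\<^sub>v v)"

text \<open>\<open>x t\<close> is the point reached after \<open>t\<close> iterations, so \<open>x 0\<close> is the starting point.\<close>
definition fw_run :: "nat \<Rightarrow> (rvec \<Rightarrow> real) \<Rightarrow> (rvec \<Rightarrow> rvec) \<Rightarrow> real \<Rightarrow> real \<Rightarrow> real \<Rightarrow> nat \<Rightarrow>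
    (nat \<Rightarrow> rvec) \<Rightarrow> bool" where
  "fw_run n f g R \<beta> \<alpha> s x \<longleftrightarrow>
     x 0 \<in> l1_ball n R \<and> (\<forall>t. fw_step n f g R \<beta> \<alpha> s (x t) (x (Suc t)))"

section \<open>A real-number machine\<close>

text \<open>A deterministic while-language with arrays of naturals (for indexing and control) and arrays
  of reals. The cost of an execution is its number of arithmetic operations and comparisons on
  reals; data movement and computations on naturals are free. Reals influence the naturals and
  the control flow only through comparisons, each of which is charged, and a natural becomes a
  real only through \<open>ROfNat\<close>, which is charged as well. The only constants are naturals.
  Division by zero yields zero.\<close>

record mem =
  ints :: "string \<Rightarrow> nat \<Rightarrow> nat"
  reals :: "string \<Rightarrow> nat \<Rightarrow> real"

datatype iexp =
    IConst nat
  | ICell string iexp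
  | IPlus iexp iexp
  | IMinus iexp iexp
  | ITimes iexp iexp
  | IDiv iexp iexp

primrec ival :: "iexp \<Rightarrow> mem \<Rightarrow> nat" where
  "ival (IConst k) \<sigma> = k"
| "ival (ICell a i) \<sigma> = ints \<sigma> a (ival i \<sigma>)"
| "ival (IPlus i j) \<sigma> = ival i \<sigma> + ival j \<sigma>"
| "ival (IMinus i j) \<sigma> = ival i \<sigma> - ival j \<sigma>"
| "ival (ITimes i j) \<sigma> = ival i \<sigma> * ival j \<sigma>"
| "ival (IDiv i j) \<sigma> = ival i \<sigma> div ival j \<sigma>"

datatype rexp =
    RCell string iexp
  | ROfNat iexp
  | RPlus rexp rexp
  | RMinus rexp rexp
  | RTimes rexp rexp
  | RDiv rexp rexp

primrec rval :: "rexp \<Rightarrow> mem \<Rightarrow> real" where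
  "rval (RCell a i) \<sigma> = reals \<sigma> a (ival i \<sigma>)"
| "rval (ROfNat i) \<sigma> = real (ival i \<sigma>)"
| "rval (RPlus p q) \<sigma> = rval p \<sigma> + rval q \<sigma>"
| "rval (RMinus p q) \<sigma> = rval p \<sigma> - rval q \<sigma>"
| "rval (RTimes p q) \<sigma> = rval p \<sigma> * rval q \<sigma>"
| "rval (RDiv p q) \<sigma> = rval p \<sigma> / rval q \<sigma>"

primrec rcost :: "rexp \<Rightarrow> nat" where
  "rcost (RCell a i) = 0"
| "rcost (ROfNat i) = 1"
| "rcost (RPlus p q) = rcost p + rcost q + 1"
| "rcost (RMinus p q) = rcost p + rcost q + 1"
| "rcost (RTimes p q) = rcost p + rcost q + 1"
| "rcost (RDiv p q) = rcost p + rcost q + 1"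

datatype bexp =
    ILess iexp iexp
  | RLess rexp rexp
  | BNot bexp
  | BAnd bexp bexp

primrec bval :: "bexp \<Rightarrow> mem \<Rightarrow> bool" where
  "bval (ILess i j) \<sigma> \<longleftrightarrow> ival i \<sigma> < ival j \<sigma>"
| "bval (RLess p q) \<sigma> \<longleftrightarrow> rval p \<sigma> < rval q \<sigma>"
| "bval (BNot b) \<sigma> \<longleftrightarrow> \<not> bval b \<sigma>"
| "bval (BAnd b c) \<sigma> \<longleftrightarrow> bval b \<sigma> \<and> bval c \<sigma>"

text \<open>Conjunction is not short-circuit: both sides are charged.\<close>
primrec bcost :: "bexp \<Rightarrow> nat" where
  "bcost (ILess i j) = 0"
| "bcost (RLess p q) = rcost p + rcost q + 1"
| "bcost (BNot b) = bcost b"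
| "bcost (BAnd b c) = bcost b + bcost c"

datatype com =
    Skip
  | SetInt string iexp iexp
  | SetReal string iexp rexp
  | Seq com com
  | Cond bexp com com
  | Loop bexp com

definition put_int :: "string \<Rightarrow> nat \<Rightarrow> nat \<Rightarrow> mem \<Rightarrow> mem" where
  "put_int a i k \<sigma> = \<sigma>\<lparr>ints := (ints \<sigma>)(a := (ints \<sigma> a)(i := k))\<rparr>"

definition put_real :: "string \<Rightarrow> nat \<Rightarrow> real \<Rightarrow> mem \<Rightarrow> mem" where
  "put_real a i r \<sigma> = \<sigma>\<lparr>reals := (reals \<sigma>)(a := (reals \<sigma> a)(i := r))\<rparr>"

text \<open>\<open>exec c \<sigma> k \<sigma>'\<close>: started in memory \<open>\<sigma>\<close>, the program \<open>c\<close> terminates in memory \<open>\<sigma>'\<close> at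
  cost \<open>k\<close>.\<close>
inductive exec :: "com \<Rightarrow> mem \<Rightarrow> nat \<Rightarrow> mem \<Rightarrow> bool" where
  Skip: "exec Skip \<sigma> 0 \<sigma>"
| SetInt: "exec (SetInt a i e) \<sigma> 0 (put_int a (ival i \<sigma>) (ival e \<sigma>) \<sigma>)"
| SetReal: "exec (SetReal a i e) \<sigma> (rcost e) (put_real a (ival i \<sigma>) (rval e \<sigma>) \<sigma>)"
| Seq: "exec c \<sigma> k \<sigma>' \<Longrightarrow> exec d \<sigma>' l \<sigma>'' \<Longrightarrow> exec (Seq c d) \<sigma> (k + l) \<sigma>''"
| CondTrue: "bval b \<sigma> \<Longrightarrow> exec c \<sigma> k \<sigma>' \<Longrightarrow> exec (Cond b c d) \<sigma> (bcost b + k) \<sigma>'"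
| CondFalse: "\<not> bval b \<sigma> \<Longrightarrow> exec d \<sigma> k \<sigma>' \<Longrightarrow> exec (Cond b c d) \<sigma> (bcost b + k) \<sigma>'"
| LoopFalse: "\<not> bval b \<sigma> \<Longrightarrow> exec (Loop b c) \<sigma> (bcost b) \<sigma>"
| LoopTrue: "bval b \<sigma> \<Longrightarrow> exec c \<sigma> k \<sigma>' \<Longrightarrow> exec (Loop b c) \<sigma>' l \<sigma>'' \<Longrightarrow>
    exec (Loop b c) \<sigma> (bcost b + k + l) \<sigma>''"

section \<open>Implementations of the algorithm\<close>

definition read_vec :: "nat \<Rightarrow> string \<Rightarrow> mem \<Rightarrow> rvec" where
  "read_vec n a \<sigma> = vec n (reals \<sigma> a)"

definition write_vec :: "string \<Rightarrow> rvec \<Rightarrow> mem \<Rightarrow> mem" where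
  "write_vec a v \<sigma> = \<sigma>\<lparr>reals := (reals \<sigma>)
     (a := (\<lambda>i. if i < dim_vec v then v $ i else reals \<sigma> a i))\<rparr>"

text \<open>The input as laid out in memory. All other cells have arbitrary contents.\<close>
definition holds_input :: "nat \<Rightarrow> real \<Rightarrow> real \<Rightarrow> real \<Rightarrow> nat \<Rightarrow> mem \<Rightarrow> bool" where
  "holds_input n R \<beta> \<alpha> s \<sigma> \<longleftrightarrow>
     ints \<sigma> ''n'' 0 = n \<and> ints \<sigma> ''s'' 0 = s \<and>
     reals \<sigma> ''R'' 0 = R \<and> reals \<sigma> ''beta'' 0 = \<beta> \<and> reals \<sigma> ''alpha'' 0 = \<alpha> \<and>
     read_vec n ''x'' \<sigma> \<in> l1_ball n R"

definition holds_quadratic :: "nat \<Rightarrow> real mat \<Rightarrow> rvec \<Rightarrow> mem \<Rightarrow> bool" where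
  "holds_quadratic n A b \<sigma> \<longleftrightarrow>
     (\<forall>i<n. \<forall>j<n. reals \<sigma> ''A'' (i * n + j) = A $$ (i, j)) \<and> read_vec n ''b'' \<sigma> = b"

text \<open>The current iterate is kept in array \<open>x\<close>. Before each iteration the gradient at the current
  iterate is put into array \<open>grad\<close> at no cost; this is the only access to the objective. Then the
  same program \<open>c\<close> is run, at cost at most \<open>T\<close>. Here \<open>\<sigma> t\<close> is the memory after \<open>t\<close> iterations.\<close>
definition oracle_run :: "com \<Rightarrow> nat \<Rightarrow> (rvec \<Rightarrow> rvec) \<Rightarrow> real \<Rightarrow> (nat \<Rightarrow> mem) \<Rightarrow> bool" where
  "oracle_run c n g T \<sigma> \<longleftrightarrow>
     (\<forall>t. \<exists>k. exec c (write_vec ''grad'' (g (read_vec n ''x'' (\<sigma> t))) (\<sigma> t)) k (\<sigma> (Suc t)) \<and>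
        real k \<le> T)"

text \<open>The same without any oracle: all work, including the gradient computation, is done by \<open>c\<close>.\<close>
definition plain_run :: "com \<Rightarrow> real \<Rightarrow> (nat \<Rightarrow> mem) \<Rightarrow> bool" where
  "plain_run c T \<sigma> \<longleftrightarrow> (\<forall>t. \<exists>k. exec c (\<sigma> t) k (\<sigma> (Suc t)) \<and> real k \<le> T)"

end

theory Submission
  imports Defs "HOL-Library.Log_Nat"
begin

text \<open>Convergence. Let \<open>h\<close> be the distance to the optimal value. Comparing the nonconvex subproblem with
  a minimizer \<open>z\<close>, which is feasible for it, shows that one step with \<open>\<gamma> = \<eta>\<close> turns \<open>h\<close> into at most
  \<open>(1 - \<eta>) h + 9 s \<beta> \<eta>\<^sup>2 \<parallel>x - z\<parallel>\<^sup>2\<close>. The \<open>\<ell>\<^sub>1\<close> smoothness term is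
  affordable because \<open>v - xhat\<close> is \<open>2 s\<close>-sparse and because \<open>\<parallel>z\<parallel>\<^sub>1 = R\<close> bounds the tail
  \<open>\<parallel>x - xhat\<parallel>\<^sub>1\<close> by \<open>sqrt s \<parallel>x - z\<parallel>\<close>. Quadratic growth then yields the contraction factor \<open>1 - 5/8 \<eta>\<close>.

  Implementation. The \<open>s\<close> largest entries are kept in a sorted array of indices; inserting an
  index costs a binary search, since moving data is free. Applied to \<open>x\<close>, this gives \<open>xhat\<close>. Applied to
  \<open>w = xhat - 12 \<nabla>f / \<alpha>\<close> (note \<open>1 / (4 s \<beta> \<eta>) = 12 / \<alpha>\<close>), it reduces
  the subproblem to soft thresholding of the selected entries, with a threshold read off the prefix sums. For quadratic objectives the gradient is affine, so moving from
  \<open>x\<close> to \<open>(1 - \<eta>) x + \<eta> v\<close> updates it by \<open>s\<close> columns of the matrix.\<close>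

section \<open>Norms\<close>

text \<open>Smoothness is measured in l1, growth in l2, and the iterates may be dense, being convex
  combinations of many sparse points; comparing the two norms of \<open>v - x\<close> directly would
  cost a factor n. This is why the subproblem is centred at \<open>xhat\<close> and not at
  \<open>x\<close>: its coefficient \<open>2 s \<beta> \<eta>\<close> absorbs exactly the part of
  the smoothness term that comes from \<open>v - xhat\<close>. What remains is 1 (the tail) plus 8
  (the proximal term at \<open>z\<close>) times s \<beta> \<eta>^2 times the squared distance, hence
  the 9; quadratic growth and the 48 in \<eta> turn this into 3/8 \<eta>, and 1 - 3/8 = 5/8. Line
  search does at least as well as \<gamma> = \<eta>, so only that step is analysed; the programs
  take it because they never evaluate \<open>f\<close>. Growth speaks of an infimum over the
  minimizers, so their existence has to be proved, by compactness of the ball. For quadratic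
  objectives, recomputing the gradient at a dense iterate would cost n^2. The gradient is therefore
  kept in memory as part of the loop invariant, and only the initial one needs a full product with
  the starting point.\<close>

lemma scalar_prod_sum:
  fixes x y :: rvec
  assumes "y \<in> carrier_vec n"
  shows "x \<bullet> y = (\<Sum>i<n. x $ i * y $ i)"
  using assms by (simp add: scalar_prod_def atLeast0LessThan)

lemma l2_sq: "(l2 x)\<^sup>2 = (\<Sum>i<dim_vec x. (x $ i)\<^sup>2)"
  by (simp add: l2_def scalar_prod_def atLeast0LessThan power2_eq_square sum_nonneg)

lemma l2_nonneg [simp]: "0 \<le> l2 x"
  by (simp add: l2_def scalar_prod_def sum_nonneg)

lemma l2_le_iff: "l2 x \<le> l2 y \<longleftrightarrow> (l2 x)\<^sup>2 \<le> (l2 y)\<^sup>2"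
  by (meson l2_nonneg power2_le_imp_le power_mono)

lemma l2_smult: "l2 (c \<cdot>\<^sub>v x) = \<bar>c\<bar> * l2 x"
proof -
  have "(l2 (c \<cdot>\<^sub>v x))\<^sup>2 = (\<bar>c\<bar> * l2 x)\<^sup>2"
    unfolding power_mult_distrib l2_sq by (simp add: power_mult_distrib sum_distrib_left)
  then show ?thesis
    by (simp add: power2_eq_iff_nonneg)
qed

lemma l1_nonneg [simp]: "0 \<le> l1 x"
  by (simp add: l1_def sum_nonneg)

lemma l1_smult: "l1 (c \<cdot>\<^sub>v x) = \<bar>c\<bar> * l1 x"
  by (simp add: l1_def abs_mult sum_distrib_left)

lemma l1_add_le:
  assumes "x \<in> carrier_vec n" "y \<in> carrier_vec n"
  shows "l1 (x + y) \<le> l1 x + l1 y"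
  using assms by (simp add: l1_def sum.distrib [symmetric] sum_mono)

text \<open>Holder's inequality. In dimension 0 the maximum in \<open>linf\<close> ranges over the
  empty set, but there it is multiplied by \<open>l1 b = 0\<close>.\<close>

lemma linf_holder:
  assumes "a \<in> carrier_vec n" "b \<in> carrier_vec n"
  shows "\<bar>a \<bullet> b\<bar> \<le> linf a * l1 b"
proof -
  have le: "\<bar>a $ i\<bar> \<le> linf a" if "i < n" for i
    using that assms unfolding linf_def by (intro Max_ge) auto
  have "\<bar>a \<bullet> b\<bar> \<le> (\<Sum>i<n. \<bar>a $ i\<bar> * \<bar>b $ i\<bar>)"
    unfolding scalar_prod_sum [OF assms(2)] by (rule order_trans [OF sum_abs]) (simp add: abs_mult)
  also have "\<dots> \<le> (\<Sum>i<n. linf a * \<bar>b $ i\<bar>)"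
    using le by (intro sum_mono mult_right_mono) auto
  finally show ?thesis
    using assms by (simp add: l1_def sum_distrib_left)
qed

text \<open>Cauchy-Schwarz against the constant 1: expand the square into a double sum and bound
  each product by the mean of the two squares.\<close>

lemma sq_sum_abs_le:
  fixes a :: "'a \<Rightarrow> real"
  assumes "finite S"
  shows "(\<Sum>i\<in>S. \<bar>a i\<bar>)\<^sup>2 \<le> real (card S) * (\<Sum>i\<in>S. (a i)\<^sup>2)"
proof -
  have "(\<Sum>i\<in>S. \<bar>a i\<bar>)\<^sup>2 = (\<Sum>i\<in>S. \<Sum>j\<in>S. \<bar>a i\<bar> * \<bar>a j\<bar>)"
    by (simp add: power2_eq_square sum_product)
  also have "\<dots> \<le> (\<Sum>i\<in>S. \<Sum>j\<in>S. ((a i)\<^sup>2 + (a j)\<^sup>2) / 2)"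
  proof (intro sum_mono)
    show "\<bar>a i\<bar> * \<bar>a j\<bar> \<le> ((a i)\<^sup>2 + (a j)\<^sup>2) / 2" for i j
      using sum_squares_bound [of "\<bar>a i\<bar>" "\<bar>a j\<bar>"] by simp
  qed
  also have "\<dots> = real (card S) * (\<Sum>i\<in>S. (a i)\<^sup>2)"
    by (simp add: sum_divide_distrib [symmetric] sum.distrib sum_distrib_left [symmetric])
  finally show ?thesis .
qed

text \<open>Cauchy-Schwarz on the support only: passing from l2 to l1 costs the sparsity instead of
  the dimension.\<close>

lemma l1_sq_le: "(l1 x)\<^sup>2 \<le> real (nnz x) * (l2 x)\<^sup>2"
proof -
  let ?S = "{i. i < dim_vec x \<and> x $ i \<noteq> 0}"
  have "l1 x = (\<Sum>i\<in>?S. \<bar>x $ i\<bar>)" "(l2 x)\<^sup>2 = (\<Sum>i\<in>?S. (x $ i)\<^sup>2)"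
    unfolding l1_def l2_sq by (auto intro!: sum.mono_neutral_right)
  then show ?thesis
    unfolding nnz_def using sq_sum_abs_le [of ?S "\<lambda>i. x $ i"] by (simp only: finite_Collect_conjI finite_Collect_less_nat simp_thms)
qed

lemma l1_ball_convex:
  assumes "x \<in> l1_ball n R" "y \<in> l1_ball n R" "u \<in> {0..1}"
  shows "(1 - u) \<cdot>\<^sub>v x + u \<cdot>\<^sub>v y \<in> l1_ball n R"
proof -
  have c: "x \<in> carrier_vec n" "y \<in> carrier_vec n"
    using assms by (auto simp: l1_ball_def)
  have "l1 ((1 - u) \<cdot>\<^sub>v x + u \<cdot>\<^sub>v y) \<le> (1 - u) * l1 x + u * l1 y"
    using l1_add_le [of "(1 - u) \<cdot>\<^sub>v x" n "u \<cdot>\<^sub>v y"] c assms(3) by (simp add: l1_smult)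
  also have "\<dots> \<le> (1 - u) * R + u * R"
    using assms by (intro add_mono mult_left_mono) (auto simp: l1_ball_def)
  finally show ?thesis
    using c by (simp add: l1_ball_def algebra_simps)
qed

section \<open>Sparse vectors\<close>

text \<open>An exchange argument: after cancelling the common part, the maximum of \<open>a\<close>
  over \<open>Z - P\<close> is a level that separates the two differences, and \<open>P - Z\<close>
  has at least as many elements.\<close>

lemma sum_le_sum_top:
  fixes a :: "'a \<Rightarrow> real"
  assumes "finite P" "finite Z" "card Z \<le> card P"
    and top: "\<And>i j. i \<in> P \<Longrightarrow> j \<in> Z - P \<Longrightarrow> a j \<le> a i"
    and nonneg: "\<And>i. 0 \<le> a i"
  shows "sum a Z \<le> sum a P"
proof -
  have "sum a (Z - P) \<le> sum a (P - Z)"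
  proof (cases "Z - P = {} \<or> P - Z = {}")
    case True
    then show ?thesis
    proof
      assume empty: "Z - P = {}"
      show ?thesis
        unfolding empty using nonneg by (simp add: sum_nonneg)
    next
      assume "P - Z = {}"
      then have "Z = P"
        using assms(1-3) card_seteq [of Z P] by auto
      then show ?thesis by simp
    qed
  next
    case False
    define m where "m = Max (a ` (Z - P))"
    have m: "\<And>j. j \<in> Z - P \<Longrightarrow> a j \<le> m" "m \<in> a ` (Z - P)"
      using False assms(2) unfolding m_def by (auto intro: Max_ge Max_in)
    have m': "m \<le> a i" if "i \<in> P" for i
      using m(2) top that by auto
    have card: "card (Z - P) \<le> card (P - Z)"
      using assms(1-3) by (simp add: card_Diff_subset_Int Int_commute)
    have "sum a (Z - P) \<le> real (card (Z - P)) * m"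
      using m by (intro sum_bounded_above) auto
    also have "\<dots> \<le> real (card (P - Z)) * m"
      using card m(2) nonneg by (intro mult_right_mono) auto
    also have "\<dots> \<le> sum a (P - Z)"
      using m' by (intro sum_bounded_below) auto
    finally show ?thesis .
  qed
  moreover have "sum a Z = sum a (Z \<inter> P) + sum a (Z - P)" "sum a P = sum a (P \<inter> Z) + sum a (P - Z)"
    using assms(1,2) by (simp_all add: sum.Int_Diff [symmetric])
  ultimately show ?thesis
    by (simp add: Int_commute)
qed

text \<open>Ties are arbitrary, so the shape of a projection is extracted from its optimality alone,
  by comparing it with the vectors that keep \<open>x\<close> on a set \<open>U\<close> of at most
  \<open>s\<close> indices. Taking \<open>U = S\<close>, exchanging \<open>i\<close> for
  \<open>j\<close>, and adding \<open>j\<close> give the three claims. The support \<open>S\<close>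
  may have fewer than \<open>s\<close> elements, hence the third one.\<close>

lemma projection_properties:
  assumes "is_projection (sparse_vecs n s) x y" "x \<in> carrier_vec n"
  defines "S \<equiv> {i. i < n \<and> y $ i \<noteq> 0}"
  shows "\<And>i. i \<in> S \<Longrightarrow> y $ i = x $ i"
    and "\<And>i j. i \<in> S \<Longrightarrow> j < n \<Longrightarrow> j \<notin> S \<Longrightarrow> \<bar>x $ j\<bar> \<le> \<bar>x $ i\<bar>"
    and "\<And>j. card S < s \<Longrightarrow> j < n \<Longrightarrow> j \<notin> S \<Longrightarrow> x $ j = 0"
proof -
  have y: "y \<in> carrier_vec n" "card S \<le> s"
    and opt: "\<And>z. z \<in> carrier_vec n \<Longrightarrow> nnz z \<le> s \<Longrightarrow> (l2 (x - y))\<^sup>2 \<le> (l2 (x - z))\<^sup>2"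
    using assms(1,2) by (auto simp: is_projection_def sparse_vecs_def nnz_def S_def intro!: power_mono)
  have fS: "finite S" "S \<subseteq> {..<n}" by (auto simp: S_def)
  \<comment> \<open>Both errors are written as the total energy of \<open>x\<close> minus what is
    kept, so that the terms outside cancel.\<close>
  have key: "(\<Sum>i\<in>U. (x $ i)\<^sup>2) \<le> (\<Sum>i\<in>S. (x $ i)\<^sup>2) - (\<Sum>i\<in>S. (x $ i - y $ i)\<^sup>2)"
    if U: "U \<subseteq> {..<n}" "card U \<le> s" for U
  proof -
    define z where "z = vec n (\<lambda>i. if i \<in> U then x $ i else 0)"
    have z: "z \<in> carrier_vec n" by (simp add: z_def)
    have "finite U" using U finite_subset by blast
    then have "nnz z \<le> card U"
      unfolding nnz_def by (intro card_mono) (auto simp: z_def split: if_splits)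
    then have "(l2 (x - y))\<^sup>2 \<le> (l2 (x - z))\<^sup>2"
      using U opt z by simp
    moreover have "(l2 (x - z))\<^sup>2 = (\<Sum>i\<in>{..<n} - U. (x $ i)\<^sup>2)"
      unfolding l2_sq using assms(2) z
      by (auto simp: z_def intro!: sum.mono_neutral_cong_right)
    moreover have "\<dots> = (\<Sum>i<n. (x $ i)\<^sup>2) - (\<Sum>i\<in>U. (x $ i)\<^sup>2)"
      using U \<open>finite U\<close> by (simp add: sum_diff)
    moreover have "(l2 (x - y))\<^sup>2 = (\<Sum>i<n. (x $ i - y $ i)\<^sup>2)"
      unfolding l2_sq using assms(2) y by simp
    moreover have "\<dots> = (\<Sum>i\<in>S. (x $ i - y $ i)\<^sup>2) + (\<Sum>i\<in>{..<n} - S. (x $ i - y $ i)\<^sup>2)"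
      using fS by (simp add: sum_diff)
    moreover have "(\<Sum>i\<in>{..<n} - S. (x $ i - y $ i)\<^sup>2) = (\<Sum>i\<in>{..<n} - S. (x $ i)\<^sup>2)"
      by (intro sum.cong) (auto simp: S_def)
    moreover have "\<dots> = (\<Sum>i<n. (x $ i)\<^sup>2) - (\<Sum>i\<in>S. (x $ i)\<^sup>2)"
      using fS by (simp add: sum_diff)
    ultimately show ?thesis by linarith
  qed
  have nn: "0 \<le> (\<Sum>i\<in>S. (x $ i - y $ i)\<^sup>2)" by (simp add: sum_nonneg)
  show "y $ i = x $ i" if "i \<in> S" for i
  proof -
    have "(\<Sum>i\<in>S. (x $ i - y $ i)\<^sup>2) = 0"
      using key [OF fS(2) y(2)] nn by linarith
    then show ?thesis
      using fS(1) that by (simp add: sum_nonneg_eq_0_iff)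
  qed
  show "\<bar>x $ j\<bar> \<le> \<bar>x $ i\<bar>" if "i \<in> S" "j < n" "j \<notin> S" for i j
  proof -
    have "card (insert j (S - {i})) = card S"
      using that fS card_Suc_Diff1 [of S i] by simp
    moreover have "insert j (S - {i}) \<subseteq> {..<n}" using that fS by auto
    ultimately have "(\<Sum>k\<in>insert j (S - {i}). (x $ k)\<^sup>2) \<le> (\<Sum>k\<in>S. (x $ k)\<^sup>2)"
      using key [of "insert j (S - {i})"] y nn by simp
    then have "(x $ j)\<^sup>2 \<le> (x $ i)\<^sup>2"
      using that fS by (simp add: sum.remove [of S i])
    then show ?thesis by (simp add: abs_le_square_iff)
  qed
  show "x $ j = 0" if "card S < s" "j < n" "j \<notin> S" for j
  proof -
    have "(\<Sum>k\<in>insert j S. (x $ k)\<^sup>2) \<le> (\<Sum>k\<in>S. (x $ k)\<^sup>2) - (\<Sum>k\<in>S. (x $ k - y $ k)\<^sup>2)"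
      using that fS by (intro key) auto
    also have "(\<Sum>k\<in>insert j S. (x $ k)\<^sup>2) = (x $ j)\<^sup>2 + (\<Sum>k\<in>S. (x $ k)\<^sup>2)"
      using that fS by simp
    finally have "(x $ j)\<^sup>2 \<le> 0" using nn by linarith
    then show ?thesis by simp
  qed
qed

text \<open>With \<open>T\<close> the support of \<open>z\<close>: the tail is \<open>l1 x\<close>
  minus the mass of \<open>x\<close> on \<open>S\<close>, hence at most \<open>l1 z\<close> minus
  the mass of \<open>x\<close> on \<open>T\<close>. This is a sum over \<open>T\<close> alone,
  bounded by the mass of \<open>x - z\<close> there, and Cauchy-Schwarz costs only
  \<open>card T\<close>.\<close>

lemma projection_tail_bound:
  assumes proj: "is_projection (sparse_vecs n s) x y"
    and x: "x \<in> carrier_vec n" and z: "z \<in> carrier_vec n" "nnz z \<le> s" "l1 x \<le> l1 z"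
  shows "(l1 (x - y))\<^sup>2 \<le> real s * (l2 (x - z))\<^sup>2"
proof -
  define S where "S = {i. i < n \<and> y $ i \<noteq> 0}"
  define T where "T = {i. i < n \<and> z $ i \<noteq> 0}"
  note props = projection_properties [OF proj x, folded S_def]
  have y: "y \<in> carrier_vec n" "card S \<le> s"
    using proj by (auto simp: is_projection_def sparse_vecs_def nnz_def S_def)
  have T: "card T \<le> s" using z by (auto simp: nnz_def T_def)
  have fin: "finite S" "S \<subseteq> {..<n}" "finite T" "T \<subseteq> {..<n}" by (auto simp: S_def T_def)
  have "l1 (x - y) = (\<Sum>i<n. \<bar>x $ i - y $ i\<bar>)"
    using x y by (simp add: l1_def)
  also have "\<dots> = (\<Sum>i\<in>{..<n} - S. \<bar>x $ i\<bar>)"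
    using props(1) by (intro sum.mono_neutral_cong_right) (auto simp: S_def)
  also have "\<dots> = l1 x - (\<Sum>i\<in>S. \<bar>x $ i\<bar>)"
    using fin x by (simp add: l1_def sum_diff)
  also have "(\<Sum>i\<in>T. \<bar>x $ i\<bar>) \<le> (\<Sum>i\<in>S. \<bar>x $ i\<bar>)"
  \<comment> \<open>Either \<open>x\<close> vanishes outside \<open>S\<close>, or \<open>S\<close>
    has full size \<open>s\<close> and the exchange argument applies.\<close>
  proof (cases "card S < s")
    case True
    have "(\<Sum>i\<in>T. \<bar>x $ i\<bar>) \<le> (\<Sum>i<n. \<bar>x $ i\<bar>)"
      using fin by (intro sum_mono2) auto
    also have "\<dots> = (\<Sum>i\<in>S. \<bar>x $ i\<bar>)"
      using fin props(3) [OF True] by (intro sum.mono_neutral_right) auto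
    finally show ?thesis .
  next
    case False
    then show ?thesis
      using fin y T props(2) by (intro sum_le_sum_top) (auto simp: subset_iff)
  qed
  then have "l1 x - (\<Sum>i\<in>S. \<bar>x $ i\<bar>) \<le> l1 z - (\<Sum>i\<in>T. \<bar>x $ i\<bar>)"
    using z by linarith
  also have "l1 z = (\<Sum>i\<in>T. \<bar>z $ i\<bar>)"
    unfolding l1_def using z fin by (intro sum.mono_neutral_right) (auto simp: T_def)
  also have "\<dots> - (\<Sum>i\<in>T. \<bar>x $ i\<bar>) \<le> (\<Sum>i\<in>T. \<bar>x $ i - z $ i\<bar>)"
    unfolding sum_subtractf [symmetric] by (intro sum_mono) auto
  finally have "l1 (x - y) \<le> (\<Sum>i\<in>T. \<bar>x $ i - z $ i\<bar>)" .
  then have "(l1 (x - y))\<^sup>2 \<le> (\<Sum>i\<in>T. \<bar>x $ i - z $ i\<bar>)\<^sup>2"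
    by (intro power_mono) auto
  also have "\<dots> \<le> real (card T) * (\<Sum>i\<in>T. (x $ i - z $ i)\<^sup>2)"
    by (rule sq_sum_abs_le [OF fin(3)])
  also have "\<dots> \<le> real s * (\<Sum>i<n. (x $ i - z $ i)\<^sup>2)"
    using T fin by (intro mult_mono sum_mono2 sum_nonneg) auto
  also have "\<dots> = real s * (l2 (x - z))\<^sup>2"
    using x z by (simp add: l2_sq)
  finally show ?thesis .
qed

lemma nnz_diff_le:
  assumes "x \<in> carrier_vec n" "y \<in> carrier_vec n"
  shows "nnz (x - y) \<le> nnz x + nnz y"
proof -
  have "nnz (x - y) \<le> card ({i. i < n \<and> x $ i \<noteq> 0} \<union> {i. i < n \<and> y $ i \<noteq> 0})"
    unfolding nnz_def using assms by (intro card_mono) auto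
  also have "\<dots> \<le> nnz x + nnz y"
    using assms by (simp add: nnz_def card_Un_le)
  finally show ?thesis .
qed

section \<open>Differentiability along segments\<close>

lemma has_gradient_deriv:
  assumes G: "has_gradient n f G x" and c: "x \<in> carrier_vec n" "d \<in> carrier_vec n"
  shows "((\<lambda>t. f (x + t \<cdot>\<^sub>v d)) has_real_derivative (G \<bullet> d)) (at 0)"
  unfolding DERIV_def
proof (rule LIM_I)
  fix e :: real assume e: "0 < e"
  have Gc: "G \<in> carrier_vec n" using G by (simp add: has_gradient_def)
  \<comment> \<open>The summand 1 keeps the divisor positive for \<open>d = 0\<close>.\<close>
  define e' where "e' = e / (l2 d + 1)"
  have e': "0 < e'" using e by (simp add: e'_def add_nonneg_pos)
  obtain r where r: "r > 0"
    "\<And>h. h \<in> carrier_vec n \<Longrightarrow> l2 h < r \<Longrightarrow> \<bar>f (x + h) - f x - G \<bullet> h\<bar> \<le> e' * l2 h"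
    using G e' unfolding has_gradient_def by blast
  have pos: "0 < l2 d + 1" by (simp add: add_nonneg_pos)
  show "\<exists>r>0. \<forall>t. t \<noteq> 0 \<and> norm (t - 0) < r \<longrightarrow>
      norm ((f (x + (0 + t) \<cdot>\<^sub>v d) - f (x + 0 \<cdot>\<^sub>v d)) / t - G \<bullet> d) < e"
  proof (intro exI conjI allI impI)
    show "0 < r / (l2 d + 1)" using r pos by simp
    fix t :: real assume t: "t \<noteq> 0 \<and> norm (t - 0) < r / (l2 d + 1)"
    have x0: "x + 0 \<cdot>\<^sub>v d = x" using c by auto
    have "\<bar>t\<bar> * (l2 d + 1) < r" using t pos by (simp add: field_simps)
    moreover have "\<bar>t\<bar> * l2 d \<le> \<bar>t\<bar> * (l2 d + 1)" by (intro mult_left_mono) auto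
    ultimately have "l2 (t \<cdot>\<^sub>v d) < r" by (simp add: l2_smult)
    then have "\<bar>f (x + t \<cdot>\<^sub>v d) - f x - G \<bullet> (t \<cdot>\<^sub>v d)\<bar> \<le> e' * (\<bar>t\<bar> * l2 d)"
      using r(2) [of "t \<cdot>\<^sub>v d"] c by (simp add: l2_smult)
    then have *: "\<bar>f (x + t \<cdot>\<^sub>v d) - f x - t * (G \<bullet> d)\<bar> \<le> e' * (\<bar>t\<bar> * l2 d)"
      using c Gc by simp
    have "norm ((f (x + t \<cdot>\<^sub>v d) - f x) / t - G \<bullet> d) = \<bar>f (x + t \<cdot>\<^sub>v d) - f x - t * (G \<bullet> d)\<bar> / \<bar>t\<bar>"
      using t by (simp add: abs_divide [symmetric] diff_divide_distrib)
    also have "\<dots> \<le> e' * l2 d"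
      using * t by (simp add: field_simps)
    also have "\<dots> < e"
      using e pos by (simp add: e'_def field_simps)
    finally show "norm ((f (x + (0 + t) \<cdot>\<^sub>v d) - f (x + 0 \<cdot>\<^sub>v d)) / t - G \<bullet> d) < e"
      by (simp add: x0)
  qed
qed

lemma has_gradient_deriv_at:
  assumes G: "has_gradient n f G (x + t \<cdot>\<^sub>v d)" and c: "x \<in> carrier_vec n" "d \<in> carrier_vec n"
  shows "((\<lambda>t. f (x + t \<cdot>\<^sub>v d)) has_real_derivative (G \<bullet> d)) (at t)"
proof -
  have "x + (t \<cdot>\<^sub>v d + u \<cdot>\<^sub>v d) = x + (u + t) \<cdot>\<^sub>v d" for u
    using c by (auto simp: algebra_simps)
  then have "((\<lambda>u. f (x + (u + t) \<cdot>\<^sub>v d)) has_real_derivative (G \<bullet> d)) (at 0)"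
    using has_gradient_deriv [OF G _ c(2)] c by simp
  then show ?thesis
    using DERIV_shift [of "\<lambda>t. f (x + t \<cdot>\<^sub>v d)" "G \<bullet> d" 0 t] by simp
qed

text \<open>By convexity no difference quotient along the segment, for \<open>t\<close> up to 1,
  exceeds \<open>f y - f x\<close>, and the quotients tend to the directional derivative.\<close>

lemma convex_fun_gradient_ineq:
  assumes f: "convex_fun n f" and G: "has_gradient n f G x"
    and c: "x \<in> carrier_vec n" "y \<in> carrier_vec n"
  shows "f x + G \<bullet> (y - x) \<le> f y"
proof (rule ccontr)
  assume "\<not> ?thesis"
  then have lt: "f y - f x < G \<bullet> (y - x)" by simp
  have x0: "x + 0 \<cdot>\<^sub>v (y - x) = x" using c by auto
  let ?q = "\<lambda>t. (f (x + t \<cdot>\<^sub>v (y - x)) - f x) / t"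
  have "?q \<midarrow>0\<rightarrow> G \<bullet> (y - x)"
    using has_gradient_deriv [OF G c(1), of "y - x"] c unfolding DERIV_def
    by (simp add: x0)
  from LIM_D [OF this, of "G \<bullet> (y - x) - (f y - f x)"] lt
  obtain r where r: "r > 0"
    "\<And>t. t \<noteq> 0 \<Longrightarrow> \<bar>t\<bar> < r \<Longrightarrow> \<bar>?q t - G \<bullet> (y - x)\<bar> < G \<bullet> (y - x) - (f y - f x)"
    by auto
  define t where "t = min (r / 2) 1"
  have t: "0 < t" "t \<le> 1" "t < r" using r by (auto simp: t_def)
  have "x + t \<cdot>\<^sub>v (y - x) = (1 - t) \<cdot>\<^sub>v x + t \<cdot>\<^sub>v y"
    using c by (auto simp: algebra_simps)
  then have "f (x + t \<cdot>\<^sub>v (y - x)) \<le> (1 - t) * f x + t * f y"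
    using f c t by (simp add: convex_fun_def)
  then have "?q t \<le> f y - f x"
    using t by (simp add: field_simps)
  then show False using r(2) [of t] t by linarith
qed

section \<open>Existence of minimizers\<close>

text \<open>Bolzano-Weierstrass, one coordinate at a time: the subsequence found so far is refined
  to one on which the next coordinate is monotone.\<close>

lemma ex_subseq_coordinates_convergent:
  fixes X :: "nat \<Rightarrow> nat \<Rightarrow> real"
  assumes "\<And>k i. i < m \<Longrightarrow> \<bar>X k i\<bar> \<le> B"
  shows "\<exists>r. strict_mono r \<and> (\<forall>i<m. convergent (\<lambda>k. X (r k) i))"
  using assms
proof (induction m)
  case 0
  show ?case by (auto intro: exI [of _ id] simp: strict_mono_def)
next
  case (Suc m)
  then obtain r where r: "strict_mono r" "\<And>i. i < m \<Longrightarrow> convergent (\<lambda>k. X (r k) i)"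
    by (metis less_SucI)
  obtain q where q: "strict_mono q" "monoseq (\<lambda>k. X (r (q k)) m)"
    using seq_monosub [of "\<lambda>k. X (r k) m"] by auto
  have "Bseq (\<lambda>k. X (r (q k)) m)"
    using Suc.prems by (intro BseqI' [of _ B]) simp
  then have "convergent (\<lambda>k. X (r (q k)) m)"
    using q(2) by (rule Bseq_monoseq_convergent)
  moreover have "convergent (\<lambda>k. X (r (q k)) i)" if "i < m" for i
    using convergent_subseq_convergent [OF r(2) [OF that] q(1)] by (simp add: o_def)
  ultimately show ?case
    using strict_mono_o [OF r(1) q(1)]
    by (intro exI [of _ "r \<circ> q"]) (auto simp: less_Suc_eq o_def)
qed

text \<open>Continuity in coordinatewise form: near \<open>x\<close>, differentiability with
  \<open>e = 1\<close> bounds the error of the linear approximation by \<open>l2 (y k - x)\<close>,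
  and the linear term tends to 0 as well.\<close>

lemma has_gradient_tendsto:
  assumes G: "has_gradient n f G x" and x: "x \<in> carrier_vec n"
    and y: "\<And>k. y k \<in> carrier_vec n" and lim: "\<And>i. i < n \<Longrightarrow> (\<lambda>k. y k $ i) \<longlonglongrightarrow> x $ i"
  shows "(\<lambda>k. f (y k)) \<longlonglongrightarrow> f x"
proof -
  have Gc: "G \<in> carrier_vec n" using G by (simp add: has_gradient_def)
  have "(\<lambda>k. (\<Sum>i<n. (y k $ i - x $ i)\<^sup>2)) \<longlonglongrightarrow> (\<Sum>i<n. (x $ i - x $ i)\<^sup>2)"
    by (intro tendsto_intros) (auto intro: lim)
  then have "(\<lambda>k. sqrt (\<Sum>i<n. (y k $ i - x $ i)\<^sup>2)) \<longlonglongrightarrow> sqrt 0"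
    by (intro tendsto_real_sqrt) simp
  moreover have "sqrt (\<Sum>i<n. (y k $ i - x $ i)\<^sup>2) = l2 (y k - x)" for k
    using x y [of k] l2_sq [of "y k - x"] by (simp add: real_sqrt_unique)
  ultimately have l2: "(\<lambda>k. l2 (y k - x)) \<longlonglongrightarrow> 0" by simp
  have "(\<lambda>k. \<Sum>i<n. G $ i * (y k - x) $ i) \<longlonglongrightarrow> (\<Sum>i<n. G $ i * (x $ i - x $ i))"
  proof (intro tendsto_sum)
    fix i assume "i \<in> {..<n}"
    then have "(\<lambda>k. G $ i * (y k $ i - x $ i)) \<longlonglongrightarrow> G $ i * (x $ i - x $ i)"
      by (intro tendsto_intros) (simp add: lim)
    then show "(\<lambda>k. G $ i * (y k - x) $ i) \<longlonglongrightarrow> G $ i * (x $ i - x $ i)"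
      using x y \<open>i \<in> {..<n}\<close> by simp
  qed
  then have lin: "(\<lambda>k. G \<bullet> (y k - x)) \<longlonglongrightarrow> 0"
    using x y by (simp add: scalar_prod_sum [of _ n])
  have "(0::real) < 1" by simp
  then obtain d where d: "d > 0"
    "\<And>h. h \<in> carrier_vec n \<Longrightarrow> l2 h < d \<Longrightarrow> \<bar>f (x + h) - f x - G \<bullet> h\<bar> \<le> 1 * l2 h"
    using G unfolding has_gradient_def by blast
  have "(\<lambda>k. f (y k) - f x - G \<bullet> (y k - x)) \<longlonglongrightarrow> 0"
  proof (rule tendsto_rabs_zero_cancel, rule tendsto_sandwich [OF _ _ tendsto_const l2])
    show "\<forall>\<^sub>F k in sequentially. 0 \<le> \<bar>f (y k) - f x - G \<bullet> (y k - x)\<bar>" by simp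
    show "\<forall>\<^sub>F k in sequentially. \<bar>f (y k) - f x - G \<bullet> (y k - x)\<bar> \<le> l2 (y k - x)"
      using order_tendstoD(2) [OF l2 d(1)]
    proof eventually_elim
      case (elim k)
      have "x + (y k - x) = y k" using x y [of k] by auto
      then show ?case using d(2) [of "y k - x"] elim x y by simp
    qed
  qed
  from tendsto_add [OF tendsto_add [OF this lin] tendsto_const [of "f x"]] show ?thesis by simp
qed

text \<open>The infimum in \<open>quadratic_growth\<close> is informative only over a nonempty set.
  The minimizer is the coordinatewise limit of a subsequence of a minimizing sequence.\<close>

lemma minimizers_nonempty:
  assumes f: "C1_with_gradient n f g" and bdd: "bdd_below (f ` l1_ball n R)" and "0 \<le> R"
  shows "minimizers n R f \<noteq> {}"
proof -
  let ?m = "opt_value n R f"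
  have "0\<^sub>v n \<in> l1_ball n R" using \<open>0 \<le> R\<close> by (simp add: l1_ball_def l1_def)
  then have ne: "f ` l1_ball n R \<noteq> {}" by blast
  have "\<exists>x. x \<in> l1_ball n R \<and> f x < ?m + 1 / real (Suc k)" for k
    using cInf_lessD [OF ne, of "?m + 1 / real (Suc k)"] by (auto simp: opt_value_def)
  then obtain X where X: "\<And>k. X k \<in> l1_ball n R" "\<And>k. f (X k) < ?m + 1 / real (Suc k)"
    by metis
  have Xc: "X k \<in> carrier_vec n" for k using X(1) by (auto simp: l1_ball_def)
  have "\<bar>X k $ i\<bar> \<le> R" if "i < n" for k i
  proof -
    have "\<bar>X k $ i\<bar> \<le> l1 (X k)"
      unfolding l1_def using that Xc [of k] by (intro member_le_sum) auto
    then show ?thesis using X(1) [of k] by (simp add: l1_ball_def)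
  qed
  from ex_subseq_coordinates_convergent [of n "\<lambda>k i. X k $ i", OF this]
  obtain r where r: "strict_mono r" "\<And>i. i < n \<Longrightarrow> convergent (\<lambda>k. X (r k) $ i)" by auto
  define x where "x = vec n (\<lambda>i. lim (\<lambda>k. X (r k) $ i))"
  have x: "x \<in> carrier_vec n" by (simp add: x_def)
  have lim: "(\<lambda>k. X (r k) $ i) \<longlonglongrightarrow> x $ i" if "i < n" for i
    using r(2) [OF that] that by (simp add: x_def convergent_LIMSEQ_iff)
  have "(\<lambda>k. \<Sum>i<n. \<bar>X (r k) $ i\<bar>) \<longlonglongrightarrow> (\<Sum>i<n. \<bar>x $ i\<bar>)"
    by (intro tendsto_intros) (auto intro: lim)
  moreover have "(\<Sum>i<n. \<bar>X (r k) $ i\<bar>) \<le> R" for k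
    using X(1) [of "r k"] by (auto simp: l1_ball_def l1_def)
  ultimately have "(\<Sum>i<n. \<bar>x $ i\<bar>) \<le> R"
    by (intro LIMSEQ_le_const2) auto
  then have xb: "x \<in> l1_ball n R" using x by (simp add: l1_ball_def l1_def)
  have "has_gradient n f (g x) x" using f x by (simp add: C1_with_gradient_def)
  then have "(\<lambda>k. f (X (r k))) \<longlonglongrightarrow> f x"
    using x Xc lim by (rule has_gradient_tendsto)
  moreover have "(\<lambda>k. ?m + 1 / real (Suc (r k))) \<longlonglongrightarrow> ?m + 0"
    using LIMSEQ_subseq_LIMSEQ [OF LIMSEQ_Suc [OF lim_1_over_n] r(1)]
    by (intro tendsto_intros) (simp add: o_def)
  ultimately have "f x \<le> ?m + 0"
    by (rule LIMSEQ_le) (use X(2) less_imp_le in blast)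
  then have "f x \<le> f y" if "y \<in> l1_ball n R" for y
    using cINF_lower [OF bdd that] by (simp add: opt_value_def)
  then show ?thesis using xb by (auto simp: minimizers_def)
qed

text \<open>The tangent at the origin is a lower bound, and Holder controls it on the ball. The
  absolute value of \<open>linf G\<close> is taken because \<open>linf\<close> is unspecified in
  dimension 0.\<close>

lemma convex_fun_bdd_below_l1_ball:
  assumes "convex_fun n f" "has_gradient n f G (0\<^sub>v n)"
  shows "bdd_below (f ` l1_ball n R)"
proof (rule bdd_belowI2)
  fix x assume "x \<in> l1_ball n R"
  then have x: "x \<in> carrier_vec n" "l1 x \<le> R" by (auto simp: l1_ball_def)
  have G: "G \<in> carrier_vec n" using assms(2) by (simp add: has_gradient_def)
  have "\<bar>G \<bullet> x\<bar> \<le> linf G * l1 x" by (rule linf_holder [OF G x(1)])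
  also have "\<dots> \<le> \<bar>linf G\<bar> * R" using x by (intro mult_mono) auto
  finally have "f (0\<^sub>v n) - \<bar>linf G\<bar> * R \<le> f (0\<^sub>v n) + G \<bullet> x" by linarith
  also have "\<dots> \<le> f x"
    using convex_fun_gradient_ineq [OF assms, of x] x by simp
  finally show "f (0\<^sub>v n) - \<bar>linf G\<bar> * R \<le> f x" .
qed

section \<open>Linear convergence\<close>

text \<open>The descent inequality without integrals: along the segment, which stays in the ball
  where the gradient is Lipschitz, the left side minus the right side has nonpositive
  derivative.\<close>

lemma descent_l1:
  assumes C1: "C1_with_gradient n f g" and lip: "gradient_lipschitz n R g \<beta>"
    and xv: "x \<in> l1_ball n R" "v \<in> l1_ball n R" and u: "u \<in> {0..1}"
  shows "f ((1 - u) \<cdot>\<^sub>v x + u \<cdot>\<^sub>v v) \<le> f x + u * ((v - x) \<bullet> g x) + \<beta> * u\<^sup>2 / 2 * (l1 (v - x))\<^sup>2"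
proof -
  have c: "x \<in> carrier_vec n" "v \<in> carrier_vec n" "v - x \<in> carrier_vec n"
    using xv by (auto simp: l1_ball_def)
  let ?L = "l1 (v - x)"
  let ?p = "\<lambda>t. x + t \<cdot>\<^sub>v (v - x)"
  have p: "?p t = (1 - t) \<cdot>\<^sub>v x + t \<cdot>\<^sub>v v" for t
    using c by (auto simp: algebra_simps)
  have grad: "has_gradient n f (g y) y" if "y \<in> carrier_vec n" for y
    using C1 that by (simp add: C1_with_gradient_def)
  then have gc: "g y \<in> carrier_vec n" if "y \<in> carrier_vec n" for y
    using that by (auto simp: has_gradient_def)
  let ?h = "\<lambda>t. f (?p t) - t * (g x \<bullet> (v - x)) - \<beta> * t\<^sup>2 / 2 * ?L\<^sup>2"
  have "?h u \<le> ?h 0"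
  proof (rule DERIV_nonpos_imp_nonincreasing [of 0 u ?h])
    show "0 \<le> u" using u by simp
    fix t assume "0 \<le> t" "t \<le> u"
    then have t: "t \<in> {0..1}" using u by simp
    have pb: "?p t \<in> l1_ball n R" unfolding p by (rule l1_ball_convex [OF xv t])
    have pc: "?p t \<in> carrier_vec n" using c by simp
    have "((\<lambda>t. f (?p t)) has_real_derivative g (?p t) \<bullet> (v - x)) (at t)"
      by (rule has_gradient_deriv_at [OF grad [OF pc] c(1,3)])
    then have "(?h has_real_derivative
        g (?p t) \<bullet> (v - x) - (g x \<bullet> (v - x)) - \<beta> * t * ?L\<^sup>2) (at t)"
      by (auto intro!: derivative_eq_intros)
    moreover have "g (?p t) \<bullet> (v - x) - (g x \<bullet> (v - x)) - \<beta> * t * ?L\<^sup>2 \<le> 0"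
    proof -
      have "g (?p t) \<bullet> (v - x) - (g x \<bullet> (v - x)) = (g (?p t) - g x) \<bullet> (v - x)"
        using minus_scalar_prod_distrib [OF gc [OF pc] gc [OF c(1)] c(3)] by simp
      also have "\<dots> \<le> linf (g (?p t) - g x) * ?L"
        using linf_holder [of "g (?p t) - g x" n "v - x"] gc pc c by simp
      also have "\<dots> \<le> (\<beta> * l1 (?p t - x)) * ?L"
        using lip pb xv by (intro mult_right_mono) (auto simp: gradient_lipschitz_def)
      also have "?p t - x = t \<cdot>\<^sub>v (v - x)" using c by auto
      finally show ?thesis using t by (simp add: l1_smult power2_eq_square algebra_simps)
    qed
    ultimately show "\<exists>y. (?h has_real_derivative y) (at t) \<and> y \<le> 0" by blast
  qed
  moreover have "?p 0 = x" using c by auto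
  moreover have "g x \<bullet> (v - x) = (v - x) \<bullet> g x"
    by (rule comm_scalar_prod [OF gc [OF c(1)] c(3)])
  ultimately show ?thesis unfolding p by simp
qed

section \<open>Contraction and iteration bound under the hypotheses of the theorem\<close>

locale sparse_problem =
  fixes n s :: nat and R \<beta> \<alpha> :: real and f :: "rvec \<Rightarrow> real" and g :: "rvec \<Rightarrow> rvec"
  assumes s_pos: "1 \<le> s" and s_le: "s \<le> n" and R_pos: "R > 0" and \<beta>_pos: "\<beta> > 0" and \<alpha>_pos: "\<alpha> > 0"
    and cvx: "convex_fun n f" and C1: "C1_with_gradient n f g"
    and lip: "gradient_lipschitz n R g \<beta>" and growth: "quadratic_growth n R f \<alpha>"
    and sol: "\<forall>xs\<in>minimizers n R f. nnz xs \<le> s \<and> l1 xs = R"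
    and eta_le: "eta \<beta> \<alpha> s \<in> {0..1}"
begin

abbreviation \<eta> where "\<eta> \<equiv> eta \<beta> \<alpha> s"
abbreviation h where "h x \<equiv> f x - opt_value n R f"

lemma eta_pos: "0 < \<eta>"
  using s_pos \<beta>_pos \<alpha>_pos by (simp add: eta_def)

lemma gradient: "x \<in> carrier_vec n \<Longrightarrow> has_gradient n f (g x) x"
  using C1 by (simp add: C1_with_gradient_def)

lemma gradient_carrier: "x \<in> carrier_vec n \<Longrightarrow> g x \<in> carrier_vec n"
  using gradient by (auto simp: has_gradient_def)

lemma bdd: "bdd_below (f ` l1_ball n R)"
  by (rule convex_fun_bdd_below_l1_ball [OF cvx gradient]) simp

lemma minimizers_ne: "minimizers n R f \<noteq> {}"
  using minimizers_nonempty [OF C1 bdd] R_pos by simp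

lemma h_nonneg: "x \<in> l1_ball n R \<Longrightarrow> 0 \<le> h x"
  using cINF_lower [OF bdd] by (simp add: opt_value_def)

lemma opt_value_eq: "xs \<in> minimizers n R f \<Longrightarrow> opt_value n R f = f xs"
  unfolding opt_value_def by (rule cInf_eq_minimum) (auto simp: minimizers_def)

text \<open>The l1 length of \<open>v - x\<close> is split at \<open>xhat\<close>. The sparse part
  is traded, through optimality of \<open>v\<close>, for the proximal term at \<open>z\<close>,
  which contributes 2 * 4 = 8 to the constant 9; the tail contributes 1.\<close>

lemma fixed_step_bound:
  assumes x: "x \<in> l1_ball n R" and proj: "is_projection (sparse_vecs n s) x xhat"
    and v: "v \<in> l1_ball n R \<inter> sparse_vecs n s"
    and opt: "\<forall>w \<in> l1_ball n R \<inter> sparse_vecs n s.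
           subproblem g \<beta> \<alpha> s x xhat v \<le> subproblem g \<beta> \<alpha> s x xhat w"
    and z: "z \<in> minimizers n R f"
  shows "h ((1 - \<eta>) \<cdot>\<^sub>v x + \<eta> \<cdot>\<^sub>v v) \<le> (1 - \<eta>) * h x + 9 * real s * \<beta> * \<eta>\<^sup>2 * (l2 (x - z))\<^sup>2"
proof -
  have z': "z \<in> l1_ball n R \<inter> sparse_vecs n s" "l1 z = R"
    using z bspec [OF sol z] by (simp_all add: minimizers_def sparse_vecs_def l1_ball_def)
  have xh: "xhat \<in> carrier_vec n" "nnz xhat \<le> s"
    using proj by (auto simp: is_projection_def sparse_vecs_def)
  have c: "x \<in> carrier_vec n" "v \<in> carrier_vec n" "z \<in> carrier_vec n" "nnz v \<le> s" "nnz z \<le> s"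
    using x v z' by (auto simp: l1_ball_def sparse_vecs_def)
  let ?d = "(l2 (x - z))\<^sup>2"
  have tail: "(l1 (x - xhat))\<^sup>2 \<le> real s * ?d"
    using projection_tail_bound [OF proj c(1,3,5)] x z' by (simp add: l1_ball_def)
  \<comment> \<open>\<open>z\<close> is \<open>s\<close>-sparse and so competes with
    \<open>xhat\<close> for the projection.\<close>
  have near: "(l2 (x - xhat))\<^sup>2 \<le> ?d"
    using proj z' by (intro power_mono) (auto simp: is_projection_def)
  have "(l2 (z - xhat))\<^sup>2 = (\<Sum>i<n. (z $ i - xhat $ i)\<^sup>2)"
    using c xh by (simp add: l2_sq)
  also have "\<dots> \<le> (\<Sum>i<n. 2 * (x $ i - z $ i)\<^sup>2 + 2 * (x $ i - xhat $ i)\<^sup>2)"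
  proof (rule sum_mono)
    fix i
    show "(z $ i - xhat $ i)\<^sup>2 \<le> 2 * (x $ i - z $ i)\<^sup>2 + 2 * (x $ i - xhat $ i)\<^sup>2"
      using zero_le_power2 [of "(x $ i - z $ i) + (x $ i - xhat $ i)"]
      by (simp add: power2_eq_square algebra_simps)
  qed
  also have "\<dots> = 2 * ?d + 2 * (l2 (x - xhat))\<^sup>2"
    using c xh by (simp add: l2_sq sum.distrib sum_distrib_left)
  finally have zx: "(l2 (z - xhat))\<^sup>2 \<le> 4 * ?d"
    using near by linarith
  have "(l1 (v - xhat))\<^sup>2 \<le> real (nnz (v - xhat)) * (l2 (v - xhat))\<^sup>2"
    by (rule l1_sq_le)
  also have "\<dots> \<le> (2 * real s) * (l2 (v - xhat))\<^sup>2"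
    using nnz_diff_le [OF c(2) xh(1)] c(4) xh(2) by (intro mult_right_mono) auto
  finally have vx: "(l1 (v - xhat))\<^sup>2 \<le> 2 * real s * (l2 (v - xhat))\<^sup>2" .
  have "v - x = (v - xhat) + (-1) \<cdot>\<^sub>v (x - xhat)"
    using c xh by auto
  then have "l1 (v - x) \<le> l1 (v - xhat) + l1 (x - xhat)"
    using l1_add_le [of "v - xhat" n "(-1) \<cdot>\<^sub>v (x - xhat)"] c xh by (simp add: l1_smult)
  then have "(l1 (v - x))\<^sup>2 \<le> (l1 (v - xhat) + l1 (x - xhat))\<^sup>2"
    by (intro power_mono) auto
  also have "\<dots> \<le> 2 * (l1 (v - xhat))\<^sup>2 + 2 * (l1 (x - xhat))\<^sup>2"
    using zero_le_power2 [of "l1 (v - xhat) - l1 (x - xhat)"]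
    by (simp add: power2_eq_square algebra_simps)
  finally have "(l1 (v - x))\<^sup>2 \<le> 4 * real s * (l2 (v - xhat))\<^sup>2 + 2 * real s * ?d"
    using vx tail by linarith
  then have "\<beta> * \<eta>\<^sup>2 / 2 * (l1 (v - x))\<^sup>2 \<le> \<beta> * \<eta>\<^sup>2 / 2 * (4 * real s * (l2 (v - xhat))\<^sup>2 + 2 * real s * ?d)"
    using \<beta>_pos by (intro mult_left_mono) auto
  \<comment> \<open>Here \<open>\<beta> * \<eta>\<^sup>2 / 2 * 4 * s\<close> is \<eta> times the
    proximal coefficient \<open>2 * s * \<beta> * \<eta>\<close>, so the sparse part of the
    smoothness term completes the linear term to the subproblem.\<close>
  then have "f ((1 - \<eta>) \<cdot>\<^sub>v x + \<eta> \<cdot>\<^sub>v v)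
      \<le> f x + \<eta> * subproblem g \<beta> \<alpha> s x xhat v + \<beta> * \<eta>\<^sup>2 * real s * ?d"
    using descent_l1 [OF C1 lip x _ eta_le, of v] v
    unfolding subproblem_def by (simp add: algebra_simps power2_eq_square)
  also have "\<eta> * subproblem g \<beta> \<alpha> s x xhat v \<le> \<eta> * subproblem g \<beta> \<alpha> s x xhat z"
    using opt z' eta_pos by (intro mult_left_mono) auto
  also have "\<eta> * subproblem g \<beta> \<alpha> s x xhat z
      = \<eta> * ((z - x) \<bullet> g x) + 2 * real s * \<beta> * \<eta>\<^sup>2 * (l2 (z - xhat))\<^sup>2"
    unfolding subproblem_def by (simp add: algebra_simps power2_eq_square)
  also have "2 * real s * \<beta> * \<eta>\<^sup>2 * (l2 (z - xhat))\<^sup>2 \<le> 2 * real s * \<beta> * \<eta>\<^sup>2 * (4 * ?d)"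
    using \<beta>_pos zx by (intro mult_left_mono) auto
  also have "(z - x) \<bullet> g x \<le> f z - f x"
    using convex_fun_gradient_ineq [OF cvx gradient [OF c(1)] c(1,3)] c
      comm_scalar_prod [of "z - x" n "g x"] gradient_carrier [OF c(1)] by simp
  finally have "f ((1 - \<eta>) \<cdot>\<^sub>v x + \<eta> \<cdot>\<^sub>v v) \<le> f x + (\<eta> * (f z - f x) + 2 * real s * \<beta> * \<eta>\<^sup>2 * (4 * ?d))
      + \<beta> * \<eta>\<^sup>2 * real s * ?d"
    using eta_pos by (simp add: mult_left_mono)
  then show ?thesis
    unfolding opt_value_eq [OF z] by (simp add: algebra_simps)
qed

lemma fw_step_feasible:
  assumes "x \<in> l1_ball n R" "fw_step n f g R \<beta> \<alpha> s x x'"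
  shows "x' \<in> l1_ball n R"
  using assms eta_le unfolding fw_step_def is_line_search_def by (auto intro!: l1_ball_convex)

text \<open>As \<eta> lies in [0,1], it competes in the line search; both step rules are therefore
  bounded by the fixed step.\<close>

lemma fw_step_contraction:
  assumes x: "x \<in> l1_ball n R" and step: "fw_step n f g R \<beta> \<alpha> s x x'"
  shows "h x' \<le> (1 - 5 / 8 * \<eta>) * h x"
proof -
  obtain xhat v \<gamma> where
    proj: "is_projection (sparse_vecs n s) x xhat" and v: "v \<in> l1_ball n R \<inter> sparse_vecs n s"
    and opt: "\<forall>w \<in> l1_ball n R \<inter> sparse_vecs n s.
           subproblem g \<beta> \<alpha> s x xhat v \<le> subproblem g \<beta> \<alpha> s x xhat w"
    and \<gamma>: "is_line_search f x v \<gamma> \<or> \<gamma> = \<eta>" and x': "x' = (1 - \<gamma>) \<cdot>\<^sub>v x + \<gamma> \<cdot>\<^sub>v v"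
    using step unfolding fw_step_def by blast
  define K where "K = 9 * real s * \<beta> * \<eta>\<^sup>2"
  have K: "K > 0" using s_pos \<beta>_pos eta_pos by (simp add: K_def)
  have "h x' \<le> h ((1 - \<eta>) \<cdot>\<^sub>v x + \<eta> \<cdot>\<^sub>v v)"
    using \<gamma> eta_le unfolding x' is_line_search_def by auto
  then have "h x' \<le> (1 - \<eta>) * h x + K * (l2 (x - z))\<^sup>2" if "z \<in> minimizers n R f" for z
    using fixed_step_bound [OF x proj v opt that] unfolding K_def by linarith
  \<comment> \<open>Isolating the distance lets the bound, valid for every minimizer, pass to the
    infimum that growth controls.\<close>
  then have "(h x' - (1 - \<eta>) * h x) / K \<le> (l2 (x - z))\<^sup>2" if "z \<in> minimizers n R f" for z
    using that K by (simp add: field_simps)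
  then have "(h x' - (1 - \<eta>) * h x) / K \<le> (INF z\<in>minimizers n R f. (l2 (x - z))\<^sup>2)"
    by (intro cINF_greatest minimizers_ne)
  also have "\<dots> \<le> 2 / \<alpha> * h x"
    using growth x by (simp add: quadratic_growth_def)
  finally have "h x' \<le> (1 - \<eta>) * h x + K * (2 / \<alpha> * h x)"
    using K by (simp add: field_simps)
  \<comment> \<open>The factor is 18 s \<beta> \<eta>^2 / \<alpha>, and \<eta> = \<alpha> / (48
    \<beta> s) makes it 18/48 \<eta>.\<close>
  also have "K * (2 / \<alpha> * h x) = 3 / 8 * \<eta> * h x"
    using s_pos \<beta>_pos \<alpha>_pos by (simp add: K_def eta_def power2_eq_square field_simps)
  also have "(1 - \<eta>) * h x + 3 / 8 * \<eta> * h x = (1 - 5 / 8 * \<eta>) * h x"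
    by (simp add: field_simps)
  finally show ?thesis .
qed

lemma fw_run_feasible: "fw_run n f g R \<beta> \<alpha> s x \<Longrightarrow> x t \<in> l1_ball n R"
  by (induction t) (simp_all add: fw_run_def fw_step_feasible [of "x t" "x (Suc t)" for t])

lemma fw_run_rate:
  assumes "fw_run n f g R \<beta> \<alpha> s x"
  shows "h (x t) \<le> exp (- (5 / 8 * \<eta> * real t)) * h (x 0)"
proof (induction t)
  case (Suc t)
  have "h (x (Suc t)) \<le> (1 - 5 / 8 * \<eta>) * h (x t)"
    using assms fw_run_feasible [OF assms]
    by (intro fw_step_contraction) (auto simp: fw_run_def)
  also have "\<dots> \<le> exp (- (5 / 8 * \<eta>)) * h (x t)"
    using exp_ge_add_one_self [of "- (5 / 8 * \<eta>)"] h_nonneg [OF fw_run_feasible [OF assms]]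
    by (intro mult_right_mono) auto
  also have "\<dots> \<le> exp (- (5 / 8 * \<eta>)) * (exp (- (5 / 8 * \<eta> * real t)) * h (x 0))"
    using Suc by (intro mult_left_mono) auto
  also have "\<dots> = exp (- (5 / 8 * \<eta> * real (Suc t))) * h (x 0)"
  proof -
    have "- (5 / 8 * \<eta> * real (Suc t)) = - (5 / 8 * \<eta>) + - (5 / 8 * \<eta> * real t)"
      by (simp add: field_simps)
    then show ?thesis by (simp only: exp_add mult.assoc)
  qed
  finally show ?case .
qed simp

text \<open>The exponent 5/8 \<eta> is 5/384 times \<alpha> / (\<beta> s), and 384/5 = 76.8; hence
  77.\<close>

lemma fw_run_iterations:
  assumes run: "fw_run n f g R \<beta> \<alpha> s x" and \<epsilon>: "\<epsilon> > 0"
    and t: "real t \<ge> C * (\<beta> * real s / \<alpha>) * ln (h (x 0) / \<epsilon>)" and C: "C \<ge> 77"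
  shows "approx_solution n R f \<epsilon> (x t)"
proof -
  note feas = fw_run_feasible [OF run]
  have h0: "0 \<le> h (x 0)" by (rule h_nonneg [OF feas])
  have le: "h (x t) \<le> exp (- (5 / 8 * \<eta> * real t)) * h (x 0)" by (rule fw_run_rate [OF run])
  have "h (x t) \<le> \<epsilon>"
  \<comment> \<open>If the start is already good enough, the logarithm is at most 0
    (\<open>ln 0\<close> being 0), so \<open>t\<close> may be 0; it suffices that the error never
    grows.\<close>
  proof (cases "h (x 0) \<le> \<epsilon>")
    case True
    note le
    also have "exp (- (5 / 8 * \<eta> * real t)) * h (x 0) \<le> 1 * h (x 0)"
      using h0 eta_pos by (intro mult_right_mono) auto
    also have "\<dots> \<le> \<epsilon>" using True by simp
    finally show ?thesis .
  next
    case False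
    then have ln: "0 < ln (h (x 0) / \<epsilon>)" using \<epsilon> by (intro ln_gt_zero) (simp add: field_simps)
    have "ln (h (x 0) / \<epsilon>) \<le> 5 / 384 * C * ln (h (x 0) / \<epsilon>)"
      using C ln by simp
    also have "\<dots> = 5 / 8 * \<eta> * (C * (\<beta> * real s / \<alpha>) * ln (h (x 0) / \<epsilon>))"
      using s_pos \<beta>_pos \<alpha>_pos by (simp add: eta_def)
    also have "\<dots> \<le> 5 / 8 * \<eta> * real t"
      using t eta_pos by (intro mult_left_mono) auto
    finally have "exp (- (5 / 8 * \<eta> * real t)) \<le> exp (- ln (h (x 0) / \<epsilon>))" by simp
    also have "\<dots> = \<epsilon> / h (x 0)"
      using False \<epsilon> by (simp add: exp_minus)
    finally have "exp (- (5 / 8 * \<eta> * real t)) * h (x 0) \<le> \<epsilon> / h (x 0) * h (x 0)"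
      using h0 by (intro mult_right_mono) auto
    then show ?thesis using le False \<epsilon> by simp
  qed
  then show ?thesis using feas by (simp add: approx_solution_def)
qed

end

section \<open>A calculus for total correctness and cost\<close>

text \<open>A weakest precondition for total correctness whose postcondition also sees the cost. The
  existential form suffices because the theorem asks for executions to exist.\<close>

definition runs :: "com \<Rightarrow> mem \<Rightarrow> (nat \<Rightarrow> mem \<Rightarrow> bool) \<Rightarrow> bool" where
  "runs c \<sigma> Q \<longleftrightarrow> (\<exists>k \<sigma>'. exec c \<sigma> k \<sigma>' \<and> Q k \<sigma>')"

inductive_cases exec_SkipE: "exec Skip \<sigma> k \<sigma>'"
inductive_cases exec_SetIntE: "exec (SetInt a i e) \<sigma> k \<sigma>'"
inductive_cases exec_SetRealE: "exec (SetReal a i e) \<sigma> k \<sigma>'"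
inductive_cases exec_SeqE: "exec (Seq c d) \<sigma> k \<sigma>'"
inductive_cases exec_CondE: "exec (Cond b c d) \<sigma> k \<sigma>'"
inductive_cases exec_LoopE: "exec (Loop b c) \<sigma> k \<sigma>'"

lemma runs_Skip: "runs Skip \<sigma> Q \<longleftrightarrow> Q 0 \<sigma>"
  unfolding runs_def by (blast intro: exec.Skip elim: exec_SkipE)

lemma runs_SetInt: "runs (SetInt a i e) \<sigma> Q \<longleftrightarrow> Q 0 (put_int a (ival i \<sigma>) (ival e \<sigma>) \<sigma>)"
  unfolding runs_def by (blast intro: exec.SetInt elim: exec_SetIntE)

lemma runs_SetReal: "runs (SetReal a i e) \<sigma> Q \<longleftrightarrow> Q (rcost e) (put_real a (ival i \<sigma>) (rval e \<sigma>) \<sigma>)"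
  unfolding runs_def by (blast intro: exec.SetReal elim: exec_SetRealE)

lemma runs_Seq: "runs (Seq c d) \<sigma> Q \<longleftrightarrow> runs c \<sigma> (\<lambda>k \<sigma>'. runs d \<sigma>' (\<lambda>l. Q (k + l)))"
  unfolding runs_def by (blast intro: exec.Seq elim: exec_SeqE)

lemma runs_Cond:
  "runs (Cond b c d) \<sigma> Q \<longleftrightarrow>
     (if bval b \<sigma> then runs c \<sigma> (\<lambda>k. Q (bcost b + k)) else runs d \<sigma> (\<lambda>k. Q (bcost b + k)))"
proof (cases "bval b \<sigma>")
  case True
  then show ?thesis
    unfolding runs_def by simp (blast intro: exec.CondTrue elim: exec_CondE)
next
  case False
  then show ?thesis
    unfolding runs_def by simp (blast intro: exec.CondFalse elim: exec_CondE)
qed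

text \<open>Kept out of \<open>runs_simps\<close>, where it would unfold forever.\<close>

lemma runs_Loop:
  "runs (Loop b c) \<sigma> Q \<longleftrightarrow>
     (if bval b \<sigma> then runs c \<sigma> (\<lambda>k \<sigma>'. runs (Loop b c) \<sigma>' (\<lambda>l. Q (bcost b + k + l)))
      else Q (bcost b) \<sigma>)"
proof (cases "bval b \<sigma>")
  case True
  then show ?thesis
    unfolding runs_def by simp (blast intro: exec.LoopTrue elim: exec_LoopE)
next
  case False
  then show ?thesis
    unfolding runs_def by simp (blast intro: exec.LoopFalse elim: exec_LoopE)
qed

lemmas runs_simps = runs_Skip runs_SetInt runs_SetReal runs_Seq runs_Cond

text \<open>The execution itself is handed to the second premise, so that \<open>exec_frame\<close>
  can be applied to it.\<close>

lemma runs_mono: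
  assumes "runs c \<sigma> Q" "\<And>k \<sigma>'. exec c \<sigma> k \<sigma>' \<Longrightarrow> Q k \<sigma>' \<Longrightarrow> Q' k \<sigma>'"
  shows "runs c \<sigma> Q'"
  using assms unfolding runs_def by blast

lemma put_simps [simp]:
  "ints (put_int a i k \<sigma>) b = (if b = a then (ints \<sigma> a)(i := k) else ints \<sigma> b)"
  "reals (put_int a i k \<sigma>) = reals \<sigma>"
  "ints (put_real a i r \<sigma>) = ints \<sigma>"
  "reals (put_real a i r \<sigma>) b = (if b = a then (reals \<sigma> a)(i := r) else reals \<sigma> b)"
  by (auto simp: put_int_def put_real_def)

primrec int_writes :: "com \<Rightarrow> string set" where
  "int_writes Skip = {}"
| "int_writes (SetInt a i e) = {a}"
| "int_writes (SetReal a i e) = {}"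
| "int_writes (Seq c d) = int_writes c \<union> int_writes d"
| "int_writes (Cond b c d) = int_writes c \<union> int_writes d"
| "int_writes (Loop b c) = int_writes c"

primrec real_writes :: "com \<Rightarrow> string set" where
  "real_writes Skip = {}"
| "real_writes (SetInt a i e) = {}"
| "real_writes (SetReal a i e) = {a}"
| "real_writes (Seq c d) = real_writes c \<union> real_writes d"
| "real_writes (Cond b c d) = real_writes c \<union> real_writes d"
| "real_writes (Loop b c) = real_writes c"

text \<open>Framing goes by whole arrays and syntactic write sets; the specification of a block then
  only mentions what the block computes.\<close>

definition frame :: "com \<Rightarrow> mem \<Rightarrow> mem \<Rightarrow> bool" where
  "frame c \<sigma> \<sigma>' \<longleftrightarrow> (\<forall>a. a \<notin> int_writes c \<longrightarrow> ints \<sigma>' a = ints \<sigma> a) \<and>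
                 (\<forall>a. a \<notin> real_writes c \<longrightarrow> reals \<sigma>' a = reals \<sigma> a)"

lemma exec_frame: "exec c \<sigma> k \<sigma>' \<Longrightarrow> frame c \<sigma> \<sigma>'"
  by (induction rule: exec.induct) (simp_all add: frame_def)

lemma frame_ints: "frame c \<sigma> \<sigma>' \<Longrightarrow> a \<notin> int_writes c \<Longrightarrow> ints \<sigma>' a = ints \<sigma> a"
  and frame_reals: "frame c \<sigma> \<sigma>' \<Longrightarrow> a \<notin> real_writes c \<Longrightarrow> reals \<sigma>' a = reals \<sigma> a"
  by (simp_all add: frame_def)

abbreviation IVar :: "string \<Rightarrow> iexp" where "IVar a \<equiv> ICell a (IConst 0)"
abbreviation SetIVar :: "string \<Rightarrow> iexp \<Rightarrow> com" where "SetIVar a \<equiv> SetInt a (IConst 0)"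
abbreviation RVar :: "string \<Rightarrow> rexp" where "RVar a \<equiv> RCell a (IConst 0)"
abbreviation SetRVar :: "string \<Rightarrow> rexp \<Rightarrow> com" where "SetRVar a \<equiv> SetReal a (IConst 0)"
abbreviation RNum :: "nat \<Rightarrow> rexp" where "RNum k \<equiv> ROfNat (IConst k)"

definition for_loop :: "string \<Rightarrow> string \<Rightarrow> com \<Rightarrow> com" where
  "for_loop i m c = Seq (SetIVar i (IConst 0))
     (Loop (ILess (IVar i) (IVar m)) (Seq c (SetIVar i (IPlus (IVar i) (IConst 1)))))"

lemma for_loop_writes [simp]:
  "int_writes (for_loop i m c) = insert i (int_writes c)"
  "real_writes (for_loop i m c) = real_writes c"
  by (auto simp: for_loop_def)

text \<open>Loop control works on naturals and is free, so only the bodies are summed. The bound may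
  vary with the round, for loops in which some rounds are cheap.\<close>

lemma runs_for:
  assumes i: "i \<notin> int_writes c" and m: "m \<notin> int_writes c" "m \<noteq> i" and N: "ints \<sigma> m 0 = N"
    and init: "I 0 (put_int i 0 0 \<sigma>)"
    and step: "\<And>j \<tau>. j < N \<Longrightarrow> frame (for_loop i m c) \<sigma> \<tau> \<Longrightarrow> ints \<tau> i 0 = j \<Longrightarrow> I j \<tau> \<Longrightarrow>
      runs c \<tau> (\<lambda>k \<tau>'. k \<le> K j \<and> I (Suc j) (put_int i 0 (Suc j) \<tau>'))"
  shows "runs (for_loop i m c) \<sigma> (\<lambda>k \<tau>. k \<le> (\<Sum>j<N. K j) \<and> I N \<tau>)"
proof -
  let ?L = "Loop (ILess (IVar i) (IVar m)) (Seq c (SetIVar i (IPlus (IVar i) (IConst 1))))"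
  let ?f = "frame (for_loop i m c)"
  have loop: "runs ?L \<tau> (\<lambda>k \<tau>'. k \<le> (\<Sum>j=j..<N. K j) \<and> I N \<tau>')"
    if "j \<le> N" "?f \<sigma> \<tau>" "ints \<tau> i 0 = j" "I j \<tau>" for j \<tau>
    using that
  proof (induction "N - j" arbitrary: j \<tau>)
    case 0
    then show ?case
      using N m by (subst runs_Loop) (simp add: frame_ints)
  next
    case (Suc d)
    then have j: "j < N" by simp
    have b: "bval (ILess (IVar i) (IVar m)) \<tau>"
      using j Suc.prems N m by (simp add: frame_ints)
    have "runs c \<tau> (\<lambda>k \<tau>'. runs ?L (put_int i 0 (Suc j) \<tau>') (\<lambda>l \<tau>'. k + l \<le> (\<Sum>j=j..<N. K j) \<and> I N \<tau>'))"
    proof (rule runs_mono [OF step [OF j Suc.prems(2-4)]])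
      fix k \<tau>' assume e: "exec c \<tau> k \<tau>'" and h: "k \<le> K j \<and> I (Suc j) (put_int i 0 (Suc j) \<tau>')"
      have f: "?f \<sigma> (put_int i 0 (Suc j) \<tau>')"
        using Suc.prems(2) exec_frame [OF e] by (simp add: frame_def)
      have "runs ?L (put_int i 0 (Suc j) \<tau>') (\<lambda>k \<tau>'. k \<le> (\<Sum>j=Suc j..<N. K j) \<and> I N \<tau>')"
        using Suc.hyps j h f by (intro Suc.hyps(1)) auto
      then show "runs ?L (put_int i 0 (Suc j) \<tau>') (\<lambda>l \<tau>'. k + l \<le> (\<Sum>j=j..<N. K j) \<and> I N \<tau>')"
        by (rule runs_mono) (use h j in \<open>simp add: sum.atLeast_Suc_lessThan\<close>)
    qed
    then have *: "runs c \<tau> (\<lambda>k \<tau>'. runs ?L (put_int i 0 (Suc (ints \<tau>' i 0)) \<tau>')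
        (\<lambda>l \<tau>'. k + l \<le> (\<Sum>j=j..<N. K j) \<and> I N \<tau>'))"
    proof (rule runs_mono)
      fix k \<tau>' assume e: "exec c \<tau> k \<tau>'"
        and h: "runs ?L (put_int i 0 (Suc j) \<tau>') (\<lambda>l \<tau>'. k + l \<le> (\<Sum>j=j..<N. K j) \<and> I N \<tau>')"
      have "ints \<tau>' i 0 = j"
        using frame_ints [OF exec_frame [OF e] i] Suc.prems by simp
      then show "runs ?L (put_int i 0 (Suc (ints \<tau>' i 0)) \<tau>')
        (\<lambda>l \<tau>'. k + l \<le> (\<Sum>j=j..<N. K j) \<and> I N \<tau>')" using h by simp
    qed
    show ?case
      using b * by (subst runs_Loop) (simp add: runs_simps)
  qed
  have "?f \<sigma> (put_int i 0 0 \<sigma>)"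
    by (simp add: frame_def)
  from loop [OF _ this _ init] show ?thesis
    unfolding for_loop_def by (simp add: runs_simps atLeast0LessThan)
qed

lemma runs_for_uniform:
  assumes "i \<notin> int_writes c" "m \<notin> int_writes c" "m \<noteq> i" "ints \<sigma> m 0 = N"
    and "I 0 (put_int i 0 0 \<sigma>)"
    and "\<And>j \<tau>. j < N \<Longrightarrow> frame (for_loop i m c) \<sigma> \<tau> \<Longrightarrow> ints \<tau> i 0 = j \<Longrightarrow> I j \<tau> \<Longrightarrow>
      runs c \<tau> (\<lambda>k \<tau>'. k \<le> K \<and> I (Suc j) (put_int i 0 (Suc j) \<tau>'))"
  shows "runs (for_loop i m c) \<sigma> (\<lambda>k \<tau>. k \<le> N * K \<and> I N \<tau>)"
proof -
  have "runs (for_loop i m c) \<sigma> (\<lambda>k \<tau>. k \<le> (\<Sum>j<N. K) \<and> I N \<tau>)"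
    by (rule runs_for [where I = I and K = "\<lambda>_. K", OF assms])
  then show ?thesis by simp
qed

section \<open>Selecting the largest entries\<close>

text \<open>\<open>p\<close> is the content of an array and is constrained only below
  \<open>m\<close>. Ties may fall either way; the last conjunct makes the listed indices a top
  set.\<close>

definition top_sorted :: "(nat \<Rightarrow> real) \<Rightarrow> nat \<Rightarrow> nat \<Rightarrow> (nat \<Rightarrow> nat) \<Rightarrow> bool" where
  "top_sorted a i m p \<longleftrightarrow> inj_on p {..<m} \<and> p ` {..<m} \<subseteq> {..<i} \<and>
     (\<forall>u v. u \<le> v \<longrightarrow> v < m \<longrightarrow> a (p v) \<le> a (p u)) \<and>
     (\<forall>q<i. q \<notin> p ` {..<m} \<longrightarrow> (\<forall>u<m. a q \<le> a (p u)))"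

text \<open>A cell of the new list is an old cell before the insertion point, the new index, or an
  old cell moved up by one (\<open>shape\<close>), and all claims are checked along this
  distinction. Specifying \<open>p'\<close> up to \<open>min i s\<close> covers both a growing list
  and a full one, which drops its last candidate.\<close>

lemma top_sorted_insert:
  assumes top: "top_sorted a i (min i s) p" and l: "l \<le> min i s"
    and before: "\<And>u. u < l \<Longrightarrow> a i \<le> a (p u)"
    and after: "\<And>u. l \<le> u \<Longrightarrow> u < min i s \<Longrightarrow> a (p u) < a i"
    and p': "\<And>u. u \<le> min i s \<Longrightarrow> p' u = (if u < l then p u else if u = l then i else p (u - 1))"
  shows "top_sorted a (Suc i) (min (Suc i) s) p'"
proof -
  define m where "m = min i s"
  define m' where "m' = min (Suc i) s"
  have m': "m' \<le> Suc m" "m \<le> m'" by (auto simp: m_def m'_def)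
  have p_inj: "inj_on p {..<m}" and p_img: "p ` {..<m} \<subseteq> {..<i}"
    and srt: "\<And>u v. u \<le> v \<Longrightarrow> v < m \<Longrightarrow> a (p v) \<le> a (p u)"
    and out: "\<And>q u. q < i \<Longrightarrow> q \<notin> p ` {..<m} \<Longrightarrow> u < m \<Longrightarrow> a q \<le> a (p u)"
    using top unfolding top_sorted_def m_def [symmetric] by blast+
  have inj: "u = v" if "p u = p v" "u < m" "v < m" for u v
    using inj_onD [OF p_inj that(1)] that by simp
  have bnd: "p u < i" if "u < m" for u
    using p_img that by blast
  have l: "l \<le> m" and after: "\<And>u. l \<le> u \<Longrightarrow> u < m \<Longrightarrow> a (p u) < a i"
    using assms by (auto simp: m_def)
  have shape: "u < l \<and> u < m \<and> p' u = p u \<or> u = l \<and> p' u = i \<or>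
      (\<exists>w. u = Suc w \<and> l \<le> w \<and> w < m \<and> p' u = p w)" if "u < m'" for u
  proof -
    have "u \<le> min i s" using that m' unfolding m_def by linarith
    from p' [OF this] show ?thesis
      using that m' l by (cases u) auto
  qed
  have val: "a (p' v) \<le> a (p' u)" if uv: "u \<le> v" "v < m'" for u v
  proof -
    have u: "u < m'" using uv by simp
    consider "v < l" "v < m" "p' v = p v" | "v = l" "p' v = i"
      | w where "v = Suc w" "l \<le> w" "w < m" "p' v = p w"
      using shape [OF uv(2)] by blast
    then show ?thesis
    proof cases
      case 1
      then show ?thesis using shape [OF u] srt [OF uv(1)] uv by auto
    next
      case 2
      then show ?thesis using shape [OF u] before uv by auto
    next
      case 3
      then show ?thesis using shape [OF u] srt [of _ w] after [of w] uv by (auto intro: less_imp_le)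
    qed
  qed
  have ne: "p' u \<noteq> p' v" if uv: "u < v" "v < m'" for u v
  proof -
    have u: "u < m'" using uv by simp
    consider "v < l" "v < m" "p' v = p v" | "v = l" "p' v = i"
      | w where "v = Suc w" "l \<le> w" "w < m" "p' v = p w"
      using shape [OF uv(2)] by blast
    then show ?thesis
    proof cases
      case 1
      then show ?thesis using shape [OF u] inj [of u v] uv by auto
    next
      case 2
      then show ?thesis using shape [OF u] bnd [of u] uv by auto
    next
      case 3
      then show ?thesis using shape [OF u] inj [of _ w] bnd [of w] uv by force
    qed
  qed
  have "inj_on p' {..<m'}"
    by (rule linorder_inj_onI) (use ne in auto)
  moreover have "p' u < Suc i" if "u < m'" for u
    using shape [OF that] by (auto dest: bnd)
  moreover have "a q \<le> a (p' u)" if q: "q < Suc i" "q \<notin> p' ` {..<m'}" and u: "u < m'" for q u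
  proof (cases "q = i")
    case True
    \<comment> \<open>The new index was not kept: the list is full and the insertion point lies
      behind it.\<close>
    have "\<not> l < m'" using shape [of l] q(2) True by force
    then show ?thesis using shape [OF u] u before True by auto
  next
    case False
    then have q': "q < i" using q by simp
    show ?thesis
    proof (cases "q \<in> p ` {..<m}")
      case False
      note out = out [OF q' False]
      consider w where "w < m" "p' u = p w" | "u = l" "p' u = i" "l < m" | "u = l" "l = m"
      proof (cases "u = l")
        case True
        then show thesis using shape [OF u] l that(2,3) by (cases "l < m") auto
      next
        case False
        then show thesis using shape [OF u] that(1) by blast
      qed
      then show ?thesis
      proof cases
        case 1
        then show ?thesis using out by simp
      next
        case 2
        then show ?thesis using out [of l] after [of l] by simp
      next
        case 3
        \<comment> \<open>The list grows at its end, so it was not full and already held every index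
          below \<open>i\<close>; no \<open>q\<close> is left out.\<close>
        then have "m < s" "m = i" using u unfolding m_def m'_def by auto
        then have "card (p ` {..<m}) = card {..<i}" using card_image [OF p_inj] by simp
        then have "p ` {..<m} = {..<i}" using p_img by (intro card_subset_eq) auto
        then show ?thesis using False q' by simp
      qed
    next
      case True
      then obtain v where v: "v < m" "q = p v" by auto
      have new: "p' w \<noteq> p v" if "w < m'" for w
        using q(2) that v(2) by (metis image_eqI lessThan_iff)
      \<comment> \<open>Here \<open>q\<close> is the index that fell out: it sat behind the
        insertion point, in the last cell.\<close>
      have "l \<le> v"
        using new [of v] shape [of v] v(1) m' by force
      moreover have "\<not> Suc v < m'"
        using new [of "Suc v"] shape [of "Suc v"] \<open>l \<le> v\<close> by force
      ultimately show ?thesis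
        using shape [OF u] srt [of _ v] after [of v] v u by (auto intro: less_imp_le)
    qed
  qed
  ultimately show ?thesis
    using val unfolding top_sorted_def m'_def [symmetric] by auto
qed

section \<open>Insertion by binary search\<close>

definition search_loop :: com where
  "search_loop = Loop (ILess (IVar ''lo'') (IVar ''hi''))
     (Seq (SetIVar ''mid'' (IDiv (IPlus (IVar ''lo'') (IVar ''hi'')) (IConst 2)))
       (Cond (RLess (RCell ''a'' (ICell ''p'' (IVar ''mid''))) (RCell ''a'' (IVar ''i'')))
         (SetIVar ''hi'' (IVar ''mid''))
         (SetIVar ''lo'' (IPlus (IVar ''mid'') (IConst 1)))))"

lemma search_loop_writes [simp]:
  "int_writes search_loop = {''lo'', ''hi'', ''mid''}" "real_writes search_loop = {}"
  by (auto simp: search_loop_def)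

text \<open>\<open>floorlog 2 d\<close> is the number of binary digits of \<open>d\<close>, so it
  pays for one comparison per halving.\<close>

lemma floorlog_step: "d' \<le> d div 2 \<Longrightarrow> 0 < d \<Longrightarrow> Suc (floorlog 2 d') \<le> floorlog 2 d"
proof -
  assume d: "d' \<le> d div 2" "0 < d"
  have "floorlog 2 d = floorlog 2 (d div 2) + 1"
    using d by (subst compute_floorlog) simp
  then show ?thesis
    using floorlog_mono [OF d(1), of 2] by linarith
qed

text \<open>The invariant: cells below \<open>lo\<close> hold values at least \<open>a i\<close>,
  cells from \<open>hi\<close> on hold smaller ones. Each round makes one charged
  comparison.\<close>

lemma runs_search_loop:
  assumes "lo \<le> hi" "hi \<le> m"
    and "ints \<sigma> ''lo'' 0 = lo" "ints \<sigma> ''hi'' 0 = hi" "ints \<sigma> ''i'' 0 = i" "ints \<sigma> ''p'' = p"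
      "reals \<sigma> ''a'' = a"
    and srt: "\<And>u v. u \<le> v \<Longrightarrow> v < m \<Longrightarrow> a (p v) \<le> a (p u)"
    and "\<And>u. u < lo \<Longrightarrow> a i \<le> a (p u)" "\<And>u. hi \<le> u \<Longrightarrow> u < m \<Longrightarrow> a (p u) < a i"
  shows "runs search_loop \<sigma> (\<lambda>k \<sigma>'. k \<le> floorlog 2 (hi - lo) \<and>
     (\<exists>l\<le>m. ints \<sigma>' ''lo'' 0 = l \<and> (\<forall>u<l. a i \<le> a (p u)) \<and> (\<forall>u. l \<le> u \<longrightarrow> u < m \<longrightarrow> a (p u) < a i)))"
proof -
  define Q where "Q \<tau> \<longleftrightarrow> (\<exists>l\<le>m. ints \<tau> ''lo'' 0 = l \<and> (\<forall>u<l. a i \<le> a (p u)) \<and>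
    (\<forall>u. l \<le> u \<longrightarrow> u < m \<longrightarrow> a (p u) < a i))" for \<tau> :: mem
  have "runs search_loop \<sigma> (\<lambda>k \<sigma>'. k \<le> floorlog 2 (hi - lo) \<and> Q \<sigma>')"
    using assms(1-7,9-)
  proof (induction "hi - lo" arbitrary: lo hi \<sigma> rule: less_induct)
    case less
    show ?case
    proof (cases "lo < hi")
      case False
      then show ?thesis
        unfolding search_loop_def using less.prems by (subst runs_Loop) (simp add: Q_def)
    next
      case True
      define mid where "mid = (lo + hi) div 2"
      have mid: "lo \<le> mid" "mid < hi" "mid < m" using True less.prems(2) by (auto simp: mid_def)
      have mid_half: "mid - lo \<le> (hi - lo) div 2" "hi - Suc mid \<le> (hi - lo) div 2"
        using True unfolding mid_def by linarith+
      let ?\<tau> = "put_int ''mid'' 0 mid \<sigma>"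
      show ?thesis
      proof (cases "a (p mid) < a i")
        case lt: True
        have "runs search_loop (put_int ''hi'' 0 mid ?\<tau>) (\<lambda>k \<sigma>'. k \<le> floorlog 2 (mid - lo) \<and> Q \<sigma>')"
        proof (rule less.hyps)
          show "a (p u) < a i" if "mid \<le> u" "u < m" for u
            using le_less_trans [OF srt [OF that] lt] .
        qed (use less.prems mid in simp_all)
        then have "runs search_loop (put_int ''hi'' 0 mid ?\<tau>) (\<lambda>k \<sigma>'. Suc k \<le> floorlog 2 (hi - lo) \<and> Q \<sigma>')"
          by (rule runs_mono) (use floorlog_step [OF mid_half(1)] True in simp)
        then show ?thesis
          unfolding search_loop_def using less.prems(3-7) lt True
          by (subst runs_Loop) (simp add: runs_simps mid_def)
      next
        case ge: False
        have "runs search_loop (put_int ''lo'' 0 (Suc mid) ?\<tau>) (\<lambda>k \<sigma>'. k \<le> floorlog 2 (hi - Suc mid) \<and> Q \<sigma>')"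
        proof (rule less.hyps)
          show "a i \<le> a (p u)" if "u < Suc mid" for u
            using ge srt [of u mid] mid that by simp
        qed (use less.prems mid in simp_all)
        then have "runs search_loop (put_int ''lo'' 0 (Suc mid) ?\<tau>) (\<lambda>k \<sigma>'. Suc k \<le> floorlog 2 (hi - lo) \<and> Q \<sigma>')"
          by (rule runs_mono) (use floorlog_step [OF mid_half(2)] True in simp)
        then show ?thesis
          unfolding search_loop_def using less.prems(3-7) ge True
          by (subst runs_Loop) (simp add: runs_simps mid_def)
      qed
    qed
  qed
  then show ?thesis by (simp only: Q_def)
qed

definition shift_loop :: com where
  "shift_loop = Loop (ILess (IVar ''lo'') (IVar ''j''))
     (Seq (SetInt ''p'' (IVar ''j'') (ICell ''p'' (IMinus (IVar ''j'') (IConst 1))))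
       (SetIVar ''j'' (IMinus (IVar ''j'') (IConst 1))))"

lemma shift_loop_writes [simp]:
  "int_writes shift_loop = {''p'', ''j''}" "real_writes shift_loop = {}"
  by (auto simp: shift_loop_def)

text \<open>Only naturals are moved, at no cost; this is what makes an insertion as cheap as its
  search.\<close>

lemma runs_shift_loop:
  assumes "ints \<sigma> ''lo'' 0 = l" "ints \<sigma> ''j'' 0 = j" "ints \<sigma> ''p'' = p"
  shows "runs shift_loop \<sigma> (\<lambda>k \<sigma>'. k = 0 \<and>
     ints \<sigma>' ''p'' = (\<lambda>u. if l < u \<and> u \<le> j then p (u - 1) else p u))"
  using assms
proof (induction j arbitrary: \<sigma> p)
  case 0
  then show ?case
    unfolding shift_loop_def by (subst runs_Loop) auto
next
  case (Suc j)
  show ?case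
  proof (cases "l < Suc j")
    case False
    then show ?thesis
      unfolding shift_loop_def using Suc.prems by (subst runs_Loop) auto
  next
    case True
    let ?\<tau> = "put_int ''j'' 0 j (put_int ''p'' (Suc j) (p j) \<sigma>)"
    let ?q = "p(Suc j := p j)"
    have "runs shift_loop ?\<tau> (\<lambda>k \<sigma>'. k = 0 \<and>
      ints \<sigma>' ''p'' = (\<lambda>u. if l < u \<and> u \<le> j then ?q (u - 1) else ?q u))"
      using Suc.prems by (intro Suc.IH) auto
    moreover have "(\<lambda>u. if l < u \<and> u \<le> j then ?q (u - 1) else ?q u)
      = (\<lambda>u. if l < u \<and> u \<le> Suc j then p (u - 1) else p u)"
      using True by (auto simp: fun_eq_iff le_Suc_eq)
    ultimately show ?thesis
      unfolding shift_loop_def using Suc.prems True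
      by (subst runs_Loop) (simp add: runs_simps)
  qed
qed

text \<open>Once \<open>m = s\<close>, insertion still shifts into cell \<open>s\<close>, which is never read: the smallest of the
  \<open>s + 1\<close> candidates drops out.\<close>
definition top_loop :: com where
  "top_loop = Seq (SetIVar ''m'' (IConst 0)) (for_loop ''i'' ''n''
     (Seq (SetIVar ''lo'' (IConst 0)) (Seq (SetIVar ''hi'' (IVar ''m'')) (Seq search_loop
       (Seq (SetIVar ''j'' (IVar ''m'')) (Seq shift_loop
         (Seq (SetInt ''p'' (IVar ''lo'') (IVar ''i''))
           (Cond (ILess (IVar ''m'') (IVar ''s'')) (SetIVar ''m'' (IPlus (IVar ''m'') (IConst 1))) Skip))))))))"

lemma top_loop_writes [simp]:
  "int_writes top_loop = {''i'', ''j'', ''lo'', ''hi'', ''mid'', ''m'', ''p''}" "real_writes top_loop = {}"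
  by (auto simp: top_loop_def)

text \<open>There are \<open>n\<close> insertions, each with a search among at most \<open>s\<close>
  cells; after \<open>i\<close> rounds the list has length \<open>min i s\<close>.\<close>

lemma runs_top_loop:
  assumes \<sigma>: "ints \<sigma> ''n'' 0 = n" "ints \<sigma> ''s'' 0 = s" "reals \<sigma> ''a'' = a" and "s \<le> n"
  shows "runs top_loop \<sigma> (\<lambda>k \<sigma>'. k \<le> n * floorlog 2 s \<and> top_sorted a n s (ints \<sigma>' ''p''))"
proof -
  define I where "I i \<tau> \<longleftrightarrow> ints \<tau> ''m'' 0 = min i s \<and> top_sorted a i (min i s) (ints \<tau> ''p'')"
    for i and \<tau> :: mem
  have "runs top_loop \<sigma> (\<lambda>k \<sigma>'. k \<le> n * floorlog 2 s \<and> I n \<sigma>')"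
    unfolding top_loop_def runs_Seq [of "SetIVar _ _" "for_loop _ _ _"] runs_SetInt add_0
  proof (rule runs_for_uniform)
    show "I 0 (put_int ''i'' 0 0 (put_int ''m'' (ival (IConst 0) \<sigma>) (ival (IConst 0) \<sigma>) \<sigma>))"
      by (simp add: I_def top_sorted_def)
    fix i \<tau>
    let ?body = "Seq (SetIVar ''lo'' (IConst 0)) (Seq (SetIVar ''hi'' (IVar ''m'')) (Seq search_loop
       (Seq (SetIVar ''j'' (IVar ''m'')) (Seq shift_loop
         (Seq (SetInt ''p'' (IVar ''lo'') (IVar ''i''))
           (Cond (ILess (IVar ''m'') (IVar ''s'')) (SetIVar ''m'' (IPlus (IVar ''m'') (IConst 1))) Skip))))))"
    assume i: "i < n" "ints \<tau> ''i'' 0 = i" and I: "I i \<tau>"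
      and "frame (for_loop ''i'' ''n'' ?body) (put_int ''m'' (ival (IConst 0) \<sigma>) (ival (IConst 0) \<sigma>) \<sigma>) \<tau>"
    then have \<tau>: "ints \<tau> ''s'' 0 = s" "reals \<tau> ''a'' = a"
      using \<sigma> by (simp_all add: frame_ints frame_reals)
    define m where "m = min i s"
    define p where "p = ints \<tau> ''p''"
    have top: "top_sorted a i m p" and m: "ints \<tau> ''m'' 0 = m" "m \<le> s"
      using I by (auto simp: I_def m_def p_def)
    let ?\<tau>1 = "put_int ''hi'' 0 m (put_int ''lo'' 0 0 \<tau>)"
    have search: "runs search_loop ?\<tau>1 (\<lambda>k \<sigma>'. k \<le> floorlog 2 (m - 0) \<and>
     (\<exists>l\<le>m. ints \<sigma>' ''lo'' 0 = l \<and> (\<forall>u<l. a i \<le> a (p u)) \<and> (\<forall>u. l \<le> u \<longrightarrow> u < m \<longrightarrow> a (p u) < a i)))"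
      using top i \<tau> unfolding top_sorted_def
      by (intro runs_search_loop) (simp_all add: p_def)
    have "runs search_loop ?\<tau>1 (\<lambda>k \<tau>'. runs (Seq (SetIVar ''j'' (IVar ''m'')) (Seq shift_loop
         (Seq (SetInt ''p'' (IVar ''lo'') (IVar ''i''))
           (Cond (ILess (IVar ''m'') (IVar ''s'')) (SetIVar ''m'' (IPlus (IVar ''m'') (IConst 1))) Skip)))) \<tau>'
        (\<lambda>l \<tau>''. k + l \<le> floorlog 2 s \<and> I (Suc i) (put_int ''i'' 0 (Suc i) \<tau>'')))"
    proof (rule runs_mono [OF search])
      fix k \<tau>2 assume e: "exec search_loop ?\<tau>1 k \<tau>2" and h: "k \<le> floorlog 2 (m - 0) \<and>
       (\<exists>l\<le>m. ints \<tau>2 ''lo'' 0 = l \<and> (\<forall>u<l. a i \<le> a (p u)) \<and> (\<forall>u. l \<le> u \<longrightarrow> u < m \<longrightarrow> a (p u) < a i))"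
      then obtain l where l: "l \<le> m" "ints \<tau>2 ''lo'' 0 = l" "\<forall>u<l. a i \<le> a (p u)"
        "\<forall>u. l \<le> u \<longrightarrow> u < m \<longrightarrow> a (p u) < a i" by blast
      have k: "k \<le> floorlog 2 s"
        using h floorlog_mono [OF m(2), of 2] by simp
      note fr = frame_ints [OF exec_frame [OF e]]
      have \<tau>2: "ints \<tau>2 ''i'' 0 = i" "ints \<tau>2 ''p'' = p" "ints \<tau>2 ''m'' 0 = m" "ints \<tau>2 ''s'' 0 = s"
        using i m \<tau> by (simp_all add: fr p_def)
      let ?\<tau>3 = "put_int ''j'' 0 m \<tau>2"
      have shift: "runs shift_loop ?\<tau>3 (\<lambda>k \<sigma>'. k = 0 \<and>
        ints \<sigma>' ''p'' = (\<lambda>u. if l < u \<and> u \<le> m then p (u - 1) else p u))"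
        using l \<tau>2 by (intro runs_shift_loop) auto
      have "runs shift_loop ?\<tau>3 (\<lambda>k' \<tau>'. runs (Seq (SetInt ''p'' (IVar ''lo'') (IVar ''i''))
           (Cond (ILess (IVar ''m'') (IVar ''s'')) (SetIVar ''m'' (IPlus (IVar ''m'') (IConst 1))) Skip)) \<tau>'
           (\<lambda>l \<tau>''. k + (k' + l) \<le> floorlog 2 s \<and> I (Suc i) (put_int ''i'' 0 (Suc i) \<tau>'')))"
      proof (rule runs_mono [OF shift])
        fix k' \<tau>4 assume e: "exec shift_loop ?\<tau>3 k' \<tau>4" and h: "k' = 0 \<and>
          ints \<tau>4 ''p'' = (\<lambda>u. if l < u \<and> u \<le> m then p (u - 1) else p u)"
        note fr = frame_ints [OF exec_frame [OF e]]
        have \<tau>4: "ints \<tau>4 ''i'' 0 = i" "ints \<tau>4 ''lo'' 0 = l" "ints \<tau>4 ''m'' 0 = m" "ints \<tau>4 ''s'' 0 = s"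
          "ints \<tau>4 ''p'' = (\<lambda>u. if l < u \<and> u \<le> m then p (u - 1) else p u)"
          using \<tau>2 l h by (simp_all add: fr)
        have "top_sorted a (Suc i) (min (Suc i) s) ((ints \<tau>4 ''p'')(l := i))"
          by (rule top_sorted_insert [of _ _ _ p l]) (use top l \<tau>4(5) in \<open>auto simp: m_def\<close>)
        then show "runs (Seq (SetInt ''p'' (IVar ''lo'') (IVar ''i''))
           (Cond (ILess (IVar ''m'') (IVar ''s'')) (SetIVar ''m'' (IPlus (IVar ''m'') (IConst 1))) Skip)) \<tau>4
           (\<lambda>l \<tau>''. k + (k' + l) \<le> floorlog 2 s \<and> I (Suc i) (put_int ''i'' 0 (Suc i) \<tau>''))"
          using h k \<tau>4(1-4) by (cases "i < s") (simp_all add: runs_simps I_def m_def min_def)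
      qed
      then show "runs (Seq (SetIVar ''j'' (IVar ''m'')) (Seq shift_loop
         (Seq (SetInt ''p'' (IVar ''lo'') (IVar ''i''))
           (Cond (ILess (IVar ''m'') (IVar ''s'')) (SetIVar ''m'' (IPlus (IVar ''m'') (IConst 1))) Skip)))) \<tau>2
        (\<lambda>l \<tau>''. k + l \<le> floorlog 2 s \<and> I (Suc i) (put_int ''i'' 0 (Suc i) \<tau>''))"
        using \<tau>2 by (simp add: runs_Seq runs_SetInt)
    qed
    then show "runs ?body \<tau> (\<lambda>k \<tau>'. k \<le> floorlog 2 s \<and> I (Suc i) (put_int ''i'' 0 (Suc i) \<tau>'))"
      using m by (simp add: runs_Seq runs_SetInt)
  qed (use \<sigma> in auto)
  then show ?thesis
    by (rule runs_mono) (use \<open>s \<le> n\<close> in \<open>simp add: I_def min_absorb2\<close>)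
qed

section \<open>Optimality of sparse soft thresholding\<close>

text \<open>Written with the case distinctions that \<open>scatter_loop\<close> makes.\<close>

definition soft :: "real \<Rightarrow> real \<Rightarrow> real" where
  "soft \<theta> c = (if \<theta> < \<bar>c\<bar> then if c < 0 then c + \<theta> else c - \<theta> else 0)"

text \<open>Coordinatewise, \<open>soft \<theta> c\<close> minimizes \<open>(c - z)\<^sup>2 + 2 \<theta> \<bar>z\<bar>\<close>, and its gain over \<open>z = 0\<close> is
  monotone in \<open>\<bar>c\<bar>\<close>, so that a support of given size is best put on the largest entries.\<close>
lemma sparse_soft_optimal:
  fixes w z :: "nat \<Rightarrow> real"
  assumes P: "P \<subseteq> {..<n}" and card: "card {i. i < n \<and> z i \<noteq> 0} \<le> card P"
    and top: "\<And>i j. i \<in> P \<Longrightarrow> j < n \<Longrightarrow> j \<notin> P \<Longrightarrow> \<bar>w j\<bar> \<le> \<bar>w i\<bar>" and \<theta>: "0 \<le> \<theta>"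
  defines "v \<equiv> \<lambda>i. if i \<in> P then soft \<theta> (w i) else 0"
  shows "(\<Sum>i<n. (w i - v i)\<^sup>2) + 2 * \<theta> * (\<Sum>i<n. \<bar>v i\<bar>)
    \<le> (\<Sum>i<n. (w i - z i)\<^sup>2) + 2 * \<theta> * (\<Sum>i<n. \<bar>z i\<bar>)"
proof -
  let ?Z = "{i. i < n \<and> z i \<noteq> 0}"
  \<comment> \<open>\<open>a i\<close> is the gain over 0 in coordinate \<open>i\<close>: attained
    by \<open>v\<close> on \<open>P\<close>, and an upper bound for \<open>z\<close> on its support.
    The claim thus reduces to comparing the sums of \<open>a\<close> over the two supports.\<close>
  define a where "a i = (max (\<bar>w i\<bar> - \<theta>) 0)\<^sup>2" for i
  have v: "(w i - v i)\<^sup>2 + 2 * \<theta> * \<bar>v i\<bar> = (w i)\<^sup>2 - (if i \<in> P then a i else 0)" for i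
    using \<theta> by (auto simp: v_def soft_def a_def max_def abs_if power2_eq_square algebra_simps)
  have z: "(w i)\<^sup>2 - (if i \<in> ?Z then a i else 0) \<le> (w i - z i)\<^sup>2 + 2 * \<theta> * \<bar>z i\<bar>" if "i < n" for i
  proof (cases "z i = 0")
    case False
    have "w i * z i \<le> \<bar>w i\<bar> * \<bar>z i\<bar>"
      by (metis abs_ge_self abs_mult)
    then have "(w i)\<^sup>2 - 2 * ((\<bar>w i\<bar> - \<theta>) * \<bar>z i\<bar>) + \<bar>z i\<bar>\<^sup>2 \<le> (w i - z i)\<^sup>2 + 2 * \<theta> * \<bar>z i\<bar>"
      by (simp add: power2_eq_square algebra_simps)
    moreover have "- a i \<le> - 2 * ((\<bar>w i\<bar> - \<theta>) * \<bar>z i\<bar>) + \<bar>z i\<bar>\<^sup>2"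
    proof (cases "\<theta> \<le> \<bar>w i\<bar>")
      case True
      then show ?thesis
        using zero_le_power2 [of "\<bar>z i\<bar> - (\<bar>w i\<bar> - \<theta>)"]
        by (simp add: a_def power2_eq_square algebra_simps)
    next
      case False
      then have "(\<bar>w i\<bar> - \<theta>) * \<bar>z i\<bar> \<le> 0"
        by (intro mult_nonpos_nonneg) auto
      moreover have "a i = 0" using False by (simp add: a_def max_def)
      ultimately show ?thesis using zero_le_power2 [of "\<bar>z i\<bar>"] by linarith
    qed
    moreover have "(if i \<in> ?Z then a i else 0) = a i" using that False by simp
    ultimately show ?thesis by linarith
  qed (use that in simp)
  have "(\<Sum>i<n. (w i - v i)\<^sup>2) + 2 * \<theta> * (\<Sum>i<n. \<bar>v i\<bar>) = (\<Sum>i<n. (w i)\<^sup>2) - (\<Sum>i<n. if i \<in> P then a i else 0)"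
    by (simp add: sum_distrib_left sum.distrib [symmetric] sum_subtractf [symmetric] v)
  also have "(\<Sum>i<n. if i \<in> P then a i else 0) = sum a P"
    using P by (simp add: sum.If_cases Int_absorb1)
  also have "sum a ?Z \<le> sum a P"
  proof (rule sum_le_sum_top)
    show "finite P" using P finite_subset by blast
    show "a j \<le> a i" if "i \<in> P" "j \<in> ?Z - P" for i j
      unfolding a_def using top [of i j] that by (intro power_mono) auto
  qed (use card in \<open>auto simp: a_def\<close>)
  then have "(\<Sum>i<n. (w i)\<^sup>2) - sum a P \<le> (\<Sum>i<n. (w i)\<^sup>2) - sum a ?Z" by simp
  also have "sum a ?Z = (\<Sum>i<n. if i \<in> ?Z then a i else 0)"
  proof -
    have "{..<n} \<inter> ?Z = ?Z" by auto
    then show ?thesis by (simp add: sum.If_cases del: mem_Collect_eq)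
  qed
  also have "(\<Sum>i<n. (w i)\<^sup>2) - (\<Sum>i<n. if i \<in> ?Z then a i else 0)
      \<le> (\<Sum>i<n. (w i - z i)\<^sup>2 + 2 * \<theta> * \<bar>z i\<bar>)"
    unfolding sum_subtractf [symmetric] using z by (intro sum_mono) simp
  finally show ?thesis
    by (simp add: sum_distrib_left sum.distrib)
qed

text \<open>For sorted \<open>b\<close>, the sum of the positive parts of \<open>b u - \<theta>\<close> is the maximum over \<open>k\<close> of
  \<open>b 0 + \<dots> + b (k - 1) - k \<theta>\<close>; hence the largest of \<open>0\<close> and all \<open>(b 0 + \<dots> + b (k - 1) - R) / k\<close>
  is the correct threshold for the radius \<open>R\<close>.\<close>
lemma threshold_sum:
  fixes b :: "nat \<Rightarrow> real"
  assumes srt: "\<And>u v. u \<le> v \<Longrightarrow> v < s \<Longrightarrow> b v \<le> b u" and R: "0 \<le> R" and \<theta>: "0 \<le> \<theta>"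
    and upper: "\<And>k. 1 \<le> k \<Longrightarrow> k \<le> s \<Longrightarrow> ((\<Sum>u<k. b u) - R) / real k \<le> \<theta>"
    and attained: "\<theta> = 0 \<or> (\<exists>k. 1 \<le> k \<and> k \<le> s \<and> \<theta> = ((\<Sum>u<k. b u) - R) / real k)"
  shows "(\<Sum>u<s. max (b u - \<theta>) 0) \<le> R" and "\<theta> * ((\<Sum>u<s. max (b u - \<theta>) 0) - R) = 0"
proof -
  \<comment> \<open>The number of entries above \<theta>; since \<open>b\<close> is sorted, they
    form a prefix.\<close>
  define k where "k = (LEAST u. u = s \<or> b u \<le> \<theta>)"
  have k: "k = s \<or> b k \<le> \<theta>" unfolding k_def by (rule LeastI [of _ s]) simp
  have ks: "k \<le> s" unfolding k_def by (rule Least_le) simp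
  have below: "\<theta> < b u" if "u < k" for u
    using not_less_Least [of u "\<lambda>u. u = s \<or> b u \<le> \<theta>"] that by (auto simp: k_def [symmetric])
  have above: "b u \<le> \<theta>" if "k \<le> u" "u < s" for u
    using k srt [OF that] that by auto
  have "(\<Sum>u<s. max (b u - \<theta>) 0) = (\<Sum>u<k. b u - \<theta>)"
  proof (rule sum.mono_neutral_cong_right)
    show "\<forall>u\<in>{..<s} - {..<k}. max (b u - \<theta>) 0 = 0"
      using above by (simp add: max_def)
    show "max (b u - \<theta>) 0 = b u - \<theta>" if "u \<in> {..<k}" for u
      using below [of u] that by (simp add: max_def)
  qed (use ks in auto)
  also have "\<dots> = (\<Sum>u<k. b u) - real k * \<theta>" by (simp add: sum_subtractf)
  also have "\<dots> \<le> R"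
    using upper [of k] ks R by (cases "k = 0") (auto simp: field_simps)
  finally show le: "(\<Sum>u<s. max (b u - \<theta>) 0) \<le> R" .
  show "\<theta> * ((\<Sum>u<s. max (b u - \<theta>) 0) - R) = 0"
  proof (cases "\<theta> = 0")
    case False
    \<comment> \<open>This \<open>k\<close> is the prefix that attains \<theta>, possibly another
      one. Truncating at 0 and adding the later terms only increases the sum, which yields the
      inequality opposite to \<open>le\<close>.\<close>
    then obtain k where k: "1 \<le> k" "k \<le> s" "\<theta> = ((\<Sum>u<k. b u) - R) / real k"
      using attained by auto
    have "R = (\<Sum>u<k. b u) - real k * \<theta>" using k by simp
    also have "\<dots> = (\<Sum>u<k. b u - \<theta>)" by (simp add: sum_subtractf)
    also have "\<dots> \<le> (\<Sum>u<k. max (b u - \<theta>) 0)" by (intro sum_mono) simp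
    also have "\<dots> \<le> (\<Sum>u<s. max (b u - \<theta>) 0)" using k by (intro sum_mono2) auto
    finally show ?thesis using le by simp
  qed simp
qed

section \<open>Projection and subproblem solved by thresholding\<close>

lemma top_sortedD:
  assumes "top_sorted a n s p"
  shows "p ` {..<s} \<subseteq> {..<n}" "card (p ` {..<s}) = s"
    "\<And>i j. i \<in> p ` {..<s} \<Longrightarrow> j < n \<Longrightarrow> j \<notin> p ` {..<s} \<Longrightarrow> a j \<le> a i"
  using assms by (auto simp: top_sorted_def card_image)

lemma top_sorted_cong:
  "(\<And>i. i < n \<Longrightarrow> a i = a' i) \<Longrightarrow> top_sorted a n s p \<Longrightarrow> top_sorted a' n s p"
  unfolding top_sorted_def
  by (elim conjE, intro conjI, assumption, assumption)
    (metis image_subset_iff lessThan_iff order_le_less_trans)+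

text \<open>The case \<theta> = 0 of \<open>sparse_soft_optimal\<close>, where the penalty
  vanishes.\<close>

lemma top_sorted_projection:
  assumes x: "x \<in> carrier_vec n" and top: "top_sorted (\<lambda>i. \<bar>x $ i\<bar>) n s p"
  shows "is_projection (sparse_vecs n s) x (vec n (\<lambda>i. if i \<in> p ` {..<s} then x $ i else 0))"
    (is "is_projection _ _ ?y")
proof -
  note P = top_sortedD [OF top]
  have y: "?y $ i = (if i \<in> p ` {..<s} then soft 0 (x $ i) else 0)" if "i < n" for i
    using that by (simp add: soft_def)
  have "nnz ?y \<le> card (p ` {..<s})"
    unfolding nnz_def by (intro card_mono) (auto split: if_splits)
  then have "?y \<in> sparse_vecs n s"
    using P(2) by (simp add: sparse_vecs_def)
  moreover have "l2 (x - ?y) \<le> l2 (x - z)" if z: "z \<in> carrier_vec n" "nnz z \<le> s" for z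
  proof -
    have card: "card {i. i < n \<and> z $ i \<noteq> 0} \<le> card (p ` {..<s})"
      using z P(2) unfolding nnz_def by (simp only: carrier_vecD)
    have "(\<Sum>i<n. (x $ i - ?y $ i)\<^sup>2) = (\<Sum>i<n. (x $ i - (if i \<in> p ` {..<s} then soft 0 (x $ i) else 0))\<^sup>2)"
      by (intro sum.cong refl) (simp only: y lessThan_iff)
    also have "\<dots> \<le> (\<Sum>i<n. (x $ i - z $ i)\<^sup>2)"
      using sparse_soft_optimal [OF P(1) card P(3) order_refl] by simp
    finally show ?thesis
      unfolding l2_le_iff l2_sq using x z by simp
  qed
  ultimately show ?thesis
    by (auto simp: is_projection_def sparse_vecs_def)
qed

text \<open>Completing the square: \<open>2 * s * \<beta> * \<eta>\<close> is \<alpha> / 24, which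
  puts the centre at \<open>xhat\<close> minus 12 / \<alpha> times the gradient; the second sum does
  not involve \<open>v\<close>.\<close>

lemma subproblem_eq:
  assumes c: "x \<in> carrier_vec n" "xhat \<in> carrier_vec n" "g x \<in> carrier_vec n" "v \<in> carrier_vec n"
    and pos: "\<beta> > 0" "\<alpha> > 0" "1 \<le> s"
  shows "subproblem g \<beta> \<alpha> s x xhat v = \<alpha> / 24 * (\<Sum>i<n. (xhat $ i - 12 * g x $ i / \<alpha> - v $ i)\<^sup>2)
    + (\<Sum>i<n. g x $ i * (xhat $ i - x $ i) - 6 * (g x $ i)\<^sup>2 / \<alpha>)"
proof -
  have coeff: "2 * real s * \<beta> * eta \<beta> \<alpha> s = \<alpha> / 24"
    using pos by (simp add: eta_def)
  have "subproblem g \<beta> \<alpha> s x xhat v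
    = (\<Sum>i<n. (v $ i - x $ i) * g x $ i + \<alpha> / 24 * (v $ i - xhat $ i)\<^sup>2)"
    unfolding subproblem_def coeff l2_sq scalar_prod_sum [OF c(3)]
    using c by (simp add: sum.distrib sum_distrib_left)
  also have "\<dots> = (\<Sum>i<n. \<alpha> / 24 * (xhat $ i - 12 * g x $ i / \<alpha> - v $ i)\<^sup>2
      + (g x $ i * (xhat $ i - x $ i) - 6 * (g x $ i)\<^sup>2 / \<alpha>))"
    using pos by (intro sum.cong refl) (simp add: power2_eq_square field_simps)
  finally show ?thesis
    by (simp add: sum.distrib sum_distrib_left)
qed

text \<open>Lagrangian sufficiency with multiplier 2 \<theta>: \<open>mass\<close> consists of
  feasibility and complementary slackness, so a sparse minimizer of the penalized sum is optimal in
  the ball. This direction of duality also holds for nonconvex constraints such as sparsity.\<close>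

lemma soft_subproblem:
  fixes g :: "rvec \<Rightarrow> rvec"
  assumes c: "x \<in> carrier_vec n" "xhat \<in> carrier_vec n" "g x \<in> carrier_vec n"
    and pos: "\<beta> > 0" "\<alpha> > 0" "1 \<le> s" and \<theta>: "0 \<le> \<theta>"
  defines "w \<equiv> \<lambda>i. xhat $ i - 12 * g x $ i / \<alpha>"
  assumes top: "top_sorted (\<lambda>i. \<bar>w i\<bar>) n s p"
    and mass: "(\<Sum>u<s. max (\<bar>w (p u)\<bar> - \<theta>) 0) \<le> R" "\<theta> * ((\<Sum>u<s. max (\<bar>w (p u)\<bar> - \<theta>) 0) - R) = 0"
  defines "v \<equiv> vec n (\<lambda>i. if i \<in> p ` {..<s} then soft \<theta> (w i) else 0)"
  shows "v \<in> l1_ball n R \<inter> sparse_vecs n s"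
    and "\<forall>z \<in> l1_ball n R \<inter> sparse_vecs n s. subproblem g \<beta> \<alpha> s x xhat v \<le> subproblem g \<beta> \<alpha> s x xhat z"
proof -
  let ?P = "p ` {..<s}"
  note P = top_sortedD [OF top]
  have inj: "inj_on p {..<s}" using top by (simp add: top_sorted_def)
  have vc: "v \<in> carrier_vec n" by (simp add: v_def)
  have vi: "v $ i = (if i \<in> ?P then soft \<theta> (w i) else 0)" if "i < n" for i
    using that by (simp add: v_def)
  have "nnz v \<le> card ?P"
    unfolding nnz_def by (intro card_mono) (auto simp: v_def split: if_splits)
  then have sparse: "v \<in> sparse_vecs n s"
    using P(2) vc by (simp add: sparse_vecs_def)
  have "l1 v = (\<Sum>i<n. \<bar>if i \<in> ?P then soft \<theta> (w i) else 0\<bar>)"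
    using vc vi by (simp add: l1_def)
  also have "\<dots> = (\<Sum>i\<in>?P. \<bar>soft \<theta> (w i)\<bar>)"
    using P(1) by (intro sum.mono_neutral_cong_right) auto
  also have "\<dots> = (\<Sum>i\<in>?P. max (\<bar>w i\<bar> - \<theta>) 0)"
    using \<theta> by (intro sum.cong refl) (auto simp: soft_def max_def abs_if)
  also have "\<dots> = (\<Sum>u<s. max (\<bar>w (p u)\<bar> - \<theta>) 0)"
    using inj by (simp add: sum.reindex)
  finally have l1: "l1 v = (\<Sum>u<s. max (\<bar>w (p u)\<bar> - \<theta>) 0)" .
  then show "v \<in> l1_ball n R \<inter> sparse_vecs n s"
    using mass(1) vc sparse by (simp add: l1_ball_def)
  show "\<forall>z \<in> l1_ball n R \<inter> sparse_vecs n s. subproblem g \<beta> \<alpha> s x xhat v \<le> subproblem g \<beta> \<alpha> s x xhat z"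
  proof
    fix z assume "z \<in> l1_ball n R \<inter> sparse_vecs n s"
    then have z: "z \<in> carrier_vec n" "l1 z \<le> R" "nnz z \<le> s"
      by (auto simp: l1_ball_def sparse_vecs_def)
    have card: "card {i. i < n \<and> z $ i \<noteq> 0} \<le> card ?P"
      using z P(2) unfolding nnz_def by (simp only: carrier_vecD)
    have "(\<Sum>i<n. (w i - v $ i)\<^sup>2) + 2 * \<theta> * l1 v
      = (\<Sum>i<n. (w i - (if i \<in> ?P then soft \<theta> (w i) else 0))\<^sup>2)
        + 2 * \<theta> * (\<Sum>i<n. \<bar>if i \<in> ?P then soft \<theta> (w i) else 0\<bar>)"
      using vc vi by (simp add: l1_def)
    also have "\<dots> \<le> (\<Sum>i<n. (w i - z $ i)\<^sup>2) + 2 * \<theta> * l1 z"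
      using sparse_soft_optimal [OF P(1) card P(3) \<theta>] z(1) by (simp only: l1_def carrier_vecD)
    also have "2 * \<theta> * l1 z \<le> 2 * \<theta> * R"
      using z \<theta> by (intro mult_left_mono) auto
    \<comment> \<open>Complementary slackness lets the two penalties cancel.\<close>
    also have "\<theta> * R = \<theta> * l1 v"
      using mass(2) l1 by auto
    then have "2 * \<theta> * R = 2 * \<theta> * l1 v" by simp
    finally have "(\<Sum>i<n. (w i - v $ i)\<^sup>2) \<le> (\<Sum>i<n. (w i - z $ i)\<^sup>2)" by simp
    then show "subproblem g \<beta> \<alpha> s x xhat v \<le> subproblem g \<beta> \<alpha> s x xhat z"
      using pos unfolding subproblem_eq [where g = g and x = x, OF c vc pos]
        subproblem_eq [where g = g and x = x, OF c z(1) pos] w_def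
      by (simp add: mult_left_mono)
  qed
qed

section \<open>Array loops\<close>

definition map_loop :: "string \<Rightarrow> rexp \<Rightarrow> com" where
  "map_loop d e = for_loop ''i'' ''n'' (SetReal d (IVar ''i'') e)"

lemma map_loop_writes [simp]:
  "int_writes (map_loop d e) = {''i''}" "real_writes (map_loop d e) = {d}"
  by (simp_all add: map_loop_def)

abbreviation RAt :: "string \<Rightarrow> rexp" where "RAt a \<equiv> RCell a (IVar ''i'')"

text \<open>The last condition on \<tau> allows \<open>e\<close> to read the cell about to be
  overwritten, as the in-place updates of \<open>w\<close>, \<open>x\<close> and \<open>grad\<close>
  do.\<close>

lemma runs_map_loop:
  assumes n: "ints \<sigma> ''n'' 0 = n"
    and F: "\<And>i \<tau>. i < n \<Longrightarrow> (\<And>b. b \<noteq> d \<Longrightarrow> reals \<tau> b = reals \<sigma> b) \<Longrightarrow>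
      (\<And>b. b \<noteq> ''i'' \<Longrightarrow> ints \<tau> b = ints \<sigma> b) \<Longrightarrow> ints \<tau> ''i'' 0 = i \<Longrightarrow>
      reals \<tau> d i = reals \<sigma> d i \<Longrightarrow> rval e \<tau> = F i"
  shows "runs (map_loop d e) \<sigma> (\<lambda>k \<sigma>'. k \<le> n * rcost e \<and> (\<forall>i<n. reals \<sigma>' d i = F i))"
proof -
  define I where "I j \<tau> \<longleftrightarrow> (\<forall>q<j. reals \<tau> d q = F q) \<and> (\<forall>q\<ge>j. reals \<tau> d q = reals \<sigma> d q)"
    for j and \<tau> :: mem
  have "runs (map_loop d e) \<sigma> (\<lambda>k \<sigma>'. k \<le> n * rcost e \<and> I n \<sigma>')"
    unfolding map_loop_def
  proof (rule runs_for_uniform)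
    fix j \<tau>
    assume j: "j < n" "ints \<tau> ''i'' 0 = j" "I j \<tau>"
      and fr: "frame (for_loop ''i'' ''n'' (SetReal d (IVar ''i'') e)) \<sigma> \<tau>"
    have "rval e \<tau> = F j"
      using j fr by (intro F) (auto simp: I_def frame_ints frame_reals)
    then show "runs (SetReal d (IVar ''i'') e) \<tau>
        (\<lambda>k \<tau>'. k \<le> rcost e \<and> I (Suc j) (put_int ''i'' 0 (Suc j) \<tau>'))"
      using j by (simp add: runs_simps I_def less_Suc_eq)
  qed (use n in \<open>auto simp: I_def\<close>)
  then show ?thesis
    by (rule runs_mono) (simp add: I_def)
qed

definition abs_loop :: "string \<Rightarrow> com" where
  "abs_loop x = for_loop ''i'' ''n'' (Cond (RLess (RAt x) (RNum 0))
     (SetReal ''a'' (IVar ''i'') (RMinus (RNum 0) (RAt x)))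
     (SetReal ''a'' (IVar ''i'') (RAt x)))"

lemma abs_loop_writes [simp]:
  "int_writes (abs_loop x) = {''i''}" "real_writes (abs_loop x) = {''a''}"
  by (simp_all add: abs_loop_def)

text \<open>The 4 counts a comparison, a subtraction and two charged constants 0.\<close>

lemma runs_abs_loop:
  assumes n: "ints \<sigma> ''n'' 0 = n" and x: "x \<noteq> ''a''"
  shows "runs (abs_loop x) \<sigma> (\<lambda>k \<sigma>'. k \<le> n * 4 \<and> (\<forall>i<n. reals \<sigma>' ''a'' i = \<bar>reals \<sigma> x i\<bar>))"
  unfolding abs_loop_def
proof (rule runs_for_uniform)
  fix j \<tau>
  let ?c = "Cond (RLess (RAt x) (RNum 0)) (SetReal ''a'' (IVar ''i'') (RMinus (RNum 0) (RAt x)))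
     (SetReal ''a'' (IVar ''i'') (RAt x))"
  assume j: "j < n" "ints \<tau> ''i'' 0 = j" "\<forall>i<j. reals \<tau> ''a'' i = \<bar>reals \<sigma> x i\<bar>"
    and fr: "frame (for_loop ''i'' ''n'' ?c) \<sigma> \<tau>"
  have "reals \<tau> x = reals \<sigma> x" using fr x by (simp add: frame_reals)
  then show "runs ?c \<tau> (\<lambda>k \<tau>'. k \<le> 4 \<and> (\<forall>i<Suc j. reals (put_int ''i'' 0 (Suc j) \<tau>') ''a'' i = \<bar>reals \<sigma> x i\<bar>))"
    using j by (simp add: runs_simps less_Suc_eq)
qed (use n in auto)

definition gather_loop :: com where
  "gather_loop = for_loop ''j'' ''s'' (SetReal ''w'' (ICell ''p'' (IVar ''j'')) (RCell ''x'' (ICell ''p'' (IVar ''j''))))"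

lemma gather_loop_writes [simp]:
  "int_writes gather_loop = {''j''}" "real_writes gather_loop = {''w''}"
  by (simp_all add: gather_loop_def)

lemma runs_gather_loop:
  assumes "ints \<sigma> ''s'' 0 = s" "ints \<sigma> ''p'' = p"
  shows "runs gather_loop \<sigma> (\<lambda>k \<sigma>'. k = 0 \<and>
    (\<forall>q. reals \<sigma>' ''w'' q = (if q \<in> p ` {..<s} then reals \<sigma> ''x'' q else reals \<sigma> ''w'' q)))"
proof -
  define I where "I j \<tau> \<longleftrightarrow>
      (\<forall>q. reals \<tau> ''w'' q = (if q \<in> p ` {..<j} then reals \<sigma> ''x'' q else reals \<sigma> ''w'' q))"
    for j :: nat and \<tau> :: mem
  let ?c = "SetReal ''w'' (ICell ''p'' (IVar ''j'')) (RCell ''x'' (ICell ''p'' (IVar ''j'')))"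
  have "runs gather_loop \<sigma> (\<lambda>k \<sigma>'. k \<le> s * 0 \<and> I s \<sigma>')"
    unfolding gather_loop_def
  proof (rule runs_for_uniform)
    fix j \<tau>
    assume j: "j < s" "ints \<tau> ''j'' 0 = j" "I j \<tau>" and fr: "frame (for_loop ''j'' ''s'' ?c) \<sigma> \<tau>"
    have "reals \<tau> ''x'' = reals \<sigma> ''x''" "ints \<tau> ''p'' = p"
      using fr assms by (simp_all add: frame_reals frame_ints)
    then show "runs ?c \<tau> (\<lambda>k \<tau>'. k \<le> 0 \<and> I (Suc j) (put_int ''j'' 0 (Suc j) \<tau>'))"
      using j by (simp add: runs_simps I_def lessThan_Suc)
  qed (use assms in \<open>auto simp: I_def\<close>)
  then show ?thesis
    by (rule runs_mono) (simp add: I_def)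
qed

definition threshold_loop :: com where
  "threshold_loop = Seq (SetRVar ''th'' (RNum 0)) (Seq (SetRVar ''S'' (RNum 0)) (for_loop ''j'' ''s''
     (Seq (SetRVar ''S'' (RPlus (RVar ''S'') (RCell ''a'' (ICell ''p'' (IVar ''j'')))))
       (Cond (RLess (RVar ''th'') (RDiv (RMinus (RVar ''S'') (RVar ''R'')) (ROfNat (IPlus (IVar ''j'') (IConst 1)))))
         (SetRVar ''th'' (RDiv (RMinus (RVar ''S'') (RVar ''R'')) (ROfNat (IPlus (IVar ''j'') (IConst 1)))))
         Skip))))"

lemma threshold_loop_writes [simp]:
  "int_writes threshold_loop = {''j''}" "real_writes threshold_loop = {''th'', ''S''}"
  by (auto simp: threshold_loop_def)

text \<open>A running maximum, from 0, of the candidates in \<open>threshold_sum\<close>. A round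
  costs 1 for the prefix sum, 4 for the comparison and 3 for the assignment, which evaluates the
  quotient again.\<close>

lemma runs_threshold_loop:
  assumes \<sigma>: "ints \<sigma> ''s'' 0 = s" "ints \<sigma> ''p'' = p" "reals \<sigma> ''a'' = a" "reals \<sigma> ''R'' 0 = R"
  defines "Q \<equiv> \<lambda>k. ((\<Sum>u<k. a (p u)) - R) / real k"
  shows "runs threshold_loop \<sigma> (\<lambda>k \<sigma>'. k \<le> 2 + s * 8 \<and> 0 \<le> reals \<sigma>' ''th'' 0 \<and>
    (\<forall>k. 1 \<le> k \<longrightarrow> k \<le> s \<longrightarrow> Q k \<le> reals \<sigma>' ''th'' 0) \<and>
    (reals \<sigma>' ''th'' 0 = 0 \<or> (\<exists>k. 1 \<le> k \<and> k \<le> s \<and> reals \<sigma>' ''th'' 0 = Q k)))"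
proof -
  define I where "I j \<tau> \<longleftrightarrow> reals \<tau> ''S'' 0 = (\<Sum>u<j. a (p u)) \<and> 0 \<le> reals \<tau> ''th'' 0 \<and>
    (\<forall>k. 1 \<le> k \<longrightarrow> k \<le> j \<longrightarrow> Q k \<le> reals \<tau> ''th'' 0) \<and>
    (reals \<tau> ''th'' 0 = 0 \<or> (\<exists>k. 1 \<le> k \<and> k \<le> j \<and> reals \<tau> ''th'' 0 = Q k))"
    for j :: nat and \<tau> :: mem
  let ?c = "Seq (SetRVar ''S'' (RPlus (RVar ''S'') (RCell ''a'' (ICell ''p'' (IVar ''j'')))))
       (Cond (RLess (RVar ''th'') (RDiv (RMinus (RVar ''S'') (RVar ''R'')) (ROfNat (IPlus (IVar ''j'') (IConst 1)))))
         (SetRVar ''th'' (RDiv (RMinus (RVar ''S'') (RVar ''R'')) (ROfNat (IPlus (IVar ''j'') (IConst 1)))))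
         Skip)"
  let ?\<sigma> = "put_real ''S'' 0 0 (put_real ''th'' 0 0 \<sigma>)"
  have "runs (for_loop ''j'' ''s'' ?c) ?\<sigma> (\<lambda>k \<sigma>'. k \<le> s * 8 \<and> I s \<sigma>')"
  proof (rule runs_for_uniform)
    fix j \<tau>
    assume j: "j < s" "ints \<tau> ''j'' 0 = j" and I: "I j \<tau>" and fr: "frame (for_loop ''j'' ''s'' ?c) ?\<sigma> \<tau>"
    have \<tau>: "reals \<tau> ''a'' = a" "ints \<tau> ''p'' = p" "reals \<tau> ''R'' 0 = R"
      using fr \<sigma> by (simp_all add: frame_reals frame_ints)
    have S: "reals \<tau> ''S'' 0 + a (p j) = (\<Sum>u<Suc j. a (p u))"
      using I by (simp add: I_def)
    have Q: "(reals \<tau> ''S'' 0 + a (p j) - R) / real (Suc j) = Q (Suc j)"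
      unfolding S Q_def ..
    have I': "I (Suc j) (put_int ''j'' 0 (Suc j) (put_real ''th'' 0 (Q (Suc j)) (put_real ''S'' 0 (reals \<tau> ''S'' 0 + a (p j)) \<tau>)))"
      if "reals \<tau> ''th'' 0 < Q (Suc j)"
      unfolding I_def
    proof (intro conjI allI impI)
      fix k assume "1 \<le> k" "k \<le> Suc j"
      then have "Q k \<le> Q (Suc j)"
        using I that order_trans [of "Q k" "reals \<tau> ''th'' 0"] by (auto simp: I_def le_Suc_eq)
      then show "Q k \<le> reals (put_int ''j'' 0 (Suc j) (put_real ''th'' 0 (Q (Suc j))
          (put_real ''S'' 0 (reals \<tau> ''S'' 0 + a (p j)) \<tau>))) ''th'' 0"
        by simp
    qed (use I that S in \<open>auto simp: I_def\<close>)
    have I'': "I (Suc j) (put_int ''j'' 0 (Suc j) (put_real ''S'' 0 (reals \<tau> ''S'' 0 + a (p j)) \<tau>))"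
      if "\<not> reals \<tau> ''th'' 0 < Q (Suc j)"
      using I that S unfolding I_def by (auto simp: le_Suc_eq)
    show "runs ?c \<tau> (\<lambda>k \<tau>'. k \<le> 8 \<and> I (Suc j) (put_int ''j'' 0 (Suc j) \<tau>'))"
      using j I' I'' Q by (simp add: runs_simps \<tau>)
  qed (use \<sigma> in \<open>auto simp: I_def\<close>)
  then have "runs (for_loop ''j'' ''s'' ?c) ?\<sigma> (\<lambda>k \<sigma>'. k \<le> s * 8 \<and> 0 \<le> reals \<sigma>' ''th'' 0 \<and>
    (\<forall>k. 1 \<le> k \<longrightarrow> k \<le> s \<longrightarrow> Q k \<le> reals \<sigma>' ''th'' 0) \<and>
    (reals \<sigma>' ''th'' 0 = 0 \<or> (\<exists>k. 1 \<le> k \<and> k \<le> s \<and> reals \<sigma>' ''th'' 0 = Q k)))"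
    by (rule runs_mono) (simp add: I_def)
  then show ?thesis
    by (simp add: threshold_loop_def runs_Seq runs_SetReal)
qed

definition scatter_loop :: com where
  "scatter_loop = for_loop ''j'' ''s'' (Cond (RLess (RVar ''th'') (RCell ''a'' (ICell ''p'' (IVar ''j''))))
     (Cond (RLess (RCell ''w'' (ICell ''p'' (IVar ''j''))) (RNum 0))
       (SetReal ''v'' (ICell ''p'' (IVar ''j'')) (RPlus (RCell ''w'' (ICell ''p'' (IVar ''j''))) (RVar ''th'')))
       (SetReal ''v'' (ICell ''p'' (IVar ''j'')) (RMinus (RCell ''w'' (ICell ''p'' (IVar ''j''))) (RVar ''th''))))
     Skip)"

lemma scatter_loop_writes [simp]:
  "int_writes scatter_loop = {''j''}" "real_writes scatter_loop = {''v''}"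
  by (auto simp: scatter_loop_def)

text \<open>Once \<open>v\<close> has been cleared and \<open>a\<close> holds absolute values of
  \<open>w\<close>, this stores \<open>soft\<close> on the selected entries; those not above the
  threshold stay 0.\<close>

lemma runs_scatter_loop:
  assumes \<sigma>: "ints \<sigma> ''s'' 0 = s" "ints \<sigma> ''p'' = p" "reals \<sigma> ''a'' = a" "reals \<sigma> ''w'' = w"
    "reals \<sigma> ''th'' 0 = \<theta>"
  shows "runs scatter_loop \<sigma> (\<lambda>k \<sigma>'. k \<le> s * 4 \<and> (\<forall>q. reals \<sigma>' ''v'' q =
    (if q \<in> p ` {..<s} \<and> \<theta> < a q then if w q < 0 then w q + \<theta> else w q - \<theta> else reals \<sigma> ''v'' q)))"
proof -
  define I where "I j \<tau> \<longleftrightarrow> (\<forall>q. reals \<tau> ''v'' q =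
    (if q \<in> p ` {..<j} \<and> \<theta> < a q then if w q < 0 then w q + \<theta> else w q - \<theta> else reals \<sigma> ''v'' q))"
    for j :: nat and \<tau> :: mem
  let ?c = "Cond (RLess (RVar ''th'') (RCell ''a'' (ICell ''p'' (IVar ''j''))))
     (Cond (RLess (RCell ''w'' (ICell ''p'' (IVar ''j''))) (RNum 0))
       (SetReal ''v'' (ICell ''p'' (IVar ''j'')) (RPlus (RCell ''w'' (ICell ''p'' (IVar ''j''))) (RVar ''th'')))
       (SetReal ''v'' (ICell ''p'' (IVar ''j'')) (RMinus (RCell ''w'' (ICell ''p'' (IVar ''j''))) (RVar ''th''))))
     Skip"
  have "runs scatter_loop \<sigma> (\<lambda>k \<sigma>'. k \<le> s * 4 \<and> I s \<sigma>')"
    unfolding scatter_loop_def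
  proof (rule runs_for_uniform)
    fix j \<tau>
    assume j: "j < s" "ints \<tau> ''j'' 0 = j" "I j \<tau>" and fr: "frame (for_loop ''j'' ''s'' ?c) \<sigma> \<tau>"
    have "reals \<tau> ''a'' = a" "reals \<tau> ''w'' = w" "reals \<tau> ''th'' 0 = \<theta>" "ints \<tau> ''p'' = p"
      using fr \<sigma> by (simp_all add: frame_reals frame_ints)
    then show "runs ?c \<tau> (\<lambda>k \<tau>'. k \<le> 4 \<and> I (Suc j) (put_int ''j'' 0 (Suc j) \<tau>'))"
      using j by (simp add: runs_simps I_def lessThan_Suc) auto
  qed (use \<sigma> in \<open>auto simp: I_def\<close>)
  then show ?thesis
    by (rule runs_mono) (simp add: I_def)
qed

section \<open>One iteration\<close>

text \<open>Array \<open>w\<close> holds first \<open>xhat\<close>, then the point to be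
  thresholded. The values of \<eta> and \<open>v\<close> remain in \<open>e\<close> and
  \<open>v\<close>, where \<open>gradient_update\<close> expects them.\<close>

definition step_program :: com where
  "step_program = Seq (abs_loop ''x'') (Seq top_loop (Seq (map_loop ''w'' (RNum 0)) (Seq gather_loop
     (Seq (map_loop ''w'' (RMinus (RAt ''w'') (RDiv (RTimes (RNum 12) (RAt ''grad'')) (RVar ''alpha''))))
     (Seq (abs_loop ''w'') (Seq top_loop (Seq threshold_loop (Seq (map_loop ''v'' (RNum 0)) (Seq scatter_loop
     (Seq (SetRVar ''e'' (RDiv (RVar ''alpha'') (RTimes (RTimes (RNum 48) (RVar ''beta'')) (ROfNat (IVar ''s'')))))
       (map_loop ''x'' (RPlus (RTimes (RMinus (RNum 1) (RVar ''e'')) (RAt ''x'')) (RTimes (RVar ''e'') (RAt ''v''))))))))))))))"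

lemma step_program_writes [simp]:
  "int_writes step_program = {''i'', ''j'', ''lo'', ''hi'', ''mid'', ''m'', ''p''}"
  "real_writes step_program = {''a'', ''w'', ''th'', ''S'', ''v'', ''e'', ''x''}"
  by (auto simp: step_program_def)

lemma read_vec_carrier [simp]: "read_vec n a \<sigma> \<in> carrier_vec n"
  by (simp add: read_vec_def)

lemma runs_step_program:
  assumes inp: "holds_input n R \<beta> \<alpha> s \<sigma>"
    and pos: "1 \<le> s" "s \<le> n" "R > 0" "\<beta> > 0" "\<alpha> > 0"
    and grad: "g (read_vec n ''x'' \<sigma>) = read_vec n ''grad'' \<sigma>"
  defines "x \<equiv> read_vec n ''x'' \<sigma>" and "\<eta> \<equiv> eta \<beta> \<alpha> s"
  shows "runs step_program \<sigma> (\<lambda>k \<sigma>'. k \<le> 40 * n * floorlog 2 s \<and> reals \<sigma>' ''e'' 0 = \<eta> \<and>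
    fw_step n f g R \<beta> \<alpha> s x (read_vec n ''x'' \<sigma>') \<and> nnz (read_vec n ''v'' \<sigma>') \<le> s \<and>
    read_vec n ''x'' \<sigma>' = (1 - \<eta>) \<cdot>\<^sub>v x + \<eta> \<cdot>\<^sub>v read_vec n ''v'' \<sigma>')"
proof -
  have \<sigma>: "ints \<sigma> ''n'' 0 = n" "ints \<sigma> ''s'' 0 = s" "reals \<sigma> ''R'' 0 = R" "reals \<sigma> ''beta'' 0 = \<beta>"
    "reals \<sigma> ''alpha'' 0 = \<alpha>"
    using inp by (simp_all add: holds_input_def)
  have xi: "x $ i = reals \<sigma> ''x'' i" "g x $ i = reals \<sigma> ''grad'' i" if "i < n" for i
    using that grad by (simp_all add: x_def read_vec_def)
  have xc: "x \<in> carrier_vec n" "g x \<in> carrier_vec n" using grad by (simp_all add: x_def)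
  have "runs (abs_loop ''x'') \<sigma> (\<lambda>k \<sigma>'. k \<le> n * 4 \<and> (\<forall>i<n. reals \<sigma>' ''a'' i = \<bar>reals \<sigma> ''x'' i\<bar>))"
    by (rule runs_abs_loop) (simp_all add: \<sigma>)
  then obtain k1 \<sigma>1 where e1: "exec (abs_loop ''x'') \<sigma> k1 \<sigma>1" and k1: "k1 \<le> n * 4"
    and a1: "\<forall>i<n. reals \<sigma>1 ''a'' i = \<bar>reals \<sigma> ''x'' i\<bar>"
    unfolding runs_def by blast
  \<comment> \<open>The facts \<open>f1\<close> to \<open>f12\<close> trace arrays that a block does
    not write back through the earlier memories.\<close>
  note f1 = frame_ints [OF exec_frame [OF e1]] frame_reals [OF exec_frame [OF e1]]
  define a where "a = reals \<sigma>1 ''a''"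
  have "runs top_loop \<sigma>1 (\<lambda>k \<sigma>'. k \<le> n * floorlog 2 s \<and> top_sorted a n s (ints \<sigma>' ''p''))"
    by (rule runs_top_loop) (simp_all add: \<sigma> f1 a_def pos)
  then obtain k2 \<sigma>2 where e2: "exec top_loop \<sigma>1 k2 \<sigma>2" and k2: "k2 \<le> n * floorlog 2 s"
    and top2: "top_sorted a n s (ints \<sigma>2 ''p'')"
    unfolding runs_def by blast
  note f2 = frame_ints [OF exec_frame [OF e2]] frame_reals [OF exec_frame [OF e2]]
  define p where "p = ints \<sigma>2 ''p''"
  have topx: "top_sorted (\<lambda>i. \<bar>x $ i\<bar>) n s p"
    by (rule top_sorted_cong [OF _ top2 [folded p_def]]) (use a1 in \<open>simp add: a_def xi\<close>)
  define xhat where "xhat = vec n (\<lambda>i. if i \<in> p ` {..<s} then x $ i else 0)"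
  have xh: "xhat \<in> carrier_vec n" by (simp add: xhat_def)
  have proj: "is_projection (sparse_vecs n s) x xhat"
    unfolding xhat_def by (rule top_sorted_projection [OF xc(1) topx])
  have "runs (map_loop ''w'' (RNum 0)) \<sigma>2 (\<lambda>k \<sigma>'. k \<le> n * rcost (RNum 0) \<and> (\<forall>i<n. reals \<sigma>' ''w'' i = 0))"
    by (rule runs_map_loop) (simp_all add: \<sigma> f1 f2)
  then obtain k3 \<sigma>3 where e3: "exec (map_loop ''w'' (RNum 0)) \<sigma>2 k3 \<sigma>3" and k3: "k3 \<le> n * 1"
    and w3: "\<forall>i<n. reals \<sigma>3 ''w'' i = 0"
    unfolding runs_def rcost.simps by blast
  note f3 = frame_ints [OF exec_frame [OF e3]] frame_reals [OF exec_frame [OF e3]]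
  have "runs gather_loop \<sigma>3 (\<lambda>k \<sigma>'. k = 0 \<and>
      (\<forall>q. reals \<sigma>' ''w'' q = (if q \<in> p ` {..<s} then reals \<sigma>3 ''x'' q else reals \<sigma>3 ''w'' q)))"
    by (rule runs_gather_loop) (simp_all add: \<sigma> f1 f2 f3 p_def)
  then obtain k4 \<sigma>4 where e4: "exec gather_loop \<sigma>3 k4 \<sigma>4" and k4: "k4 = 0"
    and w4: "\<forall>q. reals \<sigma>4 ''w'' q = (if q \<in> p ` {..<s} then reals \<sigma>3 ''x'' q else reals \<sigma>3 ''w'' q)"
    unfolding runs_def by blast
  note f4 = frame_ints [OF exec_frame [OF e4]] frame_reals [OF exec_frame [OF e4]]
  have w4': "reals \<sigma>4 ''w'' i = xhat $ i" if "i < n" for i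
    using that w3 w4 by (simp add: xhat_def xi f1 f2 f3)
  define w where "w i = xhat $ i - 12 * g x $ i / \<alpha>" for i
  let ?we = "RMinus (RAt ''w'') (RDiv (RTimes (RNum 12) (RAt ''grad'')) (RVar ''alpha''))"
  have "runs (map_loop ''w'' ?we) \<sigma>4 (\<lambda>k \<sigma>'. k \<le> n * rcost ?we \<and> (\<forall>i<n. reals \<sigma>' ''w'' i = w i))"
    by (rule runs_map_loop) (simp_all add: f1 f2 f3 f4 \<sigma> w4' w_def xi)
  then obtain k5 \<sigma>5 where e5: "exec (map_loop ''w'' ?we) \<sigma>4 k5 \<sigma>5" and k5: "k5 \<le> n * rcost ?we"
    and w5: "\<forall>i<n. reals \<sigma>5 ''w'' i = w i"
    unfolding runs_def by blast
  note f5 = frame_ints [OF exec_frame [OF e5]] frame_reals [OF exec_frame [OF e5]]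
  have "runs (abs_loop ''w'') \<sigma>5 (\<lambda>k \<sigma>'. k \<le> n * 4 \<and> (\<forall>i<n. reals \<sigma>' ''a'' i = \<bar>reals \<sigma>5 ''w'' i\<bar>))"
    by (rule runs_abs_loop) (simp_all add: \<sigma> f1 f2 f3 f4 f5)
  then obtain k6 \<sigma>6 where e6: "exec (abs_loop ''w'') \<sigma>5 k6 \<sigma>6" and k6: "k6 \<le> n * 4"
    and a6: "\<forall>i<n. reals \<sigma>6 ''a'' i = \<bar>reals \<sigma>5 ''w'' i\<bar>"
    unfolding runs_def by blast
  note f6 = frame_ints [OF exec_frame [OF e6]] frame_reals [OF exec_frame [OF e6]]
  define b where "b = reals \<sigma>6 ''a''"
  have b: "b i = \<bar>w i\<bar>" if "i < n" for i
    using a6 w5 that by (simp add: b_def)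
  have "runs top_loop \<sigma>6 (\<lambda>k \<sigma>'. k \<le> n * floorlog 2 s \<and> top_sorted b n s (ints \<sigma>' ''p''))"
    by (rule runs_top_loop) (simp_all add: \<sigma> f1 f2 f3 f4 f5 f6 b_def pos)
  then obtain k7 \<sigma>7 where e7: "exec top_loop \<sigma>6 k7 \<sigma>7" and k7: "k7 \<le> n * floorlog 2 s"
    and top7: "top_sorted b n s (ints \<sigma>7 ''p'')"
    unfolding runs_def by blast
  note f7 = frame_ints [OF exec_frame [OF e7]] frame_reals [OF exec_frame [OF e7]]
  define q where "q = ints \<sigma>7 ''p''"
  have topb: "top_sorted b n s q" using top7 by (simp add: q_def)
  have topw: "top_sorted (\<lambda>i. \<bar>w i\<bar>) n s q"
    by (rule top_sorted_cong [OF b topb])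
  have qn: "q u < n" if "u < s" for u
    using top_sortedD(1) [OF topb] that by auto
  have "runs threshold_loop \<sigma>7 (\<lambda>k \<sigma>'. k \<le> 2 + s * 8 \<and> 0 \<le> reals \<sigma>' ''th'' 0 \<and>
    (\<forall>k. 1 \<le> k \<longrightarrow> k \<le> s \<longrightarrow> ((\<Sum>u<k. b (q u)) - R) / real k \<le> reals \<sigma>' ''th'' 0) \<and>
    (reals \<sigma>' ''th'' 0 = 0 \<or> (\<exists>k. 1 \<le> k \<and> k \<le> s \<and> reals \<sigma>' ''th'' 0 = ((\<Sum>u<k. b (q u)) - R) / real k)))"
    by (rule runs_threshold_loop) (simp_all add: f1 f2 f3 f4 f5 f6 f7 \<sigma> q_def b_def)
  then obtain k8 \<sigma>8 \<theta> where e8: "exec threshold_loop \<sigma>7 k8 \<sigma>8" and k8: "k8 \<le> 2 + s * 8"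
    and \<theta>: "reals \<sigma>8 ''th'' 0 = \<theta>" "0 \<le> \<theta>"
      "\<And>k. 1 \<le> k \<Longrightarrow> k \<le> s \<Longrightarrow> ((\<Sum>u<k. b (q u)) - R) / real k \<le> \<theta>"
      "\<theta> = 0 \<or> (\<exists>k. 1 \<le> k \<and> k \<le> s \<and> \<theta> = ((\<Sum>u<k. b (q u)) - R) / real k)"
    unfolding runs_def by blast
  note f8 = frame_ints [OF exec_frame [OF e8]] frame_reals [OF exec_frame [OF e8]]
  have "b (q v) \<le> b (q u)" if "u \<le> v" "v < s" for u v
    using topb that by (simp add: top_sorted_def)
  note mass = threshold_sum [of s "\<lambda>u. b (q u)" R \<theta>, OF this less_imp_le [OF pos(3)] \<theta>(2-4)]
  have "(\<Sum>u<s. max (b (q u) - \<theta>) 0) = (\<Sum>u<s. max (\<bar>w (q u)\<bar> - \<theta>) 0)"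
    using b qn by (intro sum.cong) auto
  note mass = mass [unfolded this]
  have "runs (map_loop ''v'' (RNum 0)) \<sigma>8 (\<lambda>k \<sigma>'. k \<le> n * rcost (RNum 0) \<and> (\<forall>i<n. reals \<sigma>' ''v'' i = 0))"
    by (rule runs_map_loop) (simp_all add: \<sigma> f1 f2 f3 f4 f5 f6 f7 f8)
  then obtain k9 \<sigma>9 where e9: "exec (map_loop ''v'' (RNum 0)) \<sigma>8 k9 \<sigma>9" and k9: "k9 \<le> n * 1"
    and v9: "\<forall>i<n. reals \<sigma>9 ''v'' i = 0"
    unfolding runs_def rcost.simps by blast
  note f9 = frame_ints [OF exec_frame [OF e9]] frame_reals [OF exec_frame [OF e9]]
  have "runs scatter_loop \<sigma>9 (\<lambda>k \<sigma>'. k \<le> s * 4 \<and> (\<forall>i. reals \<sigma>' ''v'' i =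
    (if i \<in> q ` {..<s} \<and> \<theta> < b i then if reals \<sigma>5 ''w'' i < 0 then reals \<sigma>5 ''w'' i + \<theta> else reals \<sigma>5 ''w'' i - \<theta>
     else reals \<sigma>9 ''v'' i)))"
    by (rule runs_scatter_loop) (simp_all add: f1 f2 f3 f4 f5 f6 f7 f8 f9 \<sigma> \<theta>(1) q_def b_def)
  then obtain k10 \<sigma>10 where e10: "exec scatter_loop \<sigma>9 k10 \<sigma>10" and k10: "k10 \<le> s * 4"
    and v10: "\<forall>i. reals \<sigma>10 ''v'' i =
    (if i \<in> q ` {..<s} \<and> \<theta> < b i then if reals \<sigma>5 ''w'' i < 0 then reals \<sigma>5 ''w'' i + \<theta> else reals \<sigma>5 ''w'' i - \<theta>
     else reals \<sigma>9 ''v'' i)"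
    unfolding runs_def by blast
  note f10 = frame_ints [OF exec_frame [OF e10]] frame_reals [OF exec_frame [OF e10]]
  define v where "v = vec n (\<lambda>i. if i \<in> q ` {..<s} then soft \<theta> (w i) else 0)"
  have v10': "reals \<sigma>10 ''v'' i = v $ i" if "i < n" for i
    using that v10 v9 w5 b by (simp add: v_def soft_def)
  have v: "v \<in> l1_ball n R \<inter> sparse_vecs n s"
    "\<forall>z \<in> l1_ball n R \<inter> sparse_vecs n s. subproblem g \<beta> \<alpha> s x xhat v \<le> subproblem g \<beta> \<alpha> s x xhat z"
    using soft_subproblem [where g = g and x = x and xhat = xhat and n = n and s = s and p = q and R = R,
        OF xc(1) xh xc(2) pos(4,5,1) \<theta>(2) topw [unfolded w_def] mass [unfolded w_def]]
    unfolding v_def w_def by blast+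
  let ?ee = "RDiv (RVar ''alpha'') (RTimes (RTimes (RNum 48) (RVar ''beta'')) (ROfNat (IVar ''s'')))"
  define \<sigma>11 where "\<sigma>11 = put_real ''e'' 0 \<eta> \<sigma>10"
  have e11: "exec (SetRVar ''e'' ?ee) \<sigma>10 5 \<sigma>11"
    using exec.SetReal [of "''e''" "IConst 0" ?ee \<sigma>10]
    by (simp add: eval_nat_numeral \<sigma>11_def \<eta>_def eta_def f1 f2 f3 f4 f5 f6 f7 f8 f9 f10 \<sigma>)
  note f11 = frame_ints [OF exec_frame [OF e11]] frame_reals [OF exec_frame [OF e11]]
  let ?xe = "RPlus (RTimes (RMinus (RNum 1) (RVar ''e'')) (RAt ''x'')) (RTimes (RVar ''e'') (RAt ''v''))"
  have e11e: "reals \<sigma>11 ''e'' 0 = \<eta>" by (simp add: \<sigma>11_def)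
  have "runs (map_loop ''x'' ?xe) \<sigma>11 (\<lambda>k \<sigma>'. k \<le> n * rcost ?xe \<and>
      (\<forall>i<n. reals \<sigma>' ''x'' i = (1 - \<eta>) * x $ i + \<eta> * v $ i))"
    by (rule runs_map_loop) (simp_all add: e11e f1 f2 f3 f4 f5 f6 f7 f8 f9 f10 f11 \<sigma> v10' xi)
  then obtain k12 \<sigma>12 where e12: "exec (map_loop ''x'' ?xe) \<sigma>11 k12 \<sigma>12" and k12: "k12 \<le> n * rcost ?xe"
    and x12: "\<forall>i<n. reals \<sigma>12 ''x'' i = (1 - \<eta>) * x $ i + \<eta> * v $ i"
    unfolding runs_def by blast
  note f12 = frame_ints [OF exec_frame [OF e12]] frame_reals [OF exec_frame [OF e12]]
  have vc: "v \<in> carrier_vec n" "nnz v \<le> s" using v by (simp_all add: sparse_vecs_def)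
  have x': "read_vec n ''x'' \<sigma>12 = (1 - \<eta>) \<cdot>\<^sub>v x + \<eta> \<cdot>\<^sub>v v"
    using x12 xc vc by (intro eq_vecI) (auto simp: read_vec_def)
  have v': "read_vec n ''v'' \<sigma>12 = v"
    using v10' vc by (intro eq_vecI) (auto simp: read_vec_def f11 f12)
  have k5: "k5 \<le> n * 4" and k12: "k12 \<le> n * 5"
    using k5 k12 by simp_all
  have "fw_step n f g R \<beta> \<alpha> s x ((1 - \<eta>) \<cdot>\<^sub>v x + \<eta> \<cdot>\<^sub>v v)"
    unfolding fw_step_def using proj v \<eta>_def by blast
  moreover have "reals \<sigma>12 ''e'' 0 = \<eta>"
    using e11e by (simp add: f12)
  \<comment> \<open>With L = \<open>floorlog 2 s\<close>, the parts cost at most 19 n + 2 n L + 12 s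
    + 7. Since \<open>1 \<le> s \<le> n\<close> and \<open>1 \<le> L\<close>, this is at most 40 n
    L.\<close>
  moreover have "1 \<le> floorlog 2 s" using pos by (simp add: floorlog_def)
  then have "n \<le> n * floorlog 2 s" by simp
  then have "k1 + (k2 + (k3 + (k4 + (k5 + (k6 + (k7 + (k8 + (k9 + (k10 + (5 + k12)))))))))) \<le> 40 * n * floorlog 2 s"
    using k1 k2 k3 k4 k5 k6 k7 k8 k9 k10 k12 pos by linarith
  moreover have "exec step_program \<sigma> (k1 + (k2 + (k3 + (k4 + (k5 + (k6 + (k7 + (k8 + (k9 + (k10 + (5 + k12))))))))))) \<sigma>12"
    unfolding step_program_def
    by (intro exec.Seq [OF e1] exec.Seq [OF e2] exec.Seq [OF e3] exec.Seq [OF e4] exec.Seq [OF e5]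
        exec.Seq [OF e6] exec.Seq [OF e7] exec.Seq [OF e8] exec.Seq [OF e9] exec.Seq [OF e10]
        exec.Seq [OF e11] e12)
  ultimately show ?thesis
    unfolding runs_def using x' v' vc by metis
qed

section \<open>Quadratic objectives\<close>

text \<open>\<open>A\<close> need not be symmetric, so its symmetric part appears. The entry is
  found by differentiating along the \<open>i\<close>-th unit vector in two ways and using
  uniqueness of derivatives.\<close>

lemma quadratic_gradient:
  assumes q: "quadratic_fun n A b f" and G: "has_gradient n f G x" and x: "x \<in> carrier_vec n"
    and i: "i < n"
  shows "G $ i = b $ i + (\<Sum>q<n. (A $$ (i, q) + A $$ (q, i)) * x $ q / 2)"
proof -
  have A: "A \<in> carrier_mat n n" and b: "b \<in> carrier_vec n"
    and f: "\<And>y. y \<in> carrier_vec n \<Longrightarrow> f y = 1 / 2 * (y \<bullet> (A *\<^sub>v y)) + b \<bullet> y"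
    using q by (auto simp: quadratic_fun_def)
  have Gc: "G \<in> carrier_vec n" using G by (simp add: has_gradient_def)
  have f_sum: "f y = 1 / 2 * (\<Sum>j<n. \<Sum>k<n. A $$ (j, k) * y $ j * y $ k) + (\<Sum>j<n. b $ j * y $ j)"
    if y: "y \<in> carrier_vec n" for y
  proof -
    have "y \<bullet> (A *\<^sub>v y) = (\<Sum>j<n. y $ j * (A *\<^sub>v y) $ j)"
      using A y by (intro scalar_prod_sum mult_mat_vec_carrier)
    also have "\<dots> = (\<Sum>j<n. \<Sum>k<n. A $$ (j, k) * y $ j * y $ k)"
      using A y by (intro sum.cong refl) (simp add: scalar_prod_sum [OF y] sum_distrib_left mult_ac)
    finally show ?thesis
      by (simp add: f [OF y] scalar_prod_sum [OF y])
  qed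
  define \<delta> where "\<delta> j = (if j = i then 1 else 0 :: real)" for j
  let ?y = "\<lambda>t. x + t \<cdot>\<^sub>v unit_vec n i"
  have y: "?y t \<in> carrier_vec n" "\<And>j. j < n \<Longrightarrow> ?y t $ j = x $ j + t * \<delta> j" for t
    using x by (auto simp: \<delta>_def unit_vec_def)
  have fy: "f (?y t) = 1 / 2 * (\<Sum>j<n. \<Sum>k<n. A $$ (j, k) * (x $ j + t * \<delta> j) * (x $ k + t * \<delta> k))
      + (\<Sum>j<n. b $ j * (x $ j + t * \<delta> j))" for t
    unfolding f_sum [OF y(1)] by (simp add: y(2) del: index_add_vec)
  have quad: "((\<lambda>t. A $$ (j, k) * (x $ j + t * \<delta> j) * (x $ k + t * \<delta> k)) has_real_derivative
      A $$ (j, k) * \<delta> j * x $ k + A $$ (j, k) * x $ j * \<delta> k) (at 0)" for j k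
    by (auto intro!: derivative_eq_intros simp: algebra_simps)
  have lin: "((\<lambda>t. b $ j * (x $ j + t * \<delta> j)) has_real_derivative b $ j * \<delta> j) (at 0)" for j
    by (auto intro!: derivative_eq_intros)
  have "((\<lambda>t. f (?y t)) has_real_derivative
      1 / 2 * (\<Sum>j<n. \<Sum>k<n. A $$ (j, k) * \<delta> j * x $ k + A $$ (j, k) * x $ j * \<delta> k) + (\<Sum>j<n. b $ j * \<delta> j)) (at 0)"
    unfolding fy by (intro DERIV_add DERIV_cmult DERIV_sum quad lin)
  moreover have "((\<lambda>t. f (?y t)) has_real_derivative G \<bullet> unit_vec n i) (at 0)"
    by (rule has_gradient_deriv [OF G x]) simp
  ultimately have "G \<bullet> unit_vec n i
    = 1 / 2 * (\<Sum>j<n. \<Sum>k<n. A $$ (j, k) * \<delta> j * x $ k + A $$ (j, k) * x $ j * \<delta> k) + (\<Sum>j<n. b $ j * \<delta> j)"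
    by (rule DERIV_unique [rotated])
  moreover have "G \<bullet> unit_vec n i = G $ i" using Gc i by simp
  moreover have "(\<Sum>j<n. b $ j * \<delta> j) = b $ i"
    using i by (simp add: \<delta>_def if_distrib cong: if_cong)
  moreover have "(\<Sum>j<n. \<Sum>k<n. A $$ (j, k) * \<delta> j * x $ k) = (\<Sum>k<n. A $$ (i, k) * x $ k)"
  proof -
    have "(\<Sum>j<n. \<Sum>k<n. A $$ (j, k) * \<delta> j * x $ k) = (\<Sum>j<n. if j = i then \<Sum>k<n. A $$ (j, k) * x $ k else 0)"
      by (intro sum.cong refl) (simp add: \<delta>_def)
    then show ?thesis using i by simp
  qed
  moreover have "(\<Sum>j<n. \<Sum>k<n. A $$ (j, k) * x $ j * \<delta> k) = (\<Sum>j<n. A $$ (j, i) * x $ j)"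
    using i by (intro sum.cong refl) (simp add: \<delta>_def if_distrib cong: if_cong)
  ultimately show ?thesis
    by (simp add: sum.distrib sum_divide_distrib distrib_right add_divide_distrib)
qed

section \<open>Programs for the gradient of a quadratic\<close>

definition addmul_loop :: com where
  "addmul_loop = for_loop ''q'' ''n''
     (Cond (BNot (BAnd (BNot (RLess (RCell ''u'' (IVar ''q'')) (RNum 0))) (BNot (RLess (RNum 0) (RCell ''u'' (IVar ''q''))))))
       (map_loop ''grad'' (RPlus (RAt ''grad'') (RDiv (RTimes
         (RPlus (RCell ''A'' (IPlus (ITimes (IVar ''i'') (IVar ''n'')) (IVar ''q'')))
                (RCell ''A'' (IPlus (ITimes (IVar ''q'') (IVar ''n'')) (IVar ''i''))))
         (RCell ''u'' (IVar ''q''))) (RNum 2))))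
       Skip)"

lemma addmul_loop_writes [simp]:
  "int_writes addmul_loop = {''i'', ''q''}" "real_writes addmul_loop = {''grad''}"
  by (auto simp: addmul_loop_def)

text \<open>Going column by column makes a zero of \<open>u\<close> cost only its test: 4, for two
  strict comparisons with a charged constant 0 each. A nonzero entry adds 5 per row.\<close>

lemma runs_addmul_loop:
  assumes \<sigma>: "ints \<sigma> ''n'' 0 = n" "reals \<sigma> ''u'' = u" "reals \<sigma> ''A'' = A"
  shows "runs addmul_loop \<sigma> (\<lambda>k \<sigma>'. k \<le> 4 * n + 5 * n * card {q. q < n \<and> u q \<noteq> 0} \<and>
    (\<forall>i<n. reals \<sigma>' ''grad'' i = reals \<sigma> ''grad'' i + (\<Sum>q<n. (A (i * n + q) + A (q * n + i)) * u q / 2)))"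
proof -
  define I where "I r \<tau> \<longleftrightarrow>
    (\<forall>i<n. reals \<tau> ''grad'' i = reals \<sigma> ''grad'' i + (\<Sum>q<r. (A (i * n + q) + A (q * n + i)) * u q / 2))"
    for r and \<tau> :: mem
  define K where "K q = 4 + (if u q \<noteq> 0 then 5 * n else 0)" for q
  let ?e = "RPlus (RAt ''grad'') (RDiv (RTimes
         (RPlus (RCell ''A'' (IPlus (ITimes (IVar ''i'') (IVar ''n'')) (IVar ''q'')))
                (RCell ''A'' (IPlus (ITimes (IVar ''q'') (IVar ''n'')) (IVar ''i''))))
         (RCell ''u'' (IVar ''q''))) (RNum 2))"
  let ?c = "Cond (BNot (BAnd (BNot (RLess (RCell ''u'' (IVar ''q'')) (RNum 0))) (BNot (RLess (RNum 0) (RCell ''u'' (IVar ''q''))))))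
       (map_loop ''grad'' ?e) Skip"
  have "runs addmul_loop \<sigma> (\<lambda>k \<sigma>'. k \<le> (\<Sum>q<n. K q) \<and> I n \<sigma>')"
    unfolding addmul_loop_def
  proof (rule runs_for)
    fix r \<tau>
    assume r: "r < n" "ints \<tau> ''q'' 0 = r" and I: "I r \<tau>" and fr: "frame (for_loop ''q'' ''n'' ?c) \<sigma> \<tau>"
    have \<tau>: "reals \<tau> ''u'' = u" "reals \<tau> ''A'' = A" "ints \<tau> ''n'' 0 = n"
      using fr \<sigma> by (simp_all add: frame_reals frame_ints)
    have b: "bval (BNot (BAnd (BNot (RLess (RCell ''u'' (IVar ''q'')) (RNum 0))) (BNot (RLess (RNum 0) (RCell ''u'' (IVar ''q'')))))) \<tau>
        \<longleftrightarrow> u r \<noteq> 0"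
      using r \<tau> by auto
    have "runs (map_loop ''grad'' ?e) \<tau> (\<lambda>k \<tau>'. k \<le> n * rcost ?e \<and>
        (\<forall>i<n. reals \<tau>' ''grad'' i = reals \<tau> ''grad'' i + (A (i * n + r) + A (r * n + i)) * u r / 2))"
      by (rule runs_map_loop) (simp_all add: r \<tau>)
    then have m: "runs (map_loop ''grad'' ?e) \<tau> (\<lambda>k \<tau>'. k \<le> 5 * n \<and> I (Suc r) (put_int ''q'' 0 (Suc r) \<tau>'))"
      by (rule runs_mono) (use I in \<open>simp add: I_def\<close>)
    show "runs ?c \<tau> (\<lambda>k \<tau>'. k \<le> K r \<and> I (Suc r) (put_int ''q'' 0 (Suc r) \<tau>'))"
    proof (cases "u r = 0")
      case True
      then show ?thesis
        unfolding runs_Cond b using I by (simp add: runs_Skip K_def I_def)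
    next
      case False
      from m have "runs (map_loop ''grad'' ?e) \<tau> (\<lambda>k \<tau>'. 4 + k \<le> K r \<and> I (Suc r) (put_int ''q'' 0 (Suc r) \<tau>'))"
        by (rule runs_mono) (use False in \<open>simp add: K_def\<close>)
      moreover have "bcost (BNot (BAnd (BNot (RLess (RCell ''u'' (IVar ''q'')) (RNum 0))) (BNot (RLess (RNum 0) (RCell ''u'' (IVar ''q'')))))) = 4"
        by simp
      ultimately show ?thesis
        unfolding runs_Cond b using False by (simp only: if_True not_False_eq_True)
    qed
  qed (use \<sigma> in \<open>auto simp: I_def map_loop_def\<close>)
  moreover have "(\<Sum>q<n. K q) = 4 * n + 5 * n * card {q. q < n \<and> u q \<noteq> 0}"
  proof -
    have "{..<n} \<inter> {q. u q \<noteq> 0} = {q. q < n \<and> u q \<noteq> 0}" by auto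
    then show ?thesis by (simp add: K_def sum.distrib sum.If_cases)
  qed
  ultimately show ?thesis
    by (simp add: I_def)
qed

definition gradient_program :: com where
  "gradient_program = Seq (map_loop ''grad'' (RAt ''b'')) (Seq (map_loop ''u'' (RAt ''x'')) addmul_loop)"

lemma gradient_program_writes [simp]:
  "int_writes gradient_program = {''i'', ''q''}" "real_writes gradient_program = {''grad'', ''u''}"
  by (auto simp: gradient_program_def)

definition gradient_update :: com where
  "gradient_update = Seq (map_loop ''u'' (RTimes (RVar ''e'') (RAt ''v'')))
     (Seq (map_loop ''grad'' (RPlus (RTimes (RMinus (RNum 1) (RVar ''e'')) (RAt ''grad'')) (RTimes (RVar ''e'') (RAt ''b''))))
       addmul_loop)"

lemma gradient_update_writes [simp]:
  "int_writes gradient_update = {''i'', ''q''}" "real_writes gradient_update = {''grad'', ''u''}"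
  by (auto simp: gradient_update_def)

lemma runs_gradient_program:
  assumes n: "ints \<sigma> ''n'' 0 = n" and holds: "holds_quadratic n A b \<sigma>" and q: "quadratic_fun n A b f"
    and G: "has_gradient n f G (read_vec n ''x'' \<sigma>)"
  shows "runs gradient_program \<sigma> (\<lambda>k \<sigma>'. k \<le> 4 * n + 5 * n * nnz (read_vec n ''x'' \<sigma>) \<and>
    read_vec n ''grad'' \<sigma>' = G)"
proof -
  have A: "\<And>i j. i < n \<Longrightarrow> j < n \<Longrightarrow> reals \<sigma> ''A'' (i * n + j) = A $$ (i, j)"
    and b: "read_vec n ''b'' \<sigma> = b"
    using holds by (simp_all add: holds_quadratic_def)
  have bi: "reals \<sigma> ''b'' i = b $ i" if "i < n" for i
    using that by (simp add: b [symmetric] read_vec_def)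
  have "runs (map_loop ''grad'' (RAt ''b'')) \<sigma> (\<lambda>k \<sigma>'. k \<le> n * rcost (RAt ''b'') \<and> (\<forall>i<n. reals \<sigma>' ''grad'' i = b $ i))"
    by (rule runs_map_loop) (simp_all add: n bi)
  then obtain \<sigma>1 where e1: "exec (map_loop ''grad'' (RAt ''b'')) \<sigma> 0 \<sigma>1" and g1: "\<forall>i<n. reals \<sigma>1 ''grad'' i = b $ i"
    by (auto simp: runs_def)
  note f1 = frame_ints [OF exec_frame [OF e1]] frame_reals [OF exec_frame [OF e1]]
  have "runs (map_loop ''u'' (RAt ''x'')) \<sigma>1 (\<lambda>k \<sigma>'. k \<le> n * rcost (RAt ''x'') \<and> (\<forall>i<n. reals \<sigma>' ''u'' i = reals \<sigma> ''x'' i))"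
    by (rule runs_map_loop) (simp_all add: n f1)
  then obtain \<sigma>2 where e2: "exec (map_loop ''u'' (RAt ''x'')) \<sigma>1 0 \<sigma>2"
    and u2: "\<forall>i<n. reals \<sigma>2 ''u'' i = reals \<sigma> ''x'' i"
    by (auto simp: runs_def)
  note f2 = frame_ints [OF exec_frame [OF e2]] frame_reals [OF exec_frame [OF e2]]
  define u where "u = reals \<sigma>2 ''u''"
  obtain k3 \<sigma>3 where e3: "exec addmul_loop \<sigma>2 k3 \<sigma>3" and k3: "k3 \<le> 4 * n + 5 * n * card {q. q < n \<and> u q \<noteq> 0}"
    and g3: "\<forall>i<n. reals \<sigma>3 ''grad'' i = reals \<sigma>2 ''grad'' i
      + (\<Sum>q<n. (reals \<sigma> ''A'' (i * n + q) + reals \<sigma> ''A'' (q * n + i)) * u q / 2)"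
    using runs_addmul_loop [of \<sigma>2 n u "reals \<sigma> ''A''"] n by (auto simp: runs_def f1 f2 u_def)
  have "{q. q < n \<and> u q \<noteq> 0} = {q. q < n \<and> reals \<sigma> ''x'' q \<noteq> 0}"
    using u2 by (auto simp: u_def)
  also have "card \<dots> = nnz (read_vec n ''x'' \<sigma>)"
    unfolding nnz_def by (rule arg_cong [of _ _ card]) (auto simp: read_vec_def)
  finally have k3': "k3 \<le> 4 * n + 5 * n * nnz (read_vec n ''x'' \<sigma>)"
    using k3 by simp
  have "reals \<sigma>3 ''grad'' i = G $ i" if "i < n" for i
  proof -
    have "(\<Sum>q<n. (reals \<sigma> ''A'' (i * n + q) + reals \<sigma> ''A'' (q * n + i)) * u q / 2)
        = (\<Sum>q<n. (A $$ (i, q) + A $$ (q, i)) * read_vec n ''x'' \<sigma> $ q / 2)"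
      using A that u2 by (intro sum.cong refl) (simp add: u_def read_vec_def)
    then show ?thesis
      using quadratic_gradient [OF q G _ that] g1 g3 that by (simp add: f2 read_vec_def)
  qed
  moreover have "G \<in> carrier_vec n" using G by (simp add: has_gradient_def)
  ultimately have "read_vec n ''grad'' \<sigma>3 = G"
    by (intro eq_vecI) (auto simp: read_vec_def)
  moreover have "exec gradient_program \<sigma> (0 + (0 + k3)) \<sigma>3"
    unfolding gradient_program_def by (intro exec.Seq [OF e1] exec.Seq [OF e2] e3)
  ultimately show ?thesis
    unfolding runs_def using k3' by auto
qed

text \<open>The gradient is affine: its new value is \<open>(1 - \<eta>) * g x + \<eta> * b\<close>
  plus the linear part applied to \<open>\<eta> * v\<close>, where only nonzero entries of
  \<open>v\<close> cost a column. The 10 is 1 + 5 + 4, for filling \<open>u\<close>, rescaling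
  \<open>grad\<close> and the zero tests.\<close>

lemma runs_gradient_update:
  assumes n: "ints \<sigma> ''n'' 0 = n" and holds: "holds_quadratic n A b \<sigma>" and q: "quadratic_fun n A b f"
    and C1: "C1_with_gradient n f g" and e: "reals \<sigma> ''e'' 0 = \<eta>" and x: "x \<in> carrier_vec n"
    and grad: "read_vec n ''grad'' \<sigma> = g x"
  defines "v \<equiv> read_vec n ''v'' \<sigma>"
  shows "runs gradient_update \<sigma> (\<lambda>k \<sigma>'. k \<le> 10 * n + 5 * n * nnz v \<and>
    read_vec n ''grad'' \<sigma>' = g ((1 - \<eta>) \<cdot>\<^sub>v x + \<eta> \<cdot>\<^sub>v v))"
proof -
  have A: "\<And>i j. i < n \<Longrightarrow> j < n \<Longrightarrow> reals \<sigma> ''A'' (i * n + j) = A $$ (i, j)"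
    and b: "read_vec n ''b'' \<sigma> = b"
    using holds by (simp_all add: holds_quadratic_def)
  have bi: "reals \<sigma> ''b'' i = b $ i" if "i < n" for i
    using that by (simp add: b [symmetric] read_vec_def)
  have vi: "reals \<sigma> ''v'' i = v $ i" if "i < n" for i
    using that by (simp add: v_def read_vec_def)
  have vc: "v \<in> carrier_vec n" by (simp add: v_def read_vec_def)
  have gi: "reals \<sigma> ''grad'' i = g x $ i" if "i < n" for i
    using that by (simp add: grad [symmetric] read_vec_def)
  have G: "has_gradient n f (g y) y" if "y \<in> carrier_vec n" for y
    using C1 that by (simp add: C1_with_gradient_def)
  let ?ue = "RTimes (RVar ''e'') (RAt ''v'')"
  have "runs (map_loop ''u'' ?ue) \<sigma> (\<lambda>k \<sigma>'. k \<le> n * rcost ?ue \<and> (\<forall>i<n. reals \<sigma>' ''u'' i = \<eta> * v $ i))"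
    by (rule runs_map_loop) (simp_all add: n e vi)
  then obtain k1 \<sigma>1 where e1: "exec (map_loop ''u'' ?ue) \<sigma> k1 \<sigma>1" and k1: "k1 \<le> n"
    and u1: "\<forall>i<n. reals \<sigma>1 ''u'' i = \<eta> * v $ i"
    by (auto simp: runs_def)
  note f1 = frame_ints [OF exec_frame [OF e1]] frame_reals [OF exec_frame [OF e1]]
  let ?ge = "RPlus (RTimes (RMinus (RNum 1) (RVar ''e'')) (RAt ''grad'')) (RTimes (RVar ''e'') (RAt ''b''))"
  have "runs (map_loop ''grad'' ?ge) \<sigma>1 (\<lambda>k \<sigma>'. k \<le> n * rcost ?ge \<and>
      (\<forall>i<n. reals \<sigma>' ''grad'' i = (1 - \<eta>) * g x $ i + \<eta> * b $ i))"
    by (rule runs_map_loop) (simp_all add: n f1 e gi bi)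
  then obtain k2 \<sigma>2 where e2: "exec (map_loop ''grad'' ?ge) \<sigma>1 k2 \<sigma>2" and k2: "k2 \<le> n * 5"
    and g2: "\<forall>i<n. reals \<sigma>2 ''grad'' i = (1 - \<eta>) * g x $ i + \<eta> * b $ i"
    by (auto simp: runs_def)
  note f2 = frame_ints [OF exec_frame [OF e2]] frame_reals [OF exec_frame [OF e2]]
  define u where "u = reals \<sigma>1 ''u''"
  obtain k3 \<sigma>3 where e3: "exec addmul_loop \<sigma>2 k3 \<sigma>3" and k3: "k3 \<le> 4 * n + 5 * n * card {q. q < n \<and> u q \<noteq> 0}"
    and g3: "\<forall>i<n. reals \<sigma>3 ''grad'' i = reals \<sigma>2 ''grad'' i
      + (\<Sum>q<n. (reals \<sigma> ''A'' (i * n + q) + reals \<sigma> ''A'' (q * n + i)) * u q / 2)"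
    using runs_addmul_loop [of \<sigma>2 n u "reals \<sigma> ''A''"] n by (auto simp: runs_def f1 f2 u_def)
  have "card {q. q < n \<and> u q \<noteq> 0} \<le> nnz v"
    unfolding nnz_def using vc u1 by (intro card_mono) (auto simp: u_def)
  then have "5 * n * card {q. q < n \<and> u q \<noteq> 0} \<le> 5 * n * nnz v" by simp
  then have k: "k1 + (k2 + k3) \<le> 10 * n + 5 * n * nnz v"
    using k1 k2 k3 by linarith
  let ?x = "(1 - \<eta>) \<cdot>\<^sub>v x + \<eta> \<cdot>\<^sub>v v"
  have xc: "?x \<in> carrier_vec n" using x vc by simp
  have "reals \<sigma>3 ''grad'' i = g ?x $ i" if i: "i < n" for i
  proof -
    let ?M = "\<lambda>q. A $$ (i, q) + A $$ (q, i)"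
    have "(\<Sum>q<n. ?M q * ?x $ q / 2) = (\<Sum>q<n. (1 - \<eta>) * (?M q * x $ q / 2) + ?M q * (\<eta> * v $ q) / 2)"
      using x vc by (intro sum.cong refl) (simp add: field_simps)
    also have "\<dots> = (1 - \<eta>) * (\<Sum>q<n. ?M q * x $ q / 2) + (\<Sum>q<n. ?M q * (\<eta> * v $ q) / 2)"
      by (simp add: sum.distrib sum_distrib_left)
    finally have "g ?x $ i = (1 - \<eta>) * g x $ i + \<eta> * b $ i + (\<Sum>q<n. ?M q * (\<eta> * v $ q) / 2)"
      unfolding quadratic_gradient [OF q G [OF xc] xc i] quadratic_gradient [OF q G [OF x] x i]
      by (simp add: algebra_simps)
    moreover have "(\<Sum>q<n. (reals \<sigma> ''A'' (i * n + q) + reals \<sigma> ''A'' (q * n + i)) * u q / 2)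
        = (\<Sum>q<n. ?M q * (\<eta> * v $ q) / 2)"
      using A i u1 by (intro sum.cong refl) (simp add: u_def)
    ultimately show ?thesis
      using g2 g3 i by simp
  qed
  moreover have "g ?x \<in> carrier_vec n" using G [OF xc] by (simp add: has_gradient_def)
  ultimately have "read_vec n ''grad'' \<sigma>3 = g ?x"
    by (intro eq_vecI) (auto simp: read_vec_def)
  moreover have "exec gradient_update \<sigma> (k1 + (k2 + k3)) \<sigma>3"
    unfolding gradient_update_def by (intro exec.Seq [OF e1] exec.Seq [OF e2] e3)
  ultimately show ?thesis
    unfolding runs_def using k by blast
qed

section \<open>Runs of the programs\<close>

lemma floorlog_le_self: "floorlog 2 s \<le> s"
  by (simp add: floorlog_le_iff less_exp)

text \<open>Since ln 2 is at least 1/2, dividing by it at most doubles, and both ln s and ln 2 are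
  at most ln (s + 1). The shift by 1 keeps the bound positive at s = 1.\<close>

lemma floorlog_le_ln:
  assumes "1 \<le> s"
  shows "real (floorlog 2 s) \<le> 4 * ln (real s + 1)"
proof -
  have "ln (1 / 2 :: real) \<le> 1 / 2 - 1" by (rule ln_le_minus_one) simp
  then have ln2: "1 / 2 \<le> ln (2 :: real)" by (simp add: ln_div)
  have ln_s: "0 \<le> ln (real s)" "ln (real s) \<le> ln (real s + 1)" "ln 2 \<le> ln (real s + 1)"
    using assms by simp_all
  have "real (floorlog 2 s) \<le> log 2 (real s) + 1"
    using assms by (simp add: floorlog_def)
  also have "\<dots> = (ln (real s) + ln 2) / ln 2"
    using ln2 by (simp add: log_def add_divide_distrib)
  also have "\<dots> \<le> (ln (real s) + ln 2) / (1 / 2)"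
    using ln2 ln_s by (intro divide_left_mono) auto
  also have "\<dots> \<le> 4 * ln (real s + 1)"
  proof -
    have "(a + b) / (1 / 2) \<le> 4 * c" if "a \<le> c" "b \<le> c" for a b c :: real
      using that by simp
    then show ?thesis using ln_s(2,3) .
  qed
  finally show ?thesis .
qed

lemma holds_input_frame:
  assumes "holds_input n R \<beta> \<alpha> s \<sigma>" "frame c \<sigma> \<sigma>'"
    and "''n'' \<notin> int_writes c" "''s'' \<notin> int_writes c"
    and "''R'' \<notin> real_writes c" "''beta'' \<notin> real_writes c" "''alpha'' \<notin> real_writes c"
    and "read_vec n ''x'' \<sigma>' \<in> l1_ball n R"
  shows "holds_input n R \<beta> \<alpha> s \<sigma>'"
  using assms by (simp add: holds_input_def frame_ints frame_reals)

lemma holds_quadratic_frame: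
  assumes "holds_quadratic n A b \<sigma>" "frame c \<sigma> \<sigma>'" "''A'' \<notin> real_writes c" "''b'' \<notin> real_writes c"
  shows "holds_quadratic n A b \<sigma>'"
  using assms by (simp add: holds_quadratic_def read_vec_def frame_reals)

lemma read_vec_frame:
  "frame c \<sigma> \<sigma>' \<Longrightarrow> a \<notin> real_writes c \<Longrightarrow> read_vec n a \<sigma>' = read_vec n a \<sigma>"
  by (simp add: read_vec_def frame_reals)

lemma write_vec_simps:
  "ints (write_vec a v \<sigma>) = ints \<sigma>"
  "b \<noteq> a \<Longrightarrow> reals (write_vec a v \<sigma>) b = reals \<sigma> b"
  "b \<noteq> a \<Longrightarrow> read_vec n b (write_vec a v \<sigma>) = read_vec n b \<sigma>"
  "v \<in> carrier_vec n \<Longrightarrow> read_vec n a (write_vec a v \<sigma>) = v"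
  by (auto simp: write_vec_def read_vec_def)

context sparse_problem
begin

text \<open>\<open>holds_input\<close> includes feasibility of the current iterate, so it serves as
  the invariant of the run.\<close>

lemma oracle_step:
  assumes inp: "holds_input n R \<beta> \<alpha> s \<sigma>"
  shows "\<exists>\<sigma>'. holds_input n R \<beta> \<alpha> s \<sigma>' \<and>
    (\<exists>k. exec step_program (write_vec ''grad'' (g (read_vec n ''x'' \<sigma>)) \<sigma>) k \<sigma>' \<and>
      real k \<le> 200 * real n * ln (real s + 1)) \<and>
    fw_step n f g R \<beta> \<alpha> s (read_vec n ''x'' \<sigma>) (read_vec n ''x'' \<sigma>')"
proof -
  let ?x = "read_vec n ''x'' \<sigma>"
  let ?\<tau> = "write_vec ''grad'' (g ?x) \<sigma>"
  have inp': "holds_input n R \<beta> \<alpha> s ?\<tau>"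
    using inp by (simp add: holds_input_def write_vec_simps)
  have "g (read_vec n ''x'' ?\<tau>) = read_vec n ''grad'' ?\<tau>"
    using gradient_carrier [of ?x] by (simp add: write_vec_simps)
  from runs_step_program [where f = f and g = g, OF inp' s_pos s_le R_pos \<beta>_pos \<alpha>_pos this]
  obtain k \<sigma>' where e: "exec step_program ?\<tau> k \<sigma>'" and k: "k \<le> 40 * n * floorlog 2 s"
    and step: "fw_step n f g R \<beta> \<alpha> s ?x (read_vec n ''x'' \<sigma>')"
    by (auto simp: runs_def write_vec_simps)
  have "?x \<in> l1_ball n R" using inp by (simp add: holds_input_def)
  then have "holds_input n R \<beta> \<alpha> s \<sigma>'"
    using fw_step_feasible step by (intro holds_input_frame [OF inp' exec_frame [OF e]]) auto
  moreover have "real k \<le> 200 * real n * ln (real s + 1)"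
  proof -
    have "real k \<le> real (40 * n * floorlog 2 s)" using k by (simp only: of_nat_le_iff)
    also have "\<dots> = 40 * real n * real (floorlog 2 s)" by simp
    also have "\<dots> \<le> 40 * real n * (4 * ln (real s + 1))"
      using floorlog_le_ln [OF s_pos] by (intro mult_left_mono) auto
    also have "\<dots> \<le> 200 * real n * ln (real s + 1)"
      using mult_right_mono [of "160 :: real" 200 "real n * ln (real s + 1)"] by simp
    finally show ?thesis .
  qed
  ultimately show ?thesis using e step by blast
qed

text \<open>Dependent choice over \<open>oracle_step\<close>; the clause for \<open>t = 0\<close> in
  the invariant pins down the initial memory.\<close>

lemma ex_oracle_run:
  assumes "holds_input n R \<beta> \<alpha> s \<sigma>0"
  shows "\<exists>\<sigma>. \<sigma> 0 = \<sigma>0 \<and> oracle_run step_program n g (200 * real n * ln (real s + 1)) \<sigma> \<and>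
    fw_run n f g R \<beta> \<alpha> s (\<lambda>t. read_vec n ''x'' (\<sigma> t))"
proof -
  have "\<exists>\<sigma>. \<forall>t. (holds_input n R \<beta> \<alpha> s (\<sigma> t) \<and> (t = 0 \<longrightarrow> \<sigma> t = \<sigma>0)) \<and>
    ((\<exists>k. exec step_program (write_vec ''grad'' (g (read_vec n ''x'' (\<sigma> t))) (\<sigma> t)) k (\<sigma> (Suc t)) \<and>
      real k \<le> 200 * real n * ln (real s + 1)) \<and>
    fw_step n f g R \<beta> \<alpha> s (read_vec n ''x'' (\<sigma> t)) (read_vec n ''x'' (\<sigma> (Suc t))))"
    by (rule dependent_nat_choice) (use assms oracle_step in auto)
  then obtain \<sigma> where "\<And>t. holds_input n R \<beta> \<alpha> s (\<sigma> t)" "\<sigma> 0 = \<sigma>0"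
    "\<And>t. \<exists>k. exec step_program (write_vec ''grad'' (g (read_vec n ''x'' (\<sigma> t))) (\<sigma> t)) k (\<sigma> (Suc t)) \<and>
      real k \<le> 200 * real n * ln (real s + 1)"
    "\<And>t. fw_step n f g R \<beta> \<alpha> s (read_vec n ''x'' (\<sigma> t)) (read_vec n ''x'' (\<sigma> (Suc t)))"
    by blast
  then show ?thesis
    using assms by (intro exI [of _ \<sigma>]) (simp add: oracle_run_def fw_run_def holds_input_def)
qed

text \<open>Here the invariant also says that \<open>grad\<close> holds the gradient at the current
  iterate, which replaces the oracle.\<close>

lemma quadratic_step:
  assumes q: "quadratic_fun n A b f" and inp: "holds_input n R \<beta> \<alpha> s \<sigma>"
    and mat: "holds_quadratic n A b \<sigma>" and grad: "read_vec n ''grad'' \<sigma> = g (read_vec n ''x'' \<sigma>)"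
  shows "\<exists>\<sigma>'. (holds_input n R \<beta> \<alpha> s \<sigma>' \<and> holds_quadratic n A b \<sigma>' \<and>
      read_vec n ''grad'' \<sigma>' = g (read_vec n ''x'' \<sigma>')) \<and>
    (\<exists>k. exec (Seq step_program gradient_update) \<sigma> k \<sigma>' \<and> real k \<le> 200 * real s * real n) \<and>
    fw_step n f g R \<beta> \<alpha> s (read_vec n ''x'' \<sigma>) (read_vec n ''x'' \<sigma>')"
proof -
  let ?x = "read_vec n ''x'' \<sigma>"
  from runs_step_program [where f = f and g = g, OF inp s_pos s_le R_pos \<beta>_pos \<alpha>_pos grad [symmetric]]
  obtain k \<tau> where e: "exec step_program \<sigma> k \<tau>" and k: "k \<le> 40 * n * floorlog 2 s"
    and \<tau>: "reals \<tau> ''e'' 0 = \<eta>" "nnz (read_vec n ''v'' \<tau>) \<le> s"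
      "read_vec n ''x'' \<tau> = (1 - \<eta>) \<cdot>\<^sub>v ?x + \<eta> \<cdot>\<^sub>v read_vec n ''v'' \<tau>"
    and step: "fw_step n f g R \<beta> \<alpha> s ?x (read_vec n ''x'' \<tau>)"
    by (auto simp: runs_def)
  note fr = exec_frame [OF e]
  have "?x \<in> l1_ball n R" using inp by (simp add: holds_input_def)
  then have xb: "read_vec n ''x'' \<tau> \<in> l1_ball n R"
    using fw_step_feasible step by blast
  have inp\<tau>: "holds_input n R \<beta> \<alpha> s \<tau>"
    using xb by (intro holds_input_frame [OF inp fr]) auto
  have mat\<tau>: "holds_quadratic n A b \<tau>"
    by (rule holds_quadratic_frame [OF mat fr]) auto
  have "read_vec n ''grad'' \<tau> = g ?x"
    using grad by (simp add: read_vec_frame [OF fr])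
  moreover have "ints \<tau> ''n'' 0 = n" using inp\<tau> by (simp add: holds_input_def)
  ultimately have "runs gradient_update \<tau> (\<lambda>k \<sigma>'. k \<le> 10 * n + 5 * n * nnz (read_vec n ''v'' \<tau>) \<and>
    read_vec n ''grad'' \<sigma>' = g ((1 - \<eta>) \<cdot>\<^sub>v ?x + \<eta> \<cdot>\<^sub>v read_vec n ''v'' \<tau>))"
    using mat\<tau> q C1 \<tau>(1) by (intro runs_gradient_update) auto
  then obtain l \<sigma>' where e': "exec gradient_update \<tau> l \<sigma>'" and l: "l \<le> 10 * n + 5 * n * nnz (read_vec n ''v'' \<tau>)"
    and grad': "read_vec n ''grad'' \<sigma>' = g (read_vec n ''x'' \<tau>)"
    unfolding \<tau>(3) by (auto simp: runs_def)
  note fr' = exec_frame [OF e']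
  have x': "read_vec n ''x'' \<sigma>' = read_vec n ''x'' \<tau>"
    by (simp add: read_vec_frame [OF fr'])
  have "holds_input n R \<beta> \<alpha> s \<sigma>'"
    using xb x' by (intro holds_input_frame [OF inp\<tau> fr']) auto
  moreover have "holds_quadratic n A b \<sigma>'"
    by (rule holds_quadratic_frame [OF mat\<tau> fr']) auto
  moreover have "real (k + l) \<le> 200 * real s * real n"
  proof -
    have "k \<le> 40 * n * s"
      using k floorlog_le_self [of s] by (meson le_trans mult_le_mono2)
    moreover have "5 * n * nnz (read_vec n ''v'' \<tau>) \<le> 5 * n * s" using \<tau>(2) by simp
    moreover have "10 * n \<le> 10 * (n * s)" using s_pos by simp
    moreover have "0 \<le> n * s" by simp
    \<comment> \<open>In fact 40 + 10 + 5 = 55 would do.\<close>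
    ultimately have "k + l \<le> 200 * (n * s)"
      using l by linarith
    then have "real (k + l) \<le> real (200 * (n * s))" by (simp only: of_nat_le_iff)
    then show ?thesis by (simp add: mult_ac)
  qed
  then have "\<exists>k. exec (Seq step_program gradient_update) \<sigma> k \<sigma>' \<and> real k \<le> 200 * real s * real n"
    using exec.Seq [OF e e'] by blast
  ultimately show ?thesis
    using grad' x' step by auto
qed

lemma ex_quadratic_run:
  assumes q: "quadratic_fun n A b f" and inp: "holds_input n R \<beta> \<alpha> s \<sigma>0"
    and mat: "holds_quadratic n A b \<sigma>0"
  shows "\<exists>\<sigma> k. exec gradient_program \<sigma>0 k (\<sigma> 0) \<and>
    real k \<le> 200 * real n * (real (nnz (read_vec n ''x'' \<sigma>0)) + 1) \<and>
    read_vec n ''x'' (\<sigma> 0) = read_vec n ''x'' \<sigma>0 \<and>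
    plain_run (Seq step_program gradient_update) (200 * real s * real n) \<sigma> \<and>
    fw_run n f g R \<beta> \<alpha> s (\<lambda>t. read_vec n ''x'' (\<sigma> t))"
proof -
  have "ints \<sigma>0 ''n'' 0 = n" using inp by (simp add: holds_input_def)
  from runs_gradient_program [OF this mat q gradient [of "read_vec n ''x'' \<sigma>0"]]
  obtain k \<tau> where e: "exec gradient_program \<sigma>0 k \<tau>"
    and k: "k \<le> 4 * n + 5 * n * nnz (read_vec n ''x'' \<sigma>0)"
    and grad: "read_vec n ''grad'' \<tau> = g (read_vec n ''x'' \<sigma>0)"
    by (auto simp: runs_def)
  note fr = exec_frame [OF e]
  have x: "read_vec n ''x'' \<tau> = read_vec n ''x'' \<sigma>0"
    by (simp add: read_vec_frame [OF fr])
  have inp\<tau>: "holds_input n R \<beta> \<alpha> s \<tau>"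
    using inp x by (intro holds_input_frame [OF inp fr]) (auto simp: holds_input_def)
  have mat\<tau>: "holds_quadratic n A b \<tau>"
    by (rule holds_quadratic_frame [OF mat fr]) auto
  define J where "J \<sigma> \<longleftrightarrow> holds_input n R \<beta> \<alpha> s \<sigma> \<and> holds_quadratic n A b \<sigma> \<and>
      read_vec n ''grad'' \<sigma> = g (read_vec n ''x'' \<sigma>)" for \<sigma>
  have "\<exists>\<sigma>. \<forall>t. (J (\<sigma> t) \<and> (t = 0 \<longrightarrow> \<sigma> t = \<tau>)) \<and>
    ((\<exists>k. exec (Seq step_program gradient_update) (\<sigma> t) k (\<sigma> (Suc t)) \<and> real k \<le> 200 * real s * real n) \<and>
    fw_step n f g R \<beta> \<alpha> s (read_vec n ''x'' (\<sigma> t)) (read_vec n ''x'' (\<sigma> (Suc t))))"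
  proof (rule dependent_nat_choice)
    show "\<exists>\<sigma>. J \<sigma> \<and> ((0::nat) = 0 \<longrightarrow> \<sigma> = \<tau>)"
      using inp\<tau> mat\<tau> grad x by (simp add: J_def)
    fix \<sigma> :: mem and t :: nat
    assume "J \<sigma> \<and> (t = 0 \<longrightarrow> \<sigma> = \<tau>)"
    then show "\<exists>\<sigma>'. (J \<sigma>' \<and> (Suc t = 0 \<longrightarrow> \<sigma>' = \<tau>)) \<and>
      ((\<exists>k. exec (Seq step_program gradient_update) \<sigma> k \<sigma>' \<and> real k \<le> 200 * real s * real n) \<and>
      fw_step n f g R \<beta> \<alpha> s (read_vec n ''x'' \<sigma>) (read_vec n ''x'' \<sigma>'))"
      using quadratic_step [OF q, of \<sigma>] by (simp add: J_def)
  qed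
  then obtain \<sigma> where J: "\<And>t. J (\<sigma> t)" and \<sigma>: "\<sigma> 0 = \<tau>"
    "\<And>t. \<exists>k. exec (Seq step_program gradient_update) (\<sigma> t) k (\<sigma> (Suc t)) \<and> real k \<le> 200 * real s * real n"
    "\<And>t. fw_step n f g R \<beta> \<alpha> s (read_vec n ''x'' (\<sigma> t)) (read_vec n ''x'' (\<sigma> (Suc t)))"
    by blast
  have "real k \<le> real (4 * n + 5 * n * nnz (read_vec n ''x'' \<sigma>0))"
    using k by (simp only: of_nat_le_iff)
  also have "\<dots> \<le> 200 * real n * (real (nnz (read_vec n ''x'' \<sigma>0)) + 1)"
    by (simp add: algebra_simps)
  finally show ?thesis
    using e x \<sigma> inp by (intro exI [of _ \<sigma>] exI [of _ k]) (simp add: plain_run_def fw_run_def holds_input_def)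
qed

end

theorem corollary1:
  shows "\<exists>(C :: real) (step :: com) (qsetup :: com) (qstep :: com). C > 0 \<and>
    (\<forall>(n :: nat) (s :: nat) (R :: real) (\<beta> :: real) (\<alpha> :: real) (f :: rvec \<Rightarrow> real) (g :: rvec \<Rightarrow> rvec).
       1 \<le> s \<longrightarrow> s \<le> n \<longrightarrow> R > 0 \<longrightarrow> \<beta> > 0 \<longrightarrow> \<alpha> > 0 \<longrightarrow>
       convex_fun n f \<longrightarrow> C1_with_gradient n f g \<longrightarrow>
       gradient_lipschitz n R g \<beta> \<longrightarrow> quadratic_growth n R f \<alpha> \<longrightarrow>
       (\<forall>xs\<in>minimizers n R f. nnz xs \<le> s \<and> l1 xs = R) \<longrightarrow>
       eta \<beta> \<alpha> s \<in> {0..1} \<longrightarrow>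
       (\<forall>x. fw_run n f g R \<beta> \<alpha> s x \<longrightarrow>
          (\<forall>\<epsilon>>0. \<forall>t::nat.
             real t \<ge> C * (\<beta> * real s / \<alpha>) * ln ((f (x 0) - opt_value n R f) / \<epsilon>) \<longrightarrow>
             approx_solution n R f \<epsilon> (x t))) \<and>
       (\<forall>\<sigma>0. holds_input n R \<beta> \<alpha> s \<sigma>0 \<longrightarrow>
          (\<exists>\<sigma>. \<sigma> 0 = \<sigma>0 \<and>
             oracle_run step n g (C * real n * ln (real s + 1)) \<sigma> \<and>
             fw_run n f g R \<beta> \<alpha> s (\<lambda>t. read_vec n ''x'' (\<sigma> t)))) \<and>
       (\<forall>A b \<sigma>0. quadratic_fun n A b f \<longrightarrow>
          holds_input n R \<beta> \<alpha> s \<sigma>0 \<longrightarrow> holds_quadratic n A b \<sigma>0 \<longrightarrow>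
          (\<exists>\<sigma> k. exec qsetup \<sigma>0 k (\<sigma> 0) \<and>
             real k \<le> C * real n * (real (nnz (read_vec n ''x'' \<sigma>0)) + 1) \<and>
             read_vec n ''x'' (\<sigma> 0) = read_vec n ''x'' \<sigma>0 \<and>
             plain_run qstep (C * real s * real n) \<sigma> \<and>
             fw_run n f g R \<beta> \<alpha> s (\<lambda>t. read_vec n ''x'' (\<sigma> t)))))"
\<comment> \<open>The programs read n and s from memory, so one choice serves all instances. The
  constant 200 exceeds 77 (iterations), 40 * 4 = 160 (oracle iteration) and 55 (quadratic
  iteration), as well as the factor 5 of the setup.\<close>
proof (rule exI [of _ "200 :: real"], rule exI [of _ step_program], rule exI [of _ gradient_program],
    rule exI [of _ "Seq step_program gradient_update"], rule conjI, goal_cases)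
  case 1
  show ?case by simp
next
  case 2
  show ?case
  proof (intro allI impI, goal_cases)
    case (1 n s R \<beta> \<alpha> f g)
    then have "sparse_problem n s R \<beta> \<alpha> f g"
      by unfold_locales
    then show ?case
      using sparse_problem.fw_run_iterations [where C = 200] sparse_problem.ex_oracle_run
        sparse_problem.ex_quadratic_run
      by (intro conjI allI impI) simp_all
  qed
qed

end
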